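(* Suppose $\alpha>-1$ and $\varphi\in H^\infty_1$, i.e. $\varphi$ is an analytic function on the unit disk $\mathbb{D}$ with $\sup_{z\in\mathbb{D}}|\varphi(z)|\le1$. Then the following conditions are equivalent. (a) The operator $E^\alpha_\varphi=I-T_\varphi T_\varphi^*$ is compact on $A^2_\alpha$. (b) The function $\varphi$ is a finite Blaschke product. (c) The range of $E^\alpha_\varphi$ (on $A^2_\alpha$) equals $A^2_{\alpha-2}$. (d) The range of $E^\alpha_\varphi$ (on $A^2_\alpha$) is contained in $A^2_{\alpha-2}$.
   Context: For any real $\gamma$, $A^2_\gamma$ denotes the space of analytic functions $f$ on $\mathbb{D}$ such that $\int_{\mathbb{D}}(1-|z|^2)^{2k+\gamma}|f^{(k)}(z)|^2\,dA(z)<\infty$, where $k$ is any non-negative integer with $2k+\gamma>-1$ (the space does not depend on the choice of $k$) and $dA$ is normalized area measure on $\mathbb{D}$. For $\alpha>-1$, $A^2_\alpha$ is the weighted Bergman space with the inner product of $L^2(\mathbb{D},dA_\alpha)$, where $dA_\alpha(z)=(\alpha+1)(1-|z|^2)^\alpha\,dA(z)$. $T_\varphi$ is multiplication by $\varphi$ on $A^2_\alpha$ (a contraction) and $T_\varphi^*$ is its adjoint on $A^2_\alpha$. A finite Blaschke product is a unimodular constant times a finite product of Möbius maps $\frac{a-z}{1-\overline{a}z}$, $a\in\mathbb{D}$.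
   Formalization: For φ a unimodular constant, E = 0, so (a), (b), (d) hold but (c) fails, since the range {0} is not A²_{α-2}; the equivalence with (c) is therefore stated only for φ not a unimodular constant, while (a), (b), (d) are equivalent for all φ. *)

theory Defs
  imports "HOL-Analysis.Analysis"
begin

abbreviation unit_disc :: "complex set" where
  "unit_disc \<equiv> ball 0 1"

definition area :: "complex measure" where
  "area = uniform_measure lborel unit_disc"

definition weighted_area :: "real \<Rightarrow> complex measure" where
  "weighted_area \<alpha> = density area (\<lambda>z. ennreal ((\<alpha> + 1) * (1 - (cmod z)\<^sup>2) powr \<alpha>))"

text \<open>
  Functions on the disc are represented by functions on the plane that vanish off the disc, so
  that equality of functions on the disc is equality in HOL. The integral condition is known not to
  depend on the admissible \<open>k\<close>; it is required here for all of them. For \<open>\<gamma> > -1\<close> the value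
  \<open>k = 0\<close> is admissible and gives square integrability with respect to \<open>weighted_area \<gamma>\<close>.
\<close>

definition A2 :: "real \<Rightarrow> (complex \<Rightarrow> complex) set" where
  "A2 \<gamma> = {f. f holomorphic_on unit_disc \<and> (\<forall>z. z \<notin> unit_disc \<longrightarrow> f z = 0) \<and>
     (\<forall>k::nat. 2 * real k + \<gamma> > -1 \<longrightarrow>
        (\<integral>\<^sup>+z\<in>unit_disc. ennreal ((1 - (cmod z)\<^sup>2) powr (2 * real k + \<gamma>)
            * (cmod ((deriv ^^ k) f z))\<^sup>2) \<partial>area) < \<infinity>)}"

definition bergman_inner :: "real \<Rightarrow> (complex \<Rightarrow> complex) \<Rightarrow> (complex \<Rightarrow> complex) \<Rightarrow> complex" where
  "bergman_inner \<alpha> f g = (LINT z|weighted_area \<alpha>. f z * cnj (g z))"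

definition bergman_dist :: "real \<Rightarrow> (complex \<Rightarrow> complex) \<Rightarrow> (complex \<Rightarrow> complex) \<Rightarrow> real" where
  "bergman_dist \<alpha> f g = sqrt (Re (bergman_inner \<alpha> (\<lambda>z. f z - g z) (\<lambda>z. f z - g z)))"

definition mult_op :: "(complex \<Rightarrow> complex) \<Rightarrow> (complex \<Rightarrow> complex) \<Rightarrow> complex \<Rightarrow> complex" where
  "mult_op \<phi> f = (\<lambda>z. \<phi> z * f z)"

text \<open>
  The adjoint on \<^term>\<open>A2 \<alpha>\<close>. Its values are meaningful only at arguments in \<^term>\<open>A2 \<alpha>\<close>.
\<close>

definition bergman_adjoint ::
  "real \<Rightarrow> ((complex \<Rightarrow> complex) \<Rightarrow> complex \<Rightarrow> complex) \<Rightarrow> (complex \<Rightarrow> complex) \<Rightarrow> complex \<Rightarrow> complex"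
where
  "bergman_adjoint \<alpha> T g =
     (THE h. h \<in> A2 \<alpha> \<and> (\<forall>f\<in>A2 \<alpha>. bergman_inner \<alpha> (T f) g = bergman_inner \<alpha> f h))"

definition defect_op ::
  "real \<Rightarrow> (complex \<Rightarrow> complex) \<Rightarrow> (complex \<Rightarrow> complex) \<Rightarrow> complex \<Rightarrow> complex" where
  "defect_op \<alpha> \<phi> f = (\<lambda>z. f z - mult_op \<phi> (bergman_adjoint \<alpha> (mult_op \<phi>) f) z)"

abbreviation bergman_topology :: "real \<Rightarrow> (complex \<Rightarrow> complex) topology" where
  "bergman_topology \<alpha> \<equiv> Metric_space.mtopology (A2 \<alpha>) (bergman_dist \<alpha>)"

definition compact_op_on_bergman ::
  "real \<Rightarrow> ((complex \<Rightarrow> complex) \<Rightarrow> complex \<Rightarrow> complex) \<Rightarrow> bool" where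
  "compact_op_on_bergman \<alpha> S \<longleftrightarrow>
     S ` A2 \<alpha> \<subseteq> A2 \<alpha> \<and>
     compactin (bergman_topology \<alpha>)
       (bergman_topology \<alpha> closure_of (S ` {f \<in> A2 \<alpha>. bergman_dist \<alpha> f (\<lambda>_. 0) \<le> 1}))"

text \<open>
  The product may be empty, i.e. unimodular constants count as finite Blaschke products: for these
  the defect operator is \<open>0\<close>, hence compact.
\<close>

definition finite_blaschke_product :: "(complex \<Rightarrow> complex) \<Rightarrow> bool" where
  "finite_blaschke_product \<phi> \<longleftrightarrow>
     (\<exists>(c::complex) (n::nat) (a::nat \<Rightarrow> complex). cmod c = 1 \<and> (\<forall>i<n. a i \<in> unit_disc) \<and>
        (\<forall>z\<in>unit_disc. \<phi> z = c * (\<Prod>i<n. (a i - z) / (1 - cnj (a i) * z))))"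

end

theory Submission
  imports Defs "HOL-Complex_Analysis.Complex_Analysis"
begin

text \<open>
  In the orthonormal basis of normalized monomials, \<open>A\<^sup>2\<^sub>\<alpha>\<close> is the sequence space \<open>\<ell>\<^sup>2\<close>, the defect operator
  of the coordinate function \<open>z\<close> is the diagonal operator \<open>D\<close> with entries \<open>(\<alpha> + 1) / (n + \<alpha> + 1)\<close>, and
  the range of \<open>D\<close> is \<open>A\<^sup>2\<^sub>\<alpha>\<^sub>-\<^sub>2\<close>.

  If \<open>\<phi>\<close> is a finite Blaschke product, then \<open>E\<^sub>\<phi> = \<Sum> T\<^sub>e D T\<^sub>e*\<close> over finitely many functions \<open>e\<close> that
  are smooth up to the boundary. Commuting \<open>T\<^sub>e\<close> past \<open>D\<close> costs only a term of lower order, because \<open>D\<close>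
  inverts a first order differential operator; so \<open>E\<^sub>\<phi> = D Y\<close> with \<open>Y\<close> bounded, which gives (d). If
  \<open>\<phi>\<close> is not constant, one of the \<open>e\<close> is invertible, so \<open>Y\<close> is elliptic and the method of continuity
  shows that it is onto, which gives (c). Conversely, (d) implies \<open>E\<^sub>\<phi> = D Y\<close> with \<open>Y\<close> bounded by a
  closed graph argument, and \<open>D\<close> is compact, hence (a). Finally, testing a compact \<open>E\<^sub>\<phi>\<close> on normalized
  reproducing kernels \<open>k\<^sub>w\<close>, where \<open>\<langle>E\<^sub>\<phi> k\<^sub>w, k\<^sub>w\<rangle> = 1 - \<bar>\<phi>(w)\<bar>\<^sup>2\<close>, shows that \<open>\<bar>\<phi>\<bar>\<close> tends to 1 at the
  boundary, and then \<open>\<phi>\<close> is a finite Blaschke product.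
\<close>

section \<open>The Hilbert space of square-summable sequences\<close>

text \<open>For a unimodular constant the defect operator is \<open>0\<close>, whose range is
  contained in \<open>A2 (\<alpha> - 2)\<close> without being equal to it; hence (c) is compared
  with (b) only for the remaining \<phi>. The Bergman space is a set of functions with a distance
  given by integrals, whereas Riesz representation, adjoints, contractions and Baire category live
  on a complete normed type. All operator theory is therefore done on \<open>ell2\<close>, and the
  map \<open>Phi\<close> carries it over. The diagonal entries have two sources. As
  \<open>1 - wt \<alpha> n / wt \<alpha> (n - 1)\<close> for \<open>n > 0\<close> they measure how
  much multiplication by \<open>z\<close> shrinks the squared norm of a monomial, which is where the
  defect operator meets them. As eigenvalues of the inverse of
  \<open>(z d/dz + \<alpha> + 1) / (\<alpha> + 1)\<close> they describe the gain of one derivative,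
  and that gain is what lowering the exponent by 2 means. This coincidence ties the defect operator
  to \<open>A2 (\<alpha> - 2)\<close>.\<close>

typedef ell2 = "{x :: nat \<Rightarrow> complex. summable (\<lambda>n. (cmod (x n))\<^sup>2)}"
  morphisms coord Abs_ell2
  by (rule exI[of _ "\<lambda>_. 0"]) simp

lemma summable_coord: "summable (\<lambda>n. (cmod (coord x n))\<^sup>2)"
  using coord[of x] by simp

lemma coord_Abs_ell2: "summable (\<lambda>n. (cmod (x n))\<^sup>2) \<Longrightarrow> coord (Abs_ell2 x) = x"
  by (simp add: Abs_ell2_inverse)

lemma ell2_eqI: "(\<And>n. coord x n = coord y n) \<Longrightarrow> x = y"
  by (metis coord_inject ext)

lemma summable_square_norm_add:
  fixes x y :: "nat \<Rightarrow> complex"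
  assumes "summable (\<lambda>n. (cmod (x n))\<^sup>2)" "summable (\<lambda>n. (cmod (y n))\<^sup>2)"
  shows "summable (\<lambda>n. (cmod (x n + y n))\<^sup>2)"
proof (rule summable_comparison_test')
  show "summable (\<lambda>n. 2 * (cmod (x n))\<^sup>2 + 2 * (cmod (y n))\<^sup>2)"
    using assms by (intro summable_add summable_mult)
  show "norm ((cmod (x n + y n))\<^sup>2) \<le> 2 * (cmod (x n))\<^sup>2 + 2 * (cmod (y n))\<^sup>2" for n
  proof -
    have "(cmod (x n + y n))\<^sup>2 \<le> (cmod (x n) + cmod (y n))\<^sup>2"
      by (intro power_mono norm_triangle_ineq) simp
    also have "\<dots> \<le> 2 * (cmod (x n))\<^sup>2 + 2 * (cmod (y n))\<^sup>2"
      using sum_squares_bound[of "cmod (x n)" "cmod (y n)"] by (simp add: power2_sum)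
    finally show ?thesis by simp
  qed
qed

lemma summable_square_norm_mult:
  fixes x c :: "nat \<Rightarrow> complex"
  assumes "summable (\<lambda>n. (cmod (x n))\<^sup>2)" "\<And>n. cmod (c n) \<le> B"
  shows "summable (\<lambda>n. (cmod (c n * x n))\<^sup>2)"
proof (rule summable_comparison_test')
  show "summable (\<lambda>n. B\<^sup>2 * (cmod (x n))\<^sup>2)"
    using assms by (intro summable_mult)
  show "norm ((cmod (c n * x n))\<^sup>2) \<le> B\<^sup>2 * (cmod (x n))\<^sup>2" for n
    using assms(2)[of n] by (auto simp: norm_mult power_mult_distrib intro!: mult_right_mono power_mono)
qed

lemma summable_Re_mult_cnj:
  fixes x y :: "nat \<Rightarrow> complex"
  assumes "summable (\<lambda>n. (cmod (x n))\<^sup>2)" "summable (\<lambda>n. (cmod (y n))\<^sup>2)"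
  shows "summable (\<lambda>n. Re (x n * cnj (y n)))"
proof (rule summable_comparison_test')
  show "summable (\<lambda>n. (cmod (x n))\<^sup>2 + (cmod (y n))\<^sup>2)"
    using assms by (intro summable_add)
  show "norm (Re (x n * cnj (y n))) \<le> (cmod (x n))\<^sup>2 + (cmod (y n))\<^sup>2" for n
  proof -
    have "norm (Re (x n * cnj (y n))) \<le> cmod (x n) * cmod (y n)"
      by (metis abs_Re_le_cmod complex_mod_cnj norm_mult real_norm_def)
    also have "\<dots> \<le> (cmod (x n))\<^sup>2 + (cmod (y n))\<^sup>2"
      using sum_squares_bound[of "cmod (x n)" "cmod (y n)"]
        mult_nonneg_nonneg[OF norm_ge_zero[of "x n"] norm_ge_zero[of "y n"]] by linarith
    finally show ?thesis .
  qed
qed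

instantiation ell2 :: real_vector
begin

definition "0 = Abs_ell2 (\<lambda>_. 0)"
definition "x + y = Abs_ell2 (\<lambda>n. coord x n + coord y n)"
definition "- x = Abs_ell2 (\<lambda>n. - coord x n)"
definition "x - y = Abs_ell2 (\<lambda>n. coord x n - coord y n)"
definition "r *\<^sub>R x = Abs_ell2 (\<lambda>n. r *\<^sub>R coord x n)"

lemma coord_simps:
  "coord 0 n = 0" "coord (x + y) n = coord x n + coord y n" "coord (- x) n = - coord x n"
  "coord (x - y) n = coord x n - coord y n" "coord (r *\<^sub>R x) n = r *\<^sub>R coord x n"
proof -
  have m: "summable (\<lambda>n. (cmod (- coord x n))\<^sup>2)" for x
    by (simp add: summable_coord)
  show "coord 0 n = 0" "coord (x + y) n = coord x n + coord y n" "coord (- x) n = - coord x n"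
    by (simp_all add: zero_ell2_def plus_ell2_def uminus_ell2_def coord_Abs_ell2 summable_coord
        summable_square_norm_add)
  show "coord (x - y) n = coord x n - coord y n"
    unfolding minus_ell2_def
    using summable_square_norm_add[OF summable_coord m] by (subst coord_Abs_ell2) simp_all
  show "coord (r *\<^sub>R x) n = r *\<^sub>R coord x n"
    unfolding scaleR_ell2_def
    using summable_square_norm_mult[OF summable_coord, of "\<lambda>_. of_real r" "\<bar>r\<bar>" x]
    by (subst coord_Abs_ell2) (simp_all add: scaleR_conv_of_real)
qed

instance
  by standard (auto intro!: ell2_eqI simp: coord_simps algebra_simps)

end

declare coord_simps [simp]

text \<open>The real part of the complex inner product suffices: for a complex-linear operator, the adjoints with
  respect to both inner products coincide.\<close>

instantiation ell2 :: real_inner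
begin

definition "inner x y = (\<Sum>n. Re (coord x n * cnj (coord y n)))"
definition "norm (x::ell2) = sqrt (inner x x)"
definition "dist x y = norm (x - y :: ell2)"
definition "sgn x = x /\<^sub>R norm (x::ell2)"
definition uniformity_ell2 :: "(ell2 \<times> ell2) filter"
  where "uniformity_ell2 = (INF e\<in>{0<..}. principal {(x, y). dist x y < e})"
definition open_ell2 :: "ell2 set \<Rightarrow> bool"
  where "open_ell2 U = (\<forall>x\<in>U. \<forall>\<^sub>F (x', y) in uniformity. x' = x \<longrightarrow> y \<in> U)"

lemma summable_inner_ell2: "summable (\<lambda>n. Re (coord x n * cnj (coord y n)))"
  by (intro summable_Re_mult_cnj summable_coord)

lemma Re_mult_cnj_self: "Re (z * cnj z) = (cmod z)\<^sup>2"
  by (simp add: cmod_power2) (simp add: power2_eq_square)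

lemma inner_self_ell2: "inner x x = (\<Sum>n. (cmod (coord x n))\<^sup>2)"
  by (simp only: inner_ell2_def Re_mult_cnj_self)

instance
proof
  fix x y z :: ell2 and r :: real
  show "inner x y = inner y x"
    by (simp add: inner_ell2_def mult.commute)
  show "inner (x + y) z = inner x z + inner y z"
    unfolding inner_ell2_def
    by (subst suminf_add[OF summable_inner_ell2 summable_inner_ell2]) (simp add: algebra_simps)
  show "inner (r *\<^sub>R x) y = r * inner x y"
    unfolding inner_ell2_def
    by (subst suminf_mult[OF summable_inner_ell2, symmetric]) (simp add: algebra_simps)
  show "0 \<le> inner x x"
    unfolding inner_self_ell2 by (intro suminf_nonneg summable_coord) simp
  show "inner x x = 0 \<longleftrightarrow> x = 0"
    unfolding inner_self_ell2
    by (subst suminf_eq_zero_iff[OF summable_coord]) (auto intro: ell2_eqI)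
qed (simp_all add: norm_ell2_def dist_ell2_def sgn_ell2_def uniformity_ell2_def open_ell2_def)

end

lemma norm_ell2_sq: "(norm (x::ell2))\<^sup>2 = (\<Sum>n. (cmod (coord x n))\<^sup>2)"
  by (simp add: power2_norm_eq_inner inner_self_ell2)

lemma sum_coord_le_norm: "finite A \<Longrightarrow> (\<Sum>n\<in>A. (cmod (coord x n))\<^sup>2) \<le> (norm x)\<^sup>2"
  unfolding norm_ell2_sq by (intro sum_le_suminf summable_coord) auto

lemma cmod_coord_le: "cmod (coord x n) \<le> norm x"
  using sum_coord_le_norm[of "{n}" x] by (auto intro: power2_le_imp_le)

lemma norm_ell2_le:
  assumes "\<And>n. cmod (coord x n) \<le> cmod (coord y n)"
  shows "norm x \<le> norm y"
proof (rule power2_le_imp_le)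
  show "(norm x)\<^sup>2 \<le> (norm y)\<^sup>2"
    unfolding norm_ell2_sq by (intro suminf_le summable_coord power_mono assms) auto
qed simp

lemma bounded_partial_sums_ell2:
  assumes "\<And>N. (\<Sum>n<N. (cmod (f n))\<^sup>2) \<le> B\<^sup>2" "0 \<le> B"
  shows "coord (Abs_ell2 f) = f" "norm (Abs_ell2 f) \<le> B"
proof -
  have s: "summable (\<lambda>n. (cmod (f n))\<^sup>2)"
    by (rule summableI_nonneg_bounded[of _ "B\<^sup>2"]) (use assms in auto)
  then show c: "coord (Abs_ell2 f) = f"
    by (rule coord_Abs_ell2)
  have "(norm (Abs_ell2 f))\<^sup>2 \<le> B\<^sup>2"
    unfolding norm_ell2_sq c by (rule suminf_le_const[OF s]) (use assms in auto)
  then show "norm (Abs_ell2 f) \<le> B"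
    using assms(2) by (rule power2_le_imp_le)
qed

text \<open>Each finite partial sum of squares passes to the limit under the bound
  \<open>B\<^sup>2\<close>, a Fatou argument for series. It stands in for weak lower semicontinuity
  of the norm and serves completeness, weak subsequences and the closed graph argument
  alike.\<close>

lemma coordwise_limit_ell2:
  assumes lim: "\<And>n. (\<lambda>j. coord (X j) n) \<longlonglongrightarrow> f n"
    and bd: "\<forall>\<^sub>F j in sequentially. norm (X j) \<le> B"
  shows "coord (Abs_ell2 f) = f" "norm (Abs_ell2 f) \<le> B"
proof -
  have B: "0 \<le> B"
    using bd by (metis (no_types, lifting) eventually_sequentially norm_ge_zero order_refl order_trans)
  have "(\<Sum>n<N. (cmod (f n))\<^sup>2) \<le> B\<^sup>2" for N
  proof (rule tendsto_upperbound)
    show "(\<lambda>j. \<Sum>n<N. (cmod (coord (X j) n))\<^sup>2) \<longlonglongrightarrow> (\<Sum>n<N. (cmod (f n))\<^sup>2)"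
      by (intro tendsto_intros lim)
    show "\<forall>\<^sub>F j in sequentially. (\<Sum>n<N. (cmod (coord (X j) n))\<^sup>2) \<le> B\<^sup>2"
      using bd
    proof eventually_elim
      case (elim j)
      then show ?case
        using sum_coord_le_norm[of "{..<N}" "X j"] power_mono[OF elim, of 2] by auto
    qed
  qed simp
  from bounded_partial_sums_ell2[OF this B]
  show "coord (Abs_ell2 f) = f" "norm (Abs_ell2 f) \<le> B" .
qed

instance ell2 :: complete_space
proof
  fix X :: "nat \<Rightarrow> ell2"
  assume X: "Cauchy X"
  have "Cauchy (\<lambda>j. coord (X j) n)" for n
  proof (rule metric_CauchyI)
    fix e :: real assume "0 < e"
    then obtain M where M: "\<And>i j. i \<ge> M \<Longrightarrow> j \<ge> M \<Longrightarrow> dist (X i) (X j) < e"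
      using X by (meson metric_CauchyD)
    have "dist (coord (X i) n) (coord (X j) n) \<le> dist (X i) (X j)" for i j
      using cmod_coord_le[of "X i - X j" n] by (simp add: dist_norm)
    then show "\<exists>M. \<forall>m\<ge>M. \<forall>j\<ge>M. dist (coord (X m) n) (coord (X j) n) < e"
      using M by (meson order_le_less_trans)
  qed
  then have "\<exists>l. (\<lambda>j. coord (X j) n) \<longlonglongrightarrow> l" for n
    by (meson Cauchy_convergent convergent_def)
  then obtain f where f: "\<And>n. (\<lambda>j. coord (X j) n) \<longlonglongrightarrow> f n"
    by metis
  obtain B where B: "\<And>j. norm (X j) \<le> B"
    using cauchy_imp_bounded[OF X] unfolding bounded_iff by auto
  have cf: "coord (Abs_ell2 f) = f"
    by (rule coordwise_limit_ell2(1)[OF f, where B = B]) (simp add: B)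
  have "X \<longlonglongrightarrow> Abs_ell2 f"
  proof (rule metric_LIMSEQ_I)
    fix e :: real assume "0 < e"
    then obtain M where M: "\<And>i j. i \<ge> M \<Longrightarrow> j \<ge> M \<Longrightarrow> dist (X i) (X j) < e / 2"
      using metric_CauchyD[OF X, of "e / 2"] by auto
    have "dist (X i) (Abs_ell2 f) < e" if i: "i \<ge> M" for i
    proof -
      have l: "(\<lambda>j. coord (X i - X j) n) \<longlonglongrightarrow> coord (X i - Abs_ell2 f) n" for n
        by (auto simp: cf intro!: tendsto_intros f)
      have "\<forall>\<^sub>F j in sequentially. norm (X i - X j) \<le> e / 2"
        using M[OF i] by (auto simp: eventually_sequentially dist_norm intro!: exI[of _ M] less_imp_le)
      from coordwise_limit_ell2(2)[OF l this] have "norm (X i - Abs_ell2 f) \<le> e / 2"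
        by (simp only: coord_inverse)
      then show ?thesis
        using \<open>0 < e\<close> by (simp add: dist_norm)
    qed
    then show "\<exists>no. \<forall>n\<ge>no. dist (X n) (Abs_ell2 f) < e"
      by blast
  qed
  then show "convergent X"
    by (auto simp: convergent_def)
qed

instance ell2 :: banach ..

section \<open>Basis vectors, Riesz representation and adjoints\<close>

definition single :: "nat \<Rightarrow> complex \<Rightarrow> ell2" where
  "single n c = Abs_ell2 (\<lambda>k. if k = n then c else 0)"

lemma coord_single [simp]: "coord (single n c) k = (if k = n then c else 0)"
proof -
  have "summable (\<lambda>k. (cmod (if k = n then c else 0))\<^sup>2)"
    by (rule summable_finite[of "{n}"]) auto
  then show ?thesis
    by (simp add: single_def coord_Abs_ell2)
qed

lemma inner_single: "inner (single n c) x = Re (c * cnj (coord x n))"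
proof -
  have "inner (single n c) x = (\<Sum>k. if k = n then Re (c * cnj (coord x n)) else 0)"
    unfolding inner_ell2_def by (intro arg_cong[where f = suminf]) auto
  also have "\<dots> = (\<Sum>k\<in>{n}. if k = n then Re (c * cnj (coord x n)) else 0)"
    by (rule suminf_finite) auto
  finally show ?thesis
    by simp
qed

lemma coord_sum: "coord (sum f A) n = (\<Sum>i\<in>A. coord (f i) n)"
  by (induction A rule: infinite_finite_induct) auto

lemma bounded_linear_coord: "bounded_linear (\<lambda>x. coord x n)"
  by (rule bounded_linear_intro[of _ 1]) (auto simp: cmod_coord_le)

lemma norm_sub_trunc:
  "(norm (x - (\<Sum>n<N. single n (coord x n))))\<^sup>2 = (norm x)\<^sup>2 - (\<Sum>n<N. (cmod (coord x n))\<^sup>2)"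
proof -
  let ?g = "\<lambda>k. (cmod (coord x k))\<^sup>2"
  have "(norm (x - (\<Sum>n<N. single n (coord x n))))\<^sup>2 = (\<Sum>k. if k < N then 0 else ?g k)"
    unfolding norm_ell2_sq by (intro arg_cong[where f = suminf]) (auto simp: coord_sum)
  also have "\<dots> = (\<Sum>k. ?g k - (if k < N then ?g k else 0))"
    by (intro arg_cong[where f = suminf]) auto
  also have "\<dots> = (\<Sum>k. ?g k) - (\<Sum>k. if k < N then ?g k else 0)"
    by (rule suminf_diff[symmetric, OF summable_coord]) (rule summable_finite[of "{..<N}"], auto)
  also have "(\<Sum>k. if k < N then ?g k else 0) = (\<Sum>k<N. if k < N then ?g k else 0)"
    by (rule suminf_finite) auto
  finally show ?thesis
    by (simp add: norm_ell2_sq)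
qed

lemma trunc_tendsto: "(\<lambda>N. \<Sum>n<N. single n (coord x n)) \<longlonglongrightarrow> x"
proof -
  have "(\<lambda>N. (norm x)\<^sup>2 - (\<Sum>n<N. (cmod (coord x n))\<^sup>2)) \<longlonglongrightarrow> (norm x)\<^sup>2 - (norm x)\<^sup>2"
    unfolding norm_ell2_sq by (intro tendsto_intros summable_LIMSEQ summable_coord)
  then have "(\<lambda>N. norm (x - (\<Sum>n<N. single n (coord x n)))) \<longlonglongrightarrow> 0"
    unfolding norm_sub_trunc[symmetric]
    using tendsto_real_sqrt by fastforce
  then show ?thesis
    using tendsto_norm_zero_iff[of "\<lambda>N. x - (\<Sum>n<N. single n (coord x n))"]
      tendsto_diff[OF tendsto_const[of x]] by fastforce
qed

text \<open>The Riesz representation of a real-linear functional \<open>L\<close>: the coordinates of the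
  representing vector are read off from the values of \<open>L\<close> at \<open>e\<^sub>n\<close> and \<open>\<i> e\<^sub>n\<close>.\<close>

lemma ell2_riesz:
  fixes L :: "ell2 \<Rightarrow> real"
  assumes L: "bounded_linear L"
  obtains y where "\<And>x. L x = inner x y"
proof -
  interpret L: bounded_linear L by fact
  obtain K where K: "\<And>x. norm (L x) \<le> norm x * K" "K \<ge> 0"
    using L.nonneg_bounded by auto
  define y where "y n = Complex (L (single n 1)) (L (single n \<i>))" for n
  have Ls: "L (single n c) = Re (c * cnj (y n))" for n c
  proof -
    have "single n c = Re c *\<^sub>R single n 1 + Im c *\<^sub>R single n \<i>"
      by (auto intro!: ell2_eqI simp: complex_eq_iff)
    then show ?thesis
      by (simp add: L.add L.scaleR y_def)
  qed
  have "(\<Sum>n<N. (cmod (y n))\<^sup>2) \<le> K\<^sup>2" for N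
  proof -
    \<comment> \<open>Testing \<open>L\<close> on the truncation of \<open>y\<close> itself gives
      \<open>(norm x)\<^sup>2 = L x \<le> norm x * K\<close>, hence \<open>norm x \<le> K\<close>
      for every \<open>N\<close>.\<close>
    define x where "x = (\<Sum>n<N. single n (y n))"
    have cx: "coord x n = (if n < N then y n else 0)" for n
      by (simp add: x_def coord_sum)
    let ?s = "\<Sum>n<N. (cmod (y n))\<^sup>2"
    have "(norm x)\<^sup>2 = (\<Sum>n<N. (cmod (coord x n))\<^sup>2)"
      unfolding norm_ell2_sq by (rule suminf_finite) (auto simp: cx)
    then have nx: "(norm x)\<^sup>2 = ?s"
      by (simp add: cx)
    have "L x = ?s"
      by (simp only: x_def L.sum Ls Re_mult_cnj_self)
    then have "(norm x)\<^sup>2 \<le> norm x * K"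
      using K(1)[of x] nx by simp
    then have "norm x \<le> K"
      using K(2) by (cases "x = 0") (simp_all add: power2_eq_square)
    then show ?thesis
      unfolding nx[symmetric] by (intro power_mono) auto
  qed
  from bounded_partial_sums_ell2(1)[OF this K(2)] have cy: "coord (Abs_ell2 y) = y" .
  have "L x = inner x (Abs_ell2 y)" for x
  proof (rule LIMSEQ_unique)
    show "(\<lambda>N. L (\<Sum>n<N. single n (coord x n))) \<longlonglongrightarrow> L x"
      by (intro L.tendsto trunc_tendsto)
    have "(\<lambda>N. inner (\<Sum>n<N. single n (coord x n)) (Abs_ell2 y)) \<longlonglongrightarrow> inner x (Abs_ell2 y)"
      by (intro tendsto_intros trunc_tendsto)
    then show "(\<lambda>N. L (\<Sum>n<N. single n (coord x n))) \<longlonglongrightarrow> inner x (Abs_ell2 y)"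
      by (simp add: inner_sum_left inner_single L.sum Ls cy)
  qed
  then show ?thesis
    using that by blast
qed

text \<open>\<open>adjoint\<close> is defined by choice, so nothing is known of it until some
  adjoint is shown to exist. Riesz representation of \<open>\<lambda>x. inner (T x) y\<close> for
  each \<open>y\<close> provides one.\<close>

lemma inner_adjoint_ell2:
  fixes T :: "ell2 \<Rightarrow> ell2"
  assumes "bounded_linear T"
  shows "inner x (adjoint T y) = inner (T x) y"
proof -
  have "\<exists>z. \<forall>x. inner (T x) y = inner x z" for y
  proof -
    have "bounded_linear (\<lambda>x. inner (T x) y)"
      using bounded_linear_compose[OF bounded_linear_inner_left assms] .
    then show ?thesis
      by (rule ell2_riesz) auto
  qed
  then have "\<exists>f'. \<forall>x y. inner (T x) y = inner x (f' y)"
    by metis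
  then show ?thesis
    unfolding adjoint_def by (rule someI2_ex) auto
qed

lemma inner_eq_left_imp_eq: "(\<And>x. inner x y = inner x z) \<Longrightarrow> y = (z :: 'a :: real_inner)"
  using vector_eq_ldot by blast

lemma adjoint_ell2_unique:
  fixes T :: "ell2 \<Rightarrow> ell2"
  assumes "bounded_linear T" "\<And>x. inner (T x) y = inner x z"
  shows "adjoint T y = z"
  by (rule inner_eq_left_imp_eq) (simp add: inner_adjoint_ell2 assms)

lemma norm_adjoint_ell2_le:
  fixes T :: "ell2 \<Rightarrow> ell2"
  assumes T: "bounded_linear T" and B: "\<And>x. norm (T x) \<le> B * norm x"
  shows "norm (adjoint T y) \<le> B * norm y"
proof (cases "norm (adjoint T y) = 0")
  case True
  have "0 \<le> B * norm y"
    using B[of y] norm_ge_zero order_trans by blast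
  with True show ?thesis by simp
next
  case False
  let ?z = "adjoint T y"
  have "norm ?z * norm ?z = inner (T ?z) y"
    by (simp add: inner_adjoint_ell2[OF T, symmetric] power2_norm_eq_inner flip: power2_eq_square)
  also have "\<dots> \<le> norm (T ?z) * norm y"
    by (rule norm_cauchy_schwarz)
  also have "\<dots> \<le> (B * norm ?z) * norm y"
    by (intro mult_right_mono B) simp
  finally show ?thesis
    using False by (simp add: algebra_simps)
qed

lemma bounded_linear_adjoint_ell2:
  fixes T :: "ell2 \<Rightarrow> ell2"
  assumes T: "bounded_linear T"
  shows "bounded_linear (adjoint T)"
proof -
  obtain B where "\<And>x. norm (T x) \<le> norm x * B"
    using bounded_linear.bounded[OF T] by blast
  then have B: "\<And>y. norm (adjoint T y) \<le> B * norm y"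
    by (intro norm_adjoint_ell2_le T) (simp add: mult.commute)
  show ?thesis
    by (rule bounded_linear_intro[of _ B])
      (auto intro!: adjoint_ell2_unique[OF T] simp: inner_add_right inner_adjoint_ell2[OF T] B mult.commute)
qed

section \<open>Area measure on the disc\<close>

text \<open>The library has the invariance of Lebesgue measure under orthogonal maps for vectors only; it is
  transferred to rotations of the complex plane.\<close>

definition complex_of_vec :: "real ^ 2 \<Rightarrow> complex" where
  "complex_of_vec x = Complex (x $ 1) (x $ 2)"

definition vec_of_complex :: "complex \<Rightarrow> real ^ 2" where
  "vec_of_complex z = (\<chi> i. if i = 1 then Re z else Im z)"

lemma vec_of_complex_inverse [simp]: "complex_of_vec (vec_of_complex z) = z"
  by (simp add: complex_of_vec_def vec_of_complex_def)

lemma complex_of_vec_inverse [simp]: "vec_of_complex (complex_of_vec x) = x"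
  by (simp add: complex_of_vec_def vec_of_complex_def vec_eq_iff forall_2)

lemma linear_complex_of_vec: "linear complex_of_vec"
  by (rule linearI) (auto simp: complex_of_vec_def complex_eq_iff)

lemma linear_vec_of_complex: "linear vec_of_complex"
  by (rule linearI) (auto simp: vec_of_complex_def vec_eq_iff)

lemma norm_vec_of_complex: "norm (vec_of_complex z) = cmod z"
  by (simp add: norm_vec_def L2_set_def sum_2 vec_of_complex_def cmod_def)

lemma norm_complex_of_vec: "cmod (complex_of_vec x) = norm x"
  by (metis complex_of_vec_inverse norm_vec_of_complex)

lemma distr_complex_of_vec: "distr lborel borel complex_of_vec = lborel"
proof (rule lborel_eqI[symmetric])
  have [measurable]: "complex_of_vec \<in> borel \<rightarrow>\<^sub>M borel"
    by (intro borel_measurable_continuous_onI linear_continuous_on linear_conv_bounded_linear[THEN iffD1]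
        linear_complex_of_vec)
  fix l u :: complex
  assume le: "\<And>b. b \<in> Basis \<Longrightarrow> l \<bullet> b \<le> u \<bullet> b"
  have pre: "complex_of_vec -` box l u = box (vec_of_complex l) (vec_of_complex u)"
    by (rule set_eqI) (simp add: mem_box_cart forall_2 box_def[of l u] complex_of_vec_def vec_of_complex_def
        Basis_complex_def conj_ac)
  have B: "Basis = {axis 1 1, axis 2 (1::real) :: real ^ 2}"
    by (auto simp: Basis_vec_def UNIV_2)
  have "prod f Basis = f (axis 1 1) * f (axis 2 1)" for f :: "real ^ 2 \<Rightarrow> real"
    unfolding B by (subst prod.insert) (auto simp: axis_eq_axis)
  then have "(\<Prod>b\<in>Basis. (vec_of_complex u - vec_of_complex l) \<bullet> b) = (\<Prod>b\<in>Basis. (u - l) \<bullet> b)"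
    by (simp add: Basis_complex_def inner_axis vec_of_complex_def)
  moreover have "vec_of_complex l \<bullet> b \<le> vec_of_complex u \<bullet> b" if "b \<in> Basis" for b
    using le[of 1] le[of \<i>] that
    by (auto simp: Basis_vec_def UNIV_2 inner_axis vec_of_complex_def Basis_complex_def)
  ultimately show "emeasure (distr lborel borel complex_of_vec) (box l u) = (\<Prod>b\<in>Basis. (u - l) \<bullet> b)"
    by (simp add: emeasure_distr pre emeasure_lborel_box)
qed simp

text \<open>Boxes determine \<open>lborel\<close>, and the preimage of a box is its image under the
  inverse map, again orthogonal. The measure of such an image is known for \<open>lebesgue\<close>,
  with which \<open>lborel\<close> agrees on Borel sets.\<close>

lemma distr_lborel_orthogonal:
  fixes f :: "real ^ 2 \<Rightarrow> real ^ 2"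
  assumes f: "orthogonal_transformation f"
  shows "distr lborel borel f = lborel"
proof (rule lborel_eqI[symmetric])
  have [measurable]: "f \<in> borel \<rightarrow>\<^sub>M borel"
    using f by (intro borel_measurable_continuous_onI linear_continuous_on linear_conv_bounded_linear[THEN iffD1]
        orthogonal_transformation_linear)
  fix l u :: "real ^ 2"
  assume le: "\<And>b. b \<in> Basis \<Longrightarrow> l \<bullet> b \<le> u \<bullet> b"
  have bij: "bij f"
    using f by (rule orthogonal_transformation_bij)
  have inv: "orthogonal_transformation (inv f)"
    using f by (rule orthogonal_transformation_inv)
  have pre: "f -` box l u = inv f ` box l u"
    using bij by (simp add: bij_vimage_eq_inv_image)
  have m: "inv f ` box l u \<in> sets borel"
    using measurable_sets[of f borel borel "box l u"] by (simp flip: pre)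
  have lm: "inv f ` box l u \<in> lmeasurable"
    by (intro measurable_orthogonal_image inv) simp
  have "emeasure (distr lborel borel f) (box l u) = emeasure lborel (inv f ` box l u)"
    by (simp add: emeasure_distr pre)
  also have "\<dots> = emeasure lebesgue (inv f ` box l u)"
    using m by simp
  also have "\<dots> = ennreal (measure lebesgue (inv f ` box l u))"
    using lm by (intro emeasure_eq_measure2) auto
  also have "measure lebesgue (inv f ` box l u) = measure lebesgue (box l u)"
    by (intro measure_orthogonal_image inv) simp
  also have "ennreal (measure lebesgue (box l u)) = emeasure lborel (box l u)"
    using emeasure_lborel_box_finite[of l u] by (simp add: measure_def)
  also have "\<dots> = (\<Prod>b\<in>Basis. (u - l) \<bullet> b)"
    using le by (simp add: emeasure_lborel_box)
  finally show "emeasure (distr lborel borel f) (box l u) = (\<Prod>b\<in>Basis. (u - l) \<bullet> b)" .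
qed simp

lemma distr_lborel_rotate:
  assumes u: "cmod u = 1"
  shows "distr lborel borel (\<lambda>z. u * z) = lborel"
proof -
  define f where "f x = vec_of_complex (u * complex_of_vec x)" for x
  have lin: "linear f"
    unfolding f_def
    by (intro linear_compose[OF linear_complex_of_vec, unfolded o_def]
        linear_compose[OF _ linear_vec_of_complex, unfolded o_def] bounded_linear.linear
        bounded_linear_mult_right[THEN bounded_linear_compose] )
      (simp add: linear_complex_of_vec linear_conv_bounded_linear[symmetric])
  have ort: "orthogonal_transformation f"
    unfolding orthogonal_transformation using lin
    by (simp add: f_def norm_vec_of_complex norm_complex_of_vec norm_mult u)
  have [measurable]: "complex_of_vec \<in> borel \<rightarrow>\<^sub>M borel" "f \<in> borel \<rightarrow>\<^sub>M borel"
    using lin by (auto intro!: borel_measurable_continuous_onI linear_continuous_on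
        linear_conv_bounded_linear[THEN iffD1] linear_complex_of_vec)
  have "distr lborel borel (\<lambda>z. u * z) = distr (distr lborel borel complex_of_vec) borel (\<lambda>z. u * z)"
    by (simp add: distr_complex_of_vec)
  also have "\<dots> = distr lborel borel (\<lambda>x. complex_of_vec (f x))"
    by (subst distr_distr) (auto simp: o_def f_def)
  also have "\<dots> = distr (distr lborel borel f) borel complex_of_vec"
    by (subst distr_distr) (auto simp: o_def)
  also have "\<dots> = lborel"
    by (simp add: distr_lborel_orthogonal[OF ort] distr_complex_of_vec)
  finally show ?thesis .
qed

section \<open>Normalized area: rotation invariance and radial integrals\<close>

lemma sets_area [measurable_cong]: "sets area = sets borel"
  by (simp add: area_def)

lemma space_area [simp]: "space area = UNIV"
  by (simp add: area_def)

lemma emeasure_disc: "emeasure lborel (ball (0::complex) r) = ennreal (pi * r\<^sup>2)" if "r \<ge> 0"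
  using that by (simp add: emeasure_ball unit_ball_vol_2)

lemma emeasure_area:
  assumes "A \<in> sets borel"
  shows "emeasure area A = emeasure lborel (unit_disc \<inter> A) / ennreal pi"
  using assms emeasure_disc[of 1] by (simp add: area_def)

lemma AE_area: "AE z in area. z \<in> unit_disc"
  unfolding area_def
  by (rule AE_uniform_measureI) auto

lemma emeasure_area_UNIV [simp]: "emeasure area UNIV = 1"
  using emeasure_disc[of 1] by (simp add: emeasure_area divide_ennreal)

interpretation area: finite_measure area
  by standard simp

lemma distr_area_rotate:
  assumes u: "cmod u = 1"
  shows "distr area borel (\<lambda>z. u * z) = area"
proof (rule measure_eqI)
  fix A assume "A \<in> sets (distr area borel (\<lambda>z. u * z))"
  then have [measurable]: "A \<in> sets borel" by simp
  have pre: "(\<lambda>z. u * z) -` A \<in> sets borel"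
    using measurable_sets[of "\<lambda>z. u * z" borel borel A] by simp
  have "emeasure (distr area borel (\<lambda>z. u * z)) A = emeasure area ((\<lambda>z. u * z) -` A)"
    by (simp add: emeasure_distr)
  also have "\<dots> = emeasure lborel (unit_disc \<inter> ((\<lambda>z. u * z) -` A)) / ennreal pi"
    using pre by (rule emeasure_area)
  also have "unit_disc \<inter> ((\<lambda>z. u * z) -` A) = (\<lambda>z. u * z) -` (unit_disc \<inter> A)"
    by (auto simp: norm_mult u)
  also have "emeasure lborel \<dots> = emeasure (distr lborel borel (\<lambda>z. u * z)) (unit_disc \<inter> A)"
    by (simp add: emeasure_distr)
  also have "\<dots> / ennreal pi = emeasure area A"
    by (simp add: distr_lborel_rotate[OF u] emeasure_area)
  finally show "emeasure (distr area borel (\<lambda>z. u * z)) A = emeasure area A" .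
qed (simp add: sets_area)

text \<open>The disc of radius \<open>sqrt x\<close> has normalized area \<open>x\<close>, so under
  \<open>area\<close> the variable \<open>(cmod z)\<^sup>2\<close> is uniformly distributed. Radial
  integrals thus become integrals over \<open>{0..1}\<close> without polar coordinates.\<close>

lemma distr_area_norm_sq: "distr area borel (\<lambda>z. (cmod z)\<^sup>2) = uniform_measure lborel {0..1}"
proof (rule measure_eqI_lessThan)
  fix x :: real
  have m: "emeasure (distr area borel (\<lambda>z. (cmod z)\<^sup>2)) {x<..} = emeasure area {z. x < (cmod z)\<^sup>2}"
    by (subst emeasure_distr) (auto intro!: arg_cong[where f = "emeasure area"])
  show "emeasure (distr area borel (\<lambda>z. (cmod z)\<^sup>2)) {x<..} < \<infinity>"
    unfolding m using area.emeasure_finite[of "{z. x < (cmod z)\<^sup>2}"] by (simp add: less_top[symmetric])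
  have ms: "{z. x < (cmod z)\<^sup>2} \<in> sets borel"
    by (intro borel_open open_Collect_less continuous_intros)
  consider "x < 0" | "0 \<le> x" "x < 1" | "1 \<le> x" by linarith
  then show "emeasure (distr area borel (\<lambda>z. (cmod z)\<^sup>2)) {x<..} = emeasure (uniform_measure lborel {0..1}) {x<..}"
  proof cases
    case 1
    then have "{z. x < (cmod z)\<^sup>2} = (UNIV :: complex set)" "{0..1} \<inter> {x<..} = {0..1}"
      by (auto intro: less_le_trans[OF _ zero_le_power2])
    then show ?thesis
      unfolding m by simp
  next
    case 2
    have eq: "unit_disc \<inter> {z. x < (cmod z)\<^sup>2} = unit_disc - cball 0 (sqrt x)"
    proof -
      have iff: "x < (cmod z)\<^sup>2 \<longleftrightarrow> sqrt x < cmod z" for z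
        using real_sqrt_less_iff[of x "(cmod z)\<^sup>2"] by simp
      show ?thesis
        by (intro set_eqI) (simp only: Int_iff mem_Collect_eq Diff_iff mem_cball dist_0_norm not_le iff)
    qed
    have "sqrt x < 1"
      using 2 by simp
    then have sub: "cball 0 (sqrt x) \<subseteq> (unit_disc :: complex set)"
      by (metis cball_subset_ball_iff dist_self add_0_left)
    have "emeasure lborel (unit_disc - cball 0 (sqrt x) :: complex set)
        = emeasure lborel (unit_disc :: complex set) - emeasure lborel (cball (0::complex) (sqrt x))"
      using 2 by (intro emeasure_Diff sub) (simp_all add: emeasure_cball)
    also have "\<dots> = ennreal (pi * (1 - x))"
      using 2 emeasure_disc[of 1]
      by (simp add: emeasure_cball unit_ball_vol_2 ennreal_minus algebra_simps)
    finally have "emeasure area {z. x < (cmod z)\<^sup>2} = ennreal (1 - x)"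
      using 2 by (simp add: emeasure_area[OF ms] eq divide_ennreal)
    moreover have "{0..1} \<inter> {x<..} = {x<..1}"
      using 2 by auto
    ultimately show ?thesis
      unfolding m using 2 by (simp add: divide_ennreal_def)
  next
    case 3
    have "(cmod z)\<^sup>2 \<le> 1" if "cmod z < 1" for z
      using that by (simp add: power_le_one)
    with 3 have "unit_disc \<inter> {z. x < (cmod z)\<^sup>2} = {}" "{0..1} \<inter> {x<..} = {}"
      by force+
    then show ?thesis
      unfolding m by (simp add: emeasure_area[OF ms])
  qed
qed auto

lemma nn_integral_area_radial:
  assumes [measurable]: "F \<in> borel_measurable borel"
  shows "(\<integral>\<^sup>+z. F ((cmod z)\<^sup>2) \<partial>area) = (\<integral>\<^sup>+t\<in>{0..1}. F t \<partial>lborel)"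
proof -
  have "(\<integral>\<^sup>+z. F ((cmod z)\<^sup>2) \<partial>area) = (\<integral>\<^sup>+t. F t \<partial>distr area borel (\<lambda>z. (cmod z)\<^sup>2))"
    by (subst nn_integral_distr) auto
  also have "\<dots> = (\<integral>\<^sup>+t\<in>{0..1}. F t \<partial>lborel)"
    unfolding distr_area_norm_sq by (subst nn_integral_uniform_measure) (auto simp: divide_ennreal_def)
  finally show ?thesis .
qed

lemma area_moment:
  assumes b: "b > -1"
  shows "(\<integral>\<^sup>+z. ennreal ((1 - (cmod z)\<^sup>2) powr b * (cmod z) ^ (2 * n)) \<partial>area)
    = ennreal (Beta (real n + 1) (b + 1))"
proof -
  let ?F = "\<lambda>t::real. t powr (real n) * (1 - t) powr b"
  have int: "(?F has_integral Beta (real n + 1) (b + 1)) {0<..<1}"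
    using has_integral_Beta_real[of "real n + 1" "b + 1"] b by (simp add: has_integral_Icc_iff_Ioo)
  have "(\<integral>\<^sup>+z. ennreal ((1 - (cmod z)\<^sup>2) powr b * (cmod z) ^ (2 * n)) \<partial>area)
     = (\<integral>\<^sup>+z. ennreal ((1 - (cmod z)\<^sup>2) powr b * ((cmod z)\<^sup>2) ^ n) \<partial>area)"
    by (simp add: power_mult)
  also have "\<dots> = (\<integral>\<^sup>+t\<in>{0..1}. ennreal ((1 - t) powr b * t ^ n) \<partial>lborel)"
    by (rule nn_integral_area_radial) measurable
  also have "\<dots> = (\<integral>\<^sup>+t. ennreal (indicator {0<..<1} t * ?F t) \<partial>lborel)"
  proof (rule nn_integral_cong_AE)
    \<comment> \<open>At \<open>t = 0\<close> the two powers differ for \<open>n = 0\<close>, since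
      \<open>0 ^ 0 = 1\<close> but \<open>0 powr 0 = 0\<close>; both endpoints are discarded as null
      sets.\<close>
    show "AE t in lborel. ennreal ((1 - t) powr b * t ^ n) * indicator {0..1} t = ennreal (indicator {0<..<1} t * ?F t)"
      using AE_lborel_singleton[of 0] AE_lborel_singleton[of 1]
      by eventually_elim (auto simp: indicator_def powr_realpow mult.commute)
  qed
  also have "\<dots> = ennreal (Beta (real n + 1) (b + 1))"
  proof (rule nn_integral_has_integral_lborel)
    show "((\<lambda>t. indicator {0<..<1} t * ?F t) has_integral Beta (real n + 1) (b + 1)) UNIV"
      using int unfolding has_integral_restrict_UNIV[of "{0<..<1}" ?F, symmetric]
      by (rule has_integral_eq[rotated]) (auto simp: indicator_def)
  qed auto
  finally show ?thesis .
qed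

section \<open>Taylor coefficients and Parseval's identity on the disc\<close>

definition coef :: "(complex \<Rightarrow> complex) \<Rightarrow> nat \<Rightarrow> complex" where
  "coef f n = (deriv ^^ n) f 0 / fact n"

lemma coef_sums:
  assumes "f holomorphic_on unit_disc" "cmod z < 1"
  shows "(\<lambda>n. coef f n * z ^ n) sums f z"
  using holomorphic_power_series[of f 0 1 z] assms by (simp add: coef_def)

lemma coef_abs_summable:
  assumes "f holomorphic_on unit_disc" "0 \<le> r" "r < 1"
  shows "summable (\<lambda>n. cmod (coef f n) * r ^ n)"
proof -
  obtain s where s: "r < s" "s < 1"
    using assms dense by blast
  have "summable (\<lambda>n. coef f n * of_real s ^ n)"
    using coef_sums[OF assms(1), of "of_real s"] s assms by (auto simp: sums_iff)
  from powser_insidea[OF this, of "of_real r"] show ?thesis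
    using s assms by (simp add: norm_mult norm_power)
qed

lemma measurable_holomorphic_indicator:
  assumes "f holomorphic_on unit_disc"
  shows "(\<lambda>z. indicator unit_disc z *\<^sub>R f z) \<in> borel_measurable borel"
  using assms by (intro borel_measurable_continuous_on_indicator holomorphic_on_imp_continuous_on) auto

lemma borel_measurable_cnj' [measurable]: "cnj \<in> borel_measurable borel"
  by (intro borel_measurable_continuous_onI continuous_intros)

lemma integrable_area_bounded:
  fixes g :: "complex \<Rightarrow> 'b :: {banach, second_countable_topology}"
  assumes "g \<in> borel_measurable borel" "\<And>z. cmod z < 1 \<Longrightarrow> norm (g z) \<le> B"
  shows "integrable area g"
proof (rule area.integrable_const_bound)
  show "AE z in area. norm (g z) \<le> B"
    using AE_area by eventually_elim (simp add: assms(2))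
qed (use assms in measurable)

text \<open>Rotation by the angle \<open>pi / (n - m)\<close> preserves \<open>area\<close> and
  \<rho> but multiplies the integrand by -1, so the integral is its own negative.\<close>

lemma monomials_orthogonal:
  fixes \<rho> :: "complex \<Rightarrow> real"
  assumes [measurable]: "\<rho> \<in> borel_measurable borel"
    and radial: "\<And>u z. cmod u = 1 \<Longrightarrow> \<rho> (u * z) = \<rho> z" and "n \<noteq> m"
  shows "(LINT z|area. \<rho> z *\<^sub>R (z ^ n * cnj z ^ m)) = 0"
proof -
  define \<theta> where "\<theta> = pi / (real n - real m)"
  define u where "u = cis \<theta>"
  have u: "cmod u = 1"
    by (simp add: u_def)
  have "u ^ n * cnj u ^ m = cis (real n * \<theta>) * cis (- (real m * \<theta>))"
    by (simp add: u_def cis_cnj Complex.DeMoivre)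
  also have "\<dots> = cis ((real n - real m) * \<theta>)"
    by (simp add: cis_mult algebra_simps)
  also have "\<dots> = -1"
    using \<open>n \<noteq> m\<close> by (simp add: \<theta>_def)
  finally have un: "u ^ n * cnj u ^ m = -1" .
  let ?g = "\<lambda>z. \<rho> z *\<^sub>R (z ^ n * cnj z ^ m)"
  have "integral\<^sup>L area ?g = integral\<^sup>L (distr area borel (\<lambda>z. u * z)) ?g"
    by (simp add: distr_area_rotate[OF u])
  also have "\<dots> = (LINT z|area. ?g (u * z))"
    by (rule integral_distr) measurable
  also have "(\<lambda>z. ?g (u * z)) = (\<lambda>z. (u ^ n * cnj u ^ m) * ?g z)"
    by (simp only: radial[OF u] complex_cnj_mult power_mult_distrib) (simp add: mult_ac)
  also have "(LINT z|area. (u ^ n * cnj u ^ m) * ?g z) = - integral\<^sup>L area ?g"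
    unfolding un by simp
  finally show ?thesis
    by simp
qed

lemma parseval_polynomial:
  fixes \<rho> :: "complex \<Rightarrow> real" and a :: "nat \<Rightarrow> complex"
  assumes [measurable]: "\<rho> \<in> borel_measurable borel"
    and radial: "\<And>u z. cmod u = 1 \<Longrightarrow> \<rho> (u * z) = \<rho> z"
    and bd: "\<And>z. \<bar>\<rho> z\<bar> \<le> B"
  shows "(LINT z|area. \<rho> z * (cmod (\<Sum>n<N. a n * z ^ n))\<^sup>2)
    = (\<Sum>n<N. (cmod (a n))\<^sup>2 * (LINT z|area. \<rho> z * (cmod z) ^ (2 * n)))"
proof -
  let ?M = "\<lambda>n. LINT z|area. \<rho> z * (cmod z) ^ (2 * n)"
  have int: "integrable area (\<lambda>z. \<rho> z *\<^sub>R (z ^ n * cnj z ^ m))" for n m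
  proof (rule integrable_area_bounded)
    fix z :: complex assume z: "cmod z < 1"
    have "norm (\<rho> z *\<^sub>R (z ^ n * cnj z ^ m)) = \<bar>\<rho> z\<bar> * (cmod z ^ n * cmod z ^ m)"
      by (simp add: norm_mult norm_power)
    also have "\<dots> \<le> B * (1 * 1)"
      using z bd[of z] by (intro mult_mono power_le_one) auto
    finally show "norm (\<rho> z *\<^sub>R (z ^ n * cnj z ^ m)) \<le> B"
      by simp
  qed measurable
  have sq: "complex_of_real ((cmod w)\<^sup>2) = w * cnj w" for w
    by (rule complex_norm_square)
  have "complex_of_real (LINT z|area. \<rho> z * (cmod (\<Sum>n<N. a n * z ^ n))\<^sup>2)
      = (LINT z|area. complex_of_real (\<rho> z) * ((\<Sum>n<N. a n * z ^ n) * cnj (\<Sum>n<N. a n * z ^ n)))"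
    by (simp only: integral_complex_of_real[symmetric] of_real_mult sq)
  also have "\<dots> = (LINT z|area. (\<Sum>n<N. \<Sum>m<N. (a n * cnj (a m)) * (\<rho> z *\<^sub>R (z ^ n * cnj z ^ m))))"
    by (intro Bochner_Integration.integral_cong refl)
      (simp only: cnj_sum complex_cnj_mult complex_cnj_power sum_product sum_distrib_left
        scaleR_conv_of_real mult_ac, rule sum.swap)
  also have "\<dots> = (\<Sum>n<N. \<Sum>m<N. (a n * cnj (a m)) * (LINT z|area. \<rho> z *\<^sub>R (z ^ n * cnj z ^ m)))"
    by (simp add: int Bochner_Integration.integral_sum integrable_sum del: mult_scaleR_right)
  also have "\<dots> = (\<Sum>n<N. \<Sum>m<N. if m = n then of_real ((cmod (a n))\<^sup>2 * ?M n) else 0)"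
  proof (intro sum.cong refl)
    fix n m
    have "(LINT z|area. \<rho> z *\<^sub>R (z ^ n * cnj z ^ n)) = (LINT z|area. complex_of_real (\<rho> z * (cmod z) ^ (2 * n)))"
      by (intro Bochner_Integration.integral_cong refl)
        (simp only: power_mult of_real_mult of_real_power[of _ n] sq power_mult_distrib scaleR_conv_of_real)
    then have "(LINT z|area. \<rho> z *\<^sub>R (z ^ n * cnj z ^ n)) = of_real (?M n)"
      by (simp only: integral_complex_of_real)
    then show "(a n * cnj (a m)) * (LINT z|area. \<rho> z *\<^sub>R (z ^ n * cnj z ^ m))
        = (if m = n then of_real ((cmod (a n))\<^sup>2 * ?M n) else 0)"
      using monomials_orthogonal[OF assms(1) radial, of n m] by (auto simp: sq simp del: of_real_power)
  qed
  also have "\<dots> = of_real (\<Sum>n<N. (cmod (a n))\<^sup>2 * ?M n)"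
    by simp
  finally show ?thesis
    unfolding of_real_eq_iff .
qed

text \<open>A weight supported in radius \<open>R < 1\<close> sees only a part of the disc on which
  the Taylor series converges uniformly. Dominated convergence then extends the polynomial case to
  every holomorphic \<open>f\<close>, of finite norm or not.\<close>

lemma parseval_truncated:
  fixes \<rho> :: "complex \<Rightarrow> real"
  assumes [measurable]: "\<rho> \<in> borel_measurable borel"
    and radial: "\<And>u z. cmod u = 1 \<Longrightarrow> \<rho> (u * z) = \<rho> z"
    and bd: "\<And>z. 0 \<le> \<rho> z" "\<And>z. \<rho> z \<le> B"
    and R: "0 \<le> R" "R < 1" "\<And>z. cmod z \<ge> R \<Longrightarrow> \<rho> z = 0"
    and f: "f holomorphic_on unit_disc"
  shows "(\<integral>\<^sup>+z. ennreal (\<rho> z * (cmod (f z))\<^sup>2) \<partial>area)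
    = (\<Sum>n. ennreal ((cmod (coef f n))\<^sup>2) * (\<integral>\<^sup>+z. ennreal (\<rho> z * (cmod z) ^ (2 * n)) \<partial>area))"
proof -
  define a where "a = coef f"
  define K where "K = (\<Sum>n. cmod (a n) * R ^ n)"
  let ?M = "\<lambda>n. LINT z|area. \<rho> z * (cmod z) ^ (2 * n)"
  let ?g = "\<lambda>z. \<rho> z * (cmod (indicator unit_disc z *\<^sub>R f z))\<^sup>2"
  have gm: "?g \<in> borel_measurable borel"
    using measurable_holomorphic_indicator[OF f] by measurable
  have eq: "\<rho> z * (cmod (f z))\<^sup>2 = ?g z" for z
    using R(2) R(3)[of z] by (auto simp: indicator_def)
  have sm: "summable (\<lambda>n. cmod (a n) * R ^ n)"
    unfolding a_def by (rule coef_abs_summable[OF f R(1,2)])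
  have K: "0 \<le> K"
    unfolding K_def using R(1) by (intro suminf_nonneg sm) auto
  have bdp: "cmod (\<Sum>n<N. a n * z ^ n) \<le> K" if "cmod z \<le> R" for z N
  proof -
    have "cmod (\<Sum>n<N. a n * z ^ n) \<le> (\<Sum>n<N. cmod (a n) * R ^ n)"
      using that by (intro sum_norm_le) (auto simp: norm_mult norm_power intro!: mult_left_mono power_mono)
    also have "\<dots> \<le> K"
      unfolding K_def using R(1) by (intro sum_le_suminf sm) auto
    finally show ?thesis .
  qed
  have bds: "norm (\<rho> z * (cmod (\<Sum>n<N. a n * z ^ n))\<^sup>2) \<le> B * K\<^sup>2" for z N
  proof (cases "cmod z \<ge> R")
    case True
    then show ?thesis using R(3)[of z] bd[of z] K by simp
  next
    case False
    then show ?thesis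
      using bd[of z] bdp[of z N] by (auto simp: abs_mult intro!: mult_mono power_mono)
  qed
  have lim: "(\<lambda>N. \<rho> z * (cmod (\<Sum>n<N. a n * z ^ n))\<^sup>2) \<longlonglongrightarrow> ?g z" for z
  proof (cases "cmod z \<ge> R")
    case True
    then show ?thesis using R(3)[of z] by simp
  next
    case False
    then have "(\<lambda>N. \<Sum>n<N. a n * z ^ n) \<longlonglongrightarrow> f z"
      using coef_sums[OF f, of z] R(2) by (simp add: a_def sums_def)
    then show ?thesis
      unfolding eq[symmetric] by (intro tendsto_intros)
  qed
  have "(\<lambda>N. LINT z|area. \<rho> z * (cmod (\<Sum>n<N. a n * z ^ n))\<^sup>2) \<longlonglongrightarrow> integral\<^sup>L area ?g"
    by (rule integral_dominated_convergence[where w = "\<lambda>_. B * K\<^sup>2"]) (use gm lim bds in simp_all)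
  then have "(\<lambda>n. (cmod (a n))\<^sup>2 * ?M n) sums integral\<^sup>L area ?g"
    unfolding sums_def using bd by (subst (asm) parseval_polynomial[OF assms(1) radial, where B = B]) auto
  then have "(\<Sum>n. ennreal ((cmod (a n))\<^sup>2 * ?M n)) = ennreal (integral\<^sup>L area ?g)"
    using bd by (intro suminf_ennreal_eq) (auto intro!: mult_nonneg_nonneg Bochner_Integration.integral_nonneg)
  also have "\<dots> = (\<integral>\<^sup>+z. ennreal (?g z) \<partial>area)"
  proof (rule nn_integral_eq_integral[symmetric])
    show "integrable area ?g"
    proof (rule integrable_area_bounded[OF gm])
      show "norm (?g z) \<le> B * K\<^sup>2" for z
        by (rule LIMSEQ_le_const2[OF tendsto_norm[OF lim]]) (use bds in blast)
    qed
  qed (use bd in auto)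
  finally have "(\<integral>\<^sup>+z. ennreal (?g z) \<partial>area) = (\<Sum>n. ennreal ((cmod (a n))\<^sup>2 * ?M n))" ..
  also have "\<dots> = (\<Sum>n. ennreal ((cmod (a n))\<^sup>2) * (\<integral>\<^sup>+z. ennreal (\<rho> z * (cmod z) ^ (2 * n)) \<partial>area))"
  proof (intro arg_cong[where f = suminf] ext)
    fix n
    have "integrable area (\<lambda>z. \<rho> z * (cmod z) ^ (2 * n))"
    proof (rule integrable_area_bounded)
      fix z :: complex assume z: "cmod z < 1"
      have "norm (\<rho> z * (cmod z) ^ (2 * n)) = \<rho> z * (cmod z) ^ (2 * n)"
        using bd[of z] by simp
      also have "\<dots> \<le> B * 1"
        using z bd[of z] by (intro mult_mono power_le_one) auto
      finally show "norm (\<rho> z * (cmod z) ^ (2 * n)) \<le> B" by simp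
    qed measurable
    then have "(\<integral>\<^sup>+z. ennreal (\<rho> z * (cmod z) ^ (2 * n)) \<partial>area) = ennreal (?M n)"
      using bd by (intro nn_integral_eq_integral) auto
    then show "ennreal ((cmod (a n))\<^sup>2 * ?M n)
        = ennreal ((cmod (a n))\<^sup>2) * (\<integral>\<^sup>+z. ennreal (\<rho> z * (cmod z) ^ (2 * n)) \<partial>area)"
      by (simp add: ennreal_mult')
  qed
  finally show ?thesis
    unfolding eq a_def .
qed

text \<open>Monotone convergence along the cutoffs \<open>\<rho> k\<close>, whose radii
  \<open>R k\<close> tend to 1. The identity lives in the extended nonnegative reals, so it also
  decides whether the integral is finite.\<close>

theorem disc_parseval:
  assumes f: "f holomorphic_on unit_disc" and b: "b > -1"
  shows "(\<integral>\<^sup>+z\<in>unit_disc. ennreal ((1 - (cmod z)\<^sup>2) powr b * (cmod (f z))\<^sup>2) \<partial>area)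
    = (\<Sum>n. ennreal ((cmod (coef f n))\<^sup>2 * Beta (real n + 1) (b + 1)))"
proof -
  define R where "R k = 1 - 1 / (real k + 2)" for k
  have R: "0 \<le> R k" "R k < 1" for k
    by (auto simp: R_def field_simps)
  have Rmono: "R k \<le> R l" if "k \<le> l" for k l
    using that by (auto simp: R_def intro!: divide_left_mono)
  have Rlim: "R \<longlonglongrightarrow> 1"
    unfolding R_def by real_asymp
  define \<rho> where "\<rho> k z = indicator (ball 0 (R k)) z * (1 - (cmod z)\<^sup>2) powr b" for k z
  have \<rho>m [measurable]: "\<rho> k \<in> borel_measurable borel" for k
    unfolding \<rho>_def by (intro borel_measurable_times borel_measurable_indicator) measurable
  have \<rho>0: "0 \<le> \<rho> k z" for k z
    by (simp add: \<rho>_def)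
  \<comment> \<open>For \<open>b < 0\<close> the weight grows towards the boundary, so on the ball
    of radius \<open>R k\<close> it is bounded by its value at that radius; for
    \<open>b \<ge> 0\<close> it is at most 1.\<close>
  have \<rho>B: "\<rho> k z \<le> max 1 ((1 - (R k)\<^sup>2) powr b)" for k z
  proof (cases "cmod z < R k")
    case True
    have z: "0 < 1 - (R k)\<^sup>2" "1 - (R k)\<^sup>2 \<le> 1 - (cmod z)\<^sup>2"
      using R[of k] True by (auto simp: abs_square_less_1 intro!: power_mono)
    have "(1 - (cmod z)\<^sup>2) powr b \<le> max 1 ((1 - (R k)\<^sup>2) powr b)"
    proof (cases "b \<ge> 0")
      case True
      then have "(1 - (cmod z)\<^sup>2) powr b \<le> 1 powr b"
        using z by (intro powr_mono2) auto
      then show ?thesis by simp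
    next
      case False
      then have "(1 - (cmod z)\<^sup>2) powr b \<le> (1 - (R k)\<^sup>2) powr b"
        using z by (intro powr_mono2') auto
      then show ?thesis by simp
    qed
    then show ?thesis using True by (simp add: \<rho>_def indicator_def)
  qed (simp add: \<rho>_def le_max_iff_disj)
  have mono: "ennreal (\<rho> k z * c) \<le> ennreal (\<rho> l z * c)" if "k \<le> l" "0 \<le> c" for k l z c
    using Rmono[OF that(1)] that(2)
    by (intro ennreal_leI mult_right_mono) (auto simp: \<rho>_def indicator_def)
  then have inc: "incseq (\<lambda>k. ennreal (\<rho> k z * c))" if "0 \<le> c" for z c
    using that by (simp add: incseq_def)
  have SUP: "(SUP k. ennreal (\<rho> k z * c)) = ennreal ((1 - (cmod z)\<^sup>2) powr b * c) * indicator unit_disc z"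
    if "0 \<le> c" for z c
  proof (rule LIMSEQ_unique[OF LIMSEQ_SUP[OF inc[OF that]]])
    show "(\<lambda>k. ennreal (\<rho> k z * c)) \<longlonglongrightarrow> ennreal ((1 - (cmod z)\<^sup>2) powr b * c) * indicator unit_disc z"
    proof (cases "cmod z < 1")
      case True
      then have "\<forall>\<^sub>F k in sequentially. cmod z < R k"
        using Rlim by (simp add: order_tendsto_iff)
      then have "\<forall>\<^sub>F k in sequentially. ennreal (\<rho> k z * c) = ennreal ((1 - (cmod z)\<^sup>2) powr b * c) * indicator unit_disc z"
        by eventually_elim (use True in \<open>simp add: \<rho>_def indicator_def\<close>)
      then show ?thesis by (rule tendsto_eventually)
    next
      case False
      then have "\<not> cmod z < R k" for k
        using R(2)[of k] by linarith
      then show ?thesis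
        using False by (simp add: \<rho>_def indicator_def)
    qed
  qed
  have fm: "(\<lambda>z. ennreal (\<rho> k z * (cmod (f z))\<^sup>2)) \<in> borel_measurable area" for k
  proof -
    have "\<rho> k z * (cmod (f z))\<^sup>2 = \<rho> k z * (cmod (indicator unit_disc z *\<^sub>R f z))\<^sup>2" for z
      using R(2)[of k] by (auto simp: \<rho>_def indicator_def)
    then show ?thesis
      by (simp only:) (use measurable_holomorphic_indicator[OF f] in measurable)
  qed
  have "(\<integral>\<^sup>+z\<in>unit_disc. ennreal ((1 - (cmod z)\<^sup>2) powr b * (cmod (f z))\<^sup>2) \<partial>area)
      = (\<integral>\<^sup>+z. (SUP k. ennreal (\<rho> k z * (cmod (f z))\<^sup>2)) \<partial>area)"
    by (subst SUP) (simp_all add: SUP)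
  also have "\<dots> = (SUP k. \<integral>\<^sup>+z. ennreal (\<rho> k z * (cmod (f z))\<^sup>2) \<partial>area)"
    by (rule nn_integral_monotone_convergence_SUP[OF _ fm])
      (use inc in \<open>auto simp: incseq_def le_fun_def\<close>)
  also have "\<dots> = (SUP k. \<Sum>n. ennreal ((cmod (coef f n))\<^sup>2) * (\<integral>\<^sup>+z. ennreal (\<rho> k z * (cmod z) ^ (2 * n)) \<partial>area))"
  proof (intro SUP_cong refl)
    fix k
    show "(\<integral>\<^sup>+z. ennreal (\<rho> k z * (cmod (f z))\<^sup>2) \<partial>area)
      = (\<Sum>n. ennreal ((cmod (coef f n))\<^sup>2) * (\<integral>\<^sup>+z. ennreal (\<rho> k z * (cmod z) ^ (2 * n)) \<partial>area))"
      by (rule parseval_truncated[OF \<rho>m _ \<rho>0 \<rho>B R[of k] _ f])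
        (auto simp: \<rho>_def indicator_def norm_mult)
  qed
  also have "\<dots> = (\<Sum>n. SUP k. ennreal ((cmod (coef f n))\<^sup>2) * (\<integral>\<^sup>+z. ennreal (\<rho> k z * (cmod z) ^ (2 * n)) \<partial>area))"
    by (rule ennreal_suminf_SUP_eq[symmetric])
      (auto simp: incseq_def intro!: mult_left_mono nn_integral_mono mono)
  also have "\<dots> = (\<Sum>n. ennreal ((cmod (coef f n))\<^sup>2 * Beta (real n + 1) (b + 1)))"
  proof (intro arg_cong[where f = suminf] ext)
    fix n
    have "(SUP k. \<integral>\<^sup>+z. ennreal (\<rho> k z * (cmod z) ^ (2 * n)) \<partial>area)
        = (\<integral>\<^sup>+z. (SUP k. ennreal (\<rho> k z * (cmod z) ^ (2 * n))) \<partial>area)"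
      by (rule nn_integral_monotone_convergence_SUP[symmetric])
        (use inc in \<open>auto simp: incseq_def le_fun_def\<close>)
    also have "\<dots> = (\<integral>\<^sup>+z. ennreal ((1 - (cmod z)\<^sup>2) powr b * (cmod z) ^ (2 * n)) \<partial>area)"
    proof (rule nn_integral_cong_AE)
      show "AE z in area. (SUP k. ennreal (\<rho> k z * (cmod z) ^ (2 * n)))
          = ennreal ((1 - (cmod z)\<^sup>2) powr b * (cmod z) ^ (2 * n))"
        using AE_area by eventually_elim (subst SUP, auto)
    qed
    also have "\<dots> = ennreal (Beta (real n + 1) (b + 1))"
      by (rule area_moment[OF b])
    finally have "(SUP k. ennreal ((cmod (coef f n))\<^sup>2) * (\<integral>\<^sup>+z. ennreal (\<rho> k z * (cmod z) ^ (2 * n)) \<partial>area))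
        = ennreal ((cmod (coef f n))\<^sup>2) * ennreal (Beta (real n + 1) (b + 1))"
      by (simp add: SUP_mult_left_ennreal[symmetric])
    then show "(SUP k. ennreal ((cmod (coef f n))\<^sup>2) * (\<integral>\<^sup>+z. ennreal (\<rho> k z * (cmod z) ^ (2 * n)) \<partial>area))
        = ennreal ((cmod (coef f n))\<^sup>2 * Beta (real n + 1) (b + 1))"
      by (simp add: ennreal_mult')
  qed
  finally show ?thesis .
qed

section \<open>Coefficient criteria for membership in \<open>A2\<close>\<close>

lemma coef_deriv: "coef (deriv f) n = of_nat (Suc n) * coef f (Suc n)"
  by (simp add: coef_def funpow_Suc_right fact_Suc del: of_nat_Suc funpow.simps)

lemma coef_unique:
  assumes "\<And>z. cmod z < 1 \<Longrightarrow> (\<lambda>n. a n * z ^ n) sums f z"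
  shows "coef f n = a n"
proof -
  have "f has_fps_expansion Abs_fps a"
  proof (rule has_fps_expansionI)
    have "\<forall>\<^sub>F z in nhds 0. z \<in> unit_disc"
      by (intro eventually_nhds_in_open) auto
    then show "\<forall>\<^sub>F z in nhds 0. (\<lambda>n. fps_nth (Abs_fps a) n * z ^ n) sums f z"
      by eventually_elim (simp add: assms)
  qed
  from fps_nth_fps_expansion[OF this, of n] show ?thesis
    by (simp add: coef_def)
qed

lemma Beta_pos: "0 < x \<Longrightarrow> 0 < y \<Longrightarrow> 0 < Beta x (y :: real)"
  by (simp add: Beta_def Gamma_real_pos)

lemma Beta_Suc_left:
  assumes "0 < x" "0 < (y::real)"
  shows "(x + y) * Beta (x + 1) y = x * Beta x y"
  using assms by (intro Beta_plus1_left) (auto elim!: nonpos_Ints_cases)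

lemma Beta_Suc_right:
  assumes "0 < x" "0 < (y::real)"
  shows "(x + y) * Beta x (y + 1) = y * Beta x y"
  using assms by (intro Beta_plus1_right) (auto elim!: nonpos_Ints_cases)

lemma disc_integral_finite_iff:
  assumes f: "f holomorphic_on unit_disc" and b: "b > -1"
  shows "(\<integral>\<^sup>+z\<in>unit_disc. ennreal ((1 - (cmod z)\<^sup>2) powr b * (cmod (f z))\<^sup>2) \<partial>area) < \<infinity>
    \<longleftrightarrow> summable (\<lambda>n. (cmod (coef f n))\<^sup>2 * Beta (real n + 1) (b + 1))"
proof -
  have nn: "0 \<le> (cmod (coef f n))\<^sup>2 * Beta (real n + 1) (b + 1)" for n
    using Beta_pos[of "real n + 1" "b + 1"] b by simp
  show ?thesis
    unfolding disc_parseval[OF f b]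
    using summable_suminf_not_top[OF nn] ennreal_suminf_neq_top[OF _ nn]
    by (auto simp: less_top[symmetric])
qed

lemma summable_comparable:
  fixes f g :: "nat \<Rightarrow> real"
  assumes "\<And>n. 0 \<le> f n" "0 < c" "\<And>n. c * f n \<le> g n" "\<And>n. g n \<le> C * f n"
  shows "summable f \<longleftrightarrow> summable g"
proof
  assume "summable f"
  then have "summable (\<lambda>n. C * f n)"
    by (rule summable_mult)
  then show "summable g"
    by (rule summable_comparison_test'[where N = 0])
      (use assms order_trans[OF mult_nonneg_nonneg[OF less_imp_le[OF assms(2)] assms(1)] assms(3)] in auto)
next
  assume "summable g"
  then have "summable (\<lambda>n. c * f n)"
    by (rule summable_comparison_test'[where N = 0]) (use assms in auto)
  then show "summable f"
    using assms(2) by simp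
qed

text \<open>Passing from \<open>f\<close> to \<open>f'\<close> while raising the exponent by 2 multiplies the weights by
  \<open>B (B + 1) m / (m + B + 1)\<close> with \<open>m = n + 1\<close>, \<open>B = b + 1\<close>, which is bounded from both sides.\<close>

lemma summable_deriv_iff:
  assumes b: "b > -1"
  shows "summable (\<lambda>n. (cmod (coef f n))\<^sup>2 * Beta (real n + 1) (b + 1))
    \<longleftrightarrow> summable (\<lambda>n. (cmod (coef (deriv f) n))\<^sup>2 * Beta (real n + 1) (b + 2 + 1))"
proof -
  define B where "B = b + 1"
  have B: "0 < B"
    using b by (simp add: B_def)
  let ?u = "\<lambda>n. (cmod (coef f (Suc n)))\<^sup>2 * Beta (real (Suc n) + 1) B"
  let ?v = "\<lambda>n. (cmod (coef (deriv f) n))\<^sup>2 * Beta (real n + 1) (B + 2)"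
  have v: "?v n = B * (B + 1) * (real (Suc n) / (real (Suc n) + B + 1)) * ?u n" for n
  proof -
    define m where "m = real (Suc n)"
    have m: "0 < m" by (simp add: m_def)
    have "(m + B + 1) * Beta m (B + 2) = (B + 1) * Beta m (B + 1)"
      using Beta_Suc_right[of m "B + 1"] m B by (simp add: add.assoc)
    moreover have "m * Beta m (B + 1) = B * Beta (m + 1) B"
    proof -
      have "(m + B) * (m * Beta m (B + 1)) = (m + B) * (B * Beta (m + 1) B)"
        using Beta_Suc_right[of m B] Beta_Suc_left[of m B] m B by (simp add: algebra_simps)
      then show ?thesis
        using m B by simp
    qed
    ultimately have "m\<^sup>2 * ((m + B + 1) * Beta m (B + 2)) = B * (B + 1) * m * Beta (m + 1) B"
      by (simp add: power2_eq_square)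
    then have "m\<^sup>2 * Beta m (B + 2) = B * (B + 1) * (m / (m + B + 1)) * Beta (m + 1) B"
      using m B by (simp add: field_simps)
    moreover have "(cmod (coef (deriv f) n))\<^sup>2 = m\<^sup>2 * (cmod (coef f (Suc n)))\<^sup>2"
      by (simp add: coef_deriv norm_mult m_def power_mult_distrib del: of_nat_Suc)
    moreover have "real n + 1 = m"
      by (simp add: m_def)
    ultimately have "?v n = (cmod (coef f (Suc n)))\<^sup>2 * (B * (B + 1) * (m / (m + B + 1)) * Beta (m + 1) B)"
      by (metis mult.assoc mult.commute)
    then show ?thesis
      by (simp only: m_def mult_ac)
  qed
  have u0: "0 \<le> ?u n" for n
    using Beta_pos[of "real (Suc n) + 1" B] B by simp
  \<comment> \<open>The derivative loses the constant term, so the comparison starts with the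
    coefficient of index 1.\<close>
  have "summable (\<lambda>n. (cmod (coef f n))\<^sup>2 * Beta (real n + 1) B) \<longleftrightarrow> summable ?u"
    by (rule summable_Suc_iff[symmetric])
  also have "\<dots> \<longleftrightarrow> summable ?v"
  proof (rule summable_comparable)
    fix n
    show "0 \<le> ?u n" by (rule u0)
    show "?v n \<le> B * (B + 1) * ?u n"
      unfolding v using B u0[of n] by (intro mult_right_mono) (auto intro!: mult_left_le simp: field_simps)
    \<comment> \<open>The quotient increases with \<open>n\<close>; its value at
      \<open>n = 0\<close> is the lower constant.\<close>
    have "1 / (B + 2) \<le> real (Suc n) / (real (Suc n) + B + 1)"
      using B by (simp add: field_simps)
    then show "B * (B + 1) * (1 / (B + 2)) * ?u n \<le> ?v n"
      unfolding v using B u0[of n] by (intro mult_right_mono mult_left_mono) auto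
  qed (use B in simp)
  finally show ?thesis
    by (simp add: B_def add.commute add.left_commute)
qed

text \<open>\<open>A2\<close> asks for the integral condition at every admissible order. The
  derivative comparison relates consecutive orders in both directions, so a single order decides
  them all.\<close>

lemma A2_iff:
  assumes k: "2 * real k + \<gamma> > -1"
  shows "f \<in> A2 \<gamma> \<longleftrightarrow> f holomorphic_on unit_disc \<and> (\<forall>z. z \<notin> unit_disc \<longrightarrow> f z = 0) \<and>
    summable (\<lambda>n. (cmod (coef ((deriv ^^ k) f) n))\<^sup>2 * Beta (real n + 1) (2 * real k + \<gamma> + 1))"
proof -
  define P where "P j \<longleftrightarrow> summable (\<lambda>n. (cmod (coef ((deriv ^^ j) f) n))\<^sup>2 * Beta (real n + 1) (2 * real j + \<gamma> + 1))" for j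
  have step: "P (Suc j) \<longleftrightarrow> P j" if "2 * real j + \<gamma> > -1" for j
    using summable_deriv_iff[OF that, of "(deriv ^^ j) f"] by (simp add: P_def algebra_simps)
  have add: "P (i + j) \<longleftrightarrow> P j" if "2 * real j + \<gamma> > -1" for i j
    using that by (induction i) (auto simp: step)
  have all: "P j \<longleftrightarrow> P k" if "2 * real j + \<gamma> > -1" for j
    using add[OF that, of "k - j"] add[OF k, of "j - k"] by (cases "j \<le> k") auto
  have "(\<integral>\<^sup>+z\<in>unit_disc. ennreal ((1 - (cmod z)\<^sup>2) powr (2 * real j + \<gamma>)
      * (cmod ((deriv ^^ j) f z))\<^sup>2) \<partial>area) < \<infinity> \<longleftrightarrow> P j"
    if "f holomorphic_on unit_disc" "2 * real j + \<gamma> > -1" for j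
    unfolding P_def using that by (intro disc_integral_finite_iff holomorphic_higher_deriv) auto
  then show ?thesis
    unfolding A2_def P_def[symmetric] using all k by blast
qed

text \<open>The squared norm of the monomial of degree \<open>n\<close> in
  \<open>A2 \<alpha>\<close>, equal to
  \<open>n! Gamma(\<alpha> + 2) / Gamma(n + \<alpha> + 2)\<close>.\<close>

definition wt :: "real \<Rightarrow> nat \<Rightarrow> real" where
  "wt \<alpha> n = (\<alpha> + 1) * Beta (real n + 1) (\<alpha> + 1)"

definition lam :: "real \<Rightarrow> nat \<Rightarrow> real" where
  "lam \<alpha> n = (\<alpha> + 1) / (real n + \<alpha> + 1)"

lemma wt_pos: "\<alpha> > -1 \<Longrightarrow> 0 < wt \<alpha> n"
  using Beta_pos[of "real n + 1" "\<alpha> + 1"] by (simp add: wt_def)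

lemma wt_Suc: "\<alpha> > -1 \<Longrightarrow> wt \<alpha> (Suc n) = real (Suc n) / (real (Suc n) + \<alpha> + 1) * wt \<alpha> n"
  using Beta_Suc_left[of "real (Suc n)" "\<alpha> + 1"] by (simp add: wt_def field_simps)

lemma lam_bounds: "\<alpha> > -1 \<Longrightarrow> 0 < lam \<alpha> n" "\<alpha> > -1 \<Longrightarrow> lam \<alpha> n \<le> 1"
  by (auto simp: lam_def field_simps intro!: divide_pos_pos)

lemma lam_tendsto: "lam \<alpha> \<longlonglongrightarrow> 0"
  unfolding lam_def by real_asymp

lemma A2_alpha_iff:
  assumes a: "\<alpha> > -1"
  shows "f \<in> A2 \<alpha> \<longleftrightarrow> f holomorphic_on unit_disc \<and> (\<forall>z. z \<notin> unit_disc \<longrightarrow> f z = 0) \<and>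
    summable (\<lambda>n. (cmod (of_real (sqrt (wt \<alpha> n)) * coef f n))\<^sup>2)"
proof -
  have "(cmod (of_real (sqrt (wt \<alpha> n)) * coef f n))\<^sup>2 = (\<alpha> + 1) * ((cmod (coef f n))\<^sup>2 * Beta (real n + 1) (\<alpha> + 1))" for n
    using wt_pos[OF a, of n] by (simp add: norm_mult power_mult_distrib wt_def)
  then have "summable (\<lambda>n. (cmod (of_real (sqrt (wt \<alpha> n)) * coef f n))\<^sup>2)
      \<longleftrightarrow> summable (\<lambda>n. (cmod (coef f n))\<^sup>2 * Beta (real n + 1) (\<alpha> + 1))"
    using a by (simp only: summable_cmult_iff) auto
  then show ?thesis
    using A2_iff[of 0 \<alpha> f] a by simp
qed

text \<open>Order \<open>k = 1\<close> is admissible for the exponent \<open>\<alpha> - 2\<close>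
  and turns the condition into one on \<open>f'\<close> with exponent \<alpha>. The resulting
  weights differ from \<open>wt \<alpha> n / (lam \<alpha> n)\<^sup>2\<close> only by a factor that
  stays between positive constants.\<close>

lemma A2_minus_two_iff:
  assumes a: "\<alpha> > -1"
  shows "f \<in> A2 (\<alpha> - 2) \<longleftrightarrow> f holomorphic_on unit_disc \<and> (\<forall>z. z \<notin> unit_disc \<longrightarrow> f z = 0) \<and>
    summable (\<lambda>n. (cmod (of_real (sqrt (wt \<alpha> n) / lam \<alpha> n) * coef f n))\<^sup>2)"
proof -
  define B where "B = \<alpha> + 1"
  have B: "0 < B" using a by (simp add: B_def)
  let ?u = "\<lambda>n. (cmod (coef (deriv f) n))\<^sup>2 * Beta (real n + 1) B"
  let ?v = "\<lambda>n. (cmod (of_real (sqrt (wt \<alpha> n) / lam \<alpha> n) * coef f n))\<^sup>2"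
  have v: "?v (Suc n) = (1 / B) * (1 + B / real (Suc n)) * ?u n" for n
  proof -
    define m where "m = real (Suc n)"
    have m: "0 < m" by (simp add: m_def)
    have "?v (Suc n) = wt \<alpha> (Suc n) / (lam \<alpha> (Suc n))\<^sup>2 * (cmod (coef f (Suc n)))\<^sup>2"
      using wt_pos[OF a, of "Suc n"] by (simp add: norm_mult norm_divide power_mult_distrib power_divide)
    also have "wt \<alpha> (Suc n) / (lam \<alpha> (Suc n))\<^sup>2 = (m + B) / B * ((m + B) * Beta (m + 1) B)"
    proof -
      have w: "wt \<alpha> (Suc n) = B * Beta (m + 1) B" and l: "lam \<alpha> (Suc n) = B / (m + B)"
        by (simp_all add: wt_def lam_def B_def m_def add.assoc)
      show ?thesis
        unfolding w l using B m by (simp add: power2_eq_square field_simps)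
    qed
    also have "(m + B) * Beta (m + 1) B = m * Beta m B"
      by (rule Beta_Suc_left[OF m B])
    also have "(m + B) / B * (m * Beta m B) * (cmod (coef f (Suc n)))\<^sup>2 = (1 / B) * (1 + B / m) * ?u n"
      using m B by (simp add: coef_deriv norm_mult power_mult_distrib m_def[symmetric] power2_eq_square field_simps
          del: of_nat_Suc) (simp add: m_def algebra_simps)
    finally show ?thesis by (simp add: m_def)
  qed
  have u0: "0 \<le> ?u n" for n
    using Beta_pos[of "real n + 1" B] B by simp
  have "summable ?u \<longleftrightarrow> summable (\<lambda>n. ?v (Suc n))"
  proof (rule summable_comparable)
    fix n
    show "0 \<le> ?u n" by (rule u0)
    have q: "1 \<le> 1 + B / real (Suc n)" "1 + B / real (Suc n) \<le> 1 + B"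
      using B by (auto simp: field_simps)
    have "1 / B * 1 \<le> 1 / B * (1 + B / real (Suc n))" "1 / B * (1 + B / real (Suc n)) \<le> 1 / B * (1 + B)"
      using q B by (intro mult_left_mono; simp)+
    from this[THEN mult_right_mono, OF u0[of n]]
    show "1 / B * ?u n \<le> ?v (Suc n)" "?v (Suc n) \<le> ((1 / B) * (1 + B)) * ?u n"
      unfolding v by (simp_all only: mult_1_right)
  qed (use B in simp)
  also have "\<dots> \<longleftrightarrow> summable ?v"
    by (rule summable_Suc_iff)
  finally show ?thesis
    using A2_iff[of 1 "\<alpha> - 2" f] a by (simp add: B_def)
qed

section \<open>The Bergman space as a sequence space\<close>

lemma mult_le_sum_squares:
  fixes a b :: real
  assumes "0 \<le> a" "0 \<le> b"
  shows "a * b \<le> a\<^sup>2 + b\<^sup>2"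
  using sum_squares_bound[of a b] mult_nonneg_nonneg[OF assms] by linarith

locale bergman =
  fixes \<alpha> :: real
  assumes alpha: "\<alpha> > -1"
begin

lemma wt_pos' [simp]: "0 < wt \<alpha> n" "0 \<le> wt \<alpha> n" "wt \<alpha> n \<noteq> 0"
  using wt_pos[OF alpha, of n] by auto

lemma lam_pos [simp]: "0 < lam \<alpha> n" "0 \<le> lam \<alpha> n" "lam \<alpha> n \<noteq> 0" "lam \<alpha> n \<le> 1"
  using lam_bounds[OF alpha, of n] by auto

text \<open>Ratio test: consecutive terms have quotient
  \<open>r * (1 + (\<alpha> + 1) / (n + 1))\<close>, which tends to \<open>r\<close>. With
  \<open>r = (cmod w)\<^sup>2\<close> the sum is the squared norm of the reproducing kernel at
  \<open>w\<close>; the same sum makes the series of \<open>Phi\<close> converge in the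
  disc.\<close>

lemma summable_power_div_wt:
  assumes "0 \<le> r" "r < 1"
  shows "summable (\<lambda>n. r ^ n / wt \<alpha> n)"
proof -
  obtain c where c: "r < c" "c < 1"
    using assms dense by blast
  have "(\<lambda>n. r * (1 + (\<alpha> + 1) / real (Suc n))) \<longlonglongrightarrow> r"
    by real_asymp
  then have "\<forall>\<^sub>F n in sequentially. r * (1 + (\<alpha> + 1) / real (Suc n)) < c"
    using c by (simp add: order_tendsto_iff del: of_nat_Suc)
  then obtain N where N: "\<And>n. n \<ge> N \<Longrightarrow> r * (1 + (\<alpha> + 1) / real (Suc n)) < c"
    by (auto simp: eventually_sequentially)
  show ?thesis
  proof (rule summable_ratio_test[OF c(2)])
    fix n assume n: "N \<le> n"
    have pos: "0 < real (Suc n) + \<alpha> + 1"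
      using alpha by simp
    have "r ^ Suc n / wt \<alpha> (Suc n) = (r * (1 + (\<alpha> + 1) / real (Suc n))) * (r ^ n / wt \<alpha> n)"
      unfolding wt_Suc[OF alpha] using pos by (simp add: field_simps del: of_nat_Suc)
    also have "\<dots> \<le> c * (r ^ n / wt \<alpha> n)"
      using N[OF n] assms by (intro mult_right_mono) (auto simp del: of_nat_Suc)
    finally show "norm (r ^ Suc n / wt \<alpha> (Suc n)) \<le> c * norm (r ^ n / wt \<alpha> n)"
      using assms by simp
  qed
qed

definition Phi :: "ell2 \<Rightarrow> complex \<Rightarrow> complex" where
  "Phi x z = (if cmod z < 1 then \<Sum>n. coord x n / of_real (sqrt (wt \<alpha> n)) * z ^ n else 0)"

definition Phi_inv :: "(complex \<Rightarrow> complex) \<Rightarrow> ell2" where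
  "Phi_inv f = Abs_ell2 (\<lambda>n. of_real (sqrt (wt \<alpha> n)) * coef f n)"

lemma Phi_sums:
  assumes "cmod z < 1"
  shows "(\<lambda>n. coord x n / of_real (sqrt (wt \<alpha> n)) * z ^ n) sums Phi x z"
proof -
  have "summable (\<lambda>n. coord x n / of_real (sqrt (wt \<alpha> n)) * z ^ n)"
  proof (rule summable_comparison_test')
    show "summable (\<lambda>n. (cmod (coord x n))\<^sup>2 + ((cmod z)\<^sup>2) ^ n / wt \<alpha> n)"
      using assms by (intro summable_add summable_coord summable_power_div_wt) (auto simp: abs_square_less_1)
    fix n
    have "norm (coord x n / of_real (sqrt (wt \<alpha> n)) * z ^ n) = cmod (coord x n) * (cmod z ^ n / sqrt (wt \<alpha> n))"
      by (simp add: norm_mult norm_divide norm_power)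
    also have "\<dots> \<le> (cmod (coord x n))\<^sup>2 + (cmod z ^ n / sqrt (wt \<alpha> n))\<^sup>2"
      by (intro mult_le_sum_squares) auto
    also have "(cmod z ^ n / sqrt (wt \<alpha> n))\<^sup>2 = ((cmod z)\<^sup>2) ^ n / wt \<alpha> n"
      by (simp add: power_divide power_mult[symmetric] mult.commute)
    finally show "norm (coord x n / of_real (sqrt (wt \<alpha> n)) * z ^ n) \<le> (cmod (coord x n))\<^sup>2 + ((cmod z)\<^sup>2) ^ n / wt \<alpha> n" .
  qed
  then show ?thesis
    using assms by (simp add: Phi_def summable_sums)
qed

lemma Phi_outside: "z \<notin> unit_disc \<Longrightarrow> Phi x z = 0"
  by (simp add: Phi_def)

lemma Phi_holomorphic: "Phi x holomorphic_on unit_disc"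
  by (rule power_series_holomorphic[where a = "\<lambda>n. coord x n / of_real (sqrt (wt \<alpha> n))"])
    (use Phi_sums in auto)

lemma coef_Phi: "coef (Phi x) n = coord x n / of_real (sqrt (wt \<alpha> n))"
  by (rule coef_unique) (rule Phi_sums)

lemma Phi_in_A2: "Phi x \<in> A2 \<alpha>"
  unfolding A2_alpha_iff[OF alpha]
  by (simp add: Phi_holomorphic Phi_outside coef_Phi summable_coord)

lemma Phi_inv_Phi [simp]: "Phi_inv (Phi x) = x"
  by (simp add: Phi_inv_def coef_Phi coord_inverse)

lemma Phi_Phi_inv [simp]:
  assumes "f \<in> A2 \<alpha>"
  shows "Phi (Phi_inv f) = f"
proof
  fix z
  have f: "f holomorphic_on unit_disc" "z \<notin> unit_disc \<Longrightarrow> f z = 0"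
    "summable (\<lambda>n. (cmod (of_real (sqrt (wt \<alpha> n)) * coef f n))\<^sup>2)"
    using assms unfolding A2_alpha_iff[OF alpha] by auto
  show "Phi (Phi_inv f) z = f z"
  proof (cases "cmod z < 1")
    case True
    show ?thesis
      using Phi_sums[OF True, of "Phi_inv f"] coef_sums[OF f(1) True]
      by (simp add: Phi_inv_def coord_Abs_ell2[OF f(3)] sums_iff)
  next
    case False
    then show ?thesis using f(2) by (simp add: Phi_outside)
  qed
qed

lemma range_Phi: "range Phi = A2 \<alpha>"
  using Phi_in_A2 Phi_Phi_inv by (metis (no_types, lifting) image_iff rangeI subsetI subset_antisym UNIV_I image_subset_iff)

lemma Phi_inject [simp]: "Phi x = Phi y \<longleftrightarrow> x = y"
  by (metis Phi_inv_Phi)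

lemma Phi_add: "Phi (x + y) z = Phi x z + Phi y z"
proof (cases "cmod z < 1")
  case True
  have "(\<lambda>n. coord (x + y) n / of_real (sqrt (wt \<alpha> n)) * z ^ n) sums (Phi x z + Phi y z)"
    using sums_add[OF Phi_sums[OF True, of x] Phi_sums[OF True, of y]]
    by (simp add: add_divide_distrib distrib_right)
  then show ?thesis
    using Phi_sums[OF True, of "x + y"] sums_unique2 by blast
qed (simp add: Phi_def)

lemma Phi_scaleR: "Phi (r *\<^sub>R x) z = of_real r * Phi x z"
proof (cases "cmod z < 1")
  case True
  have "(\<lambda>n. coord (r *\<^sub>R x) n / of_real (sqrt (wt \<alpha> n)) * z ^ n) sums (of_real r * Phi x z)"
    using sums_mult[OF Phi_sums[OF True, of x], of "of_real r"]
    by (simp add: scaleR_conv_of_real mult_ac)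
  then show ?thesis
    using Phi_sums[OF True, of "r *\<^sub>R x"] sums_unique2 by blast
qed (simp add: Phi_def)

lemma Phi_zero: "Phi 0 z = 0"
  using Phi_scaleR[of 0 0 z] by simp

lemma Phi_diff: "Phi (x - y) z = Phi x z - Phi y z"
  using Phi_add[of "x - y" y z] by simp

lemma Phi_measurable [measurable]: "Phi x \<in> borel_measurable borel"
proof -
  have "Phi x = (\<lambda>z. indicator unit_disc z *\<^sub>R Phi x z)"
    by (auto simp: indicator_def Phi_outside)
  then show ?thesis
    using measurable_holomorphic_indicator[OF Phi_holomorphic[of x]] by metis
qed

lemma sets_weighted_area [measurable_cong]: "sets (weighted_area \<alpha>) = sets borel"
  by (simp add: weighted_area_def sets_area)

lemma nn_integral_Phi: "(\<integral>\<^sup>+z. ennreal ((cmod (Phi x z))\<^sup>2) \<partial>weighted_area \<alpha>) = ennreal ((norm x)\<^sup>2)"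
proof -
  have "(\<integral>\<^sup>+z. ennreal ((cmod (Phi x z))\<^sup>2) \<partial>weighted_area \<alpha>)
     = (\<integral>\<^sup>+z. ennreal ((\<alpha> + 1) * (1 - (cmod z)\<^sup>2) powr \<alpha>) * ennreal ((cmod (Phi x z))\<^sup>2) \<partial>area)"
    unfolding weighted_area_def by (rule nn_integral_density) measurable
  also have "\<dots> = (\<integral>\<^sup>+z. ennreal (\<alpha> + 1) * (ennreal ((1 - (cmod z)\<^sup>2) powr \<alpha> * (cmod (Phi x z))\<^sup>2) * indicator unit_disc z) \<partial>area)"
    using alpha by (intro nn_integral_cong) (auto simp: indicator_def Phi_outside ennreal_mult' mult_ac)
  also have "\<dots> = ennreal (\<alpha> + 1) * (\<integral>\<^sup>+z\<in>unit_disc. ennreal ((1 - (cmod z)\<^sup>2) powr \<alpha> * (cmod (Phi x z))\<^sup>2) \<partial>area)"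
    by (intro nn_integral_cmult borel_measurable_times_ennreal borel_measurable_indicator)
      (simp_all add: sets_area, measurable)
  also have "\<dots> = (\<Sum>n. ennreal (\<alpha> + 1) * ennreal ((cmod (coef (Phi x) n))\<^sup>2 * Beta (real n + 1) (\<alpha> + 1)))"
    by (simp only: disc_parseval[OF Phi_holomorphic alpha] ennreal_suminf_cmult)
  also have "\<dots> = (\<Sum>n. ennreal ((cmod (coord x n))\<^sup>2))"
  proof (intro arg_cong[where f = suminf] ext)
    fix n
    have "(\<alpha> + 1) * ((cmod (coef (Phi x) n))\<^sup>2 * Beta (real n + 1) (\<alpha> + 1)) = wt \<alpha> n * (cmod (coef (Phi x) n))\<^sup>2"
      by (simp add: wt_def)
    also have "\<dots> = (cmod (coord x n))\<^sup>2"
      by (simp add: coef_Phi norm_divide power_divide)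
    finally show "ennreal (\<alpha> + 1) * ennreal ((cmod (coef (Phi x) n))\<^sup>2 * Beta (real n + 1) (\<alpha> + 1)) = ennreal ((cmod (coord x n))\<^sup>2)"
      using alpha by (simp add: ennreal_mult'[symmetric])
  qed
  also have "\<dots> = ennreal ((norm x)\<^sup>2)"
    unfolding norm_ell2_sq by (rule suminf_ennreal2) (auto simp: summable_coord)
  finally show ?thesis .
qed

lemma integrable_Phi_sq: "integrable (weighted_area \<alpha>) (\<lambda>z. (cmod (Phi x z))\<^sup>2)"
  by (rule integrableI_nonneg) (auto simp: nn_integral_Phi)

lemma integral_Phi_sq: "(LINT z|weighted_area \<alpha>. (cmod (Phi x z))\<^sup>2) = (norm x)\<^sup>2"
  by (subst integral_eq_nn_integral) (auto simp: nn_integral_Phi)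

lemma integrable_Phi_mult: "integrable (weighted_area \<alpha>) (\<lambda>z. Phi x z * cnj (Phi y z))"
proof (rule Bochner_Integration.integrable_bound)
  show "integrable (weighted_area \<alpha>) (\<lambda>z. (cmod (Phi x z))\<^sup>2 + (cmod (Phi y z))\<^sup>2)"
    by (intro Bochner_Integration.integrable_add integrable_Phi_sq)
  show "AE z in weighted_area \<alpha>. norm (Phi x z * cnj (Phi y z)) \<le> norm ((cmod (Phi x z))\<^sup>2 + (cmod (Phi y z))\<^sup>2)"
  proof (rule AE_I2)
    fix z
    show "norm (Phi x z * cnj (Phi y z)) \<le> norm ((cmod (Phi x z))\<^sup>2 + (cmod (Phi y z))\<^sup>2)"
      using mult_le_sum_squares[of "cmod (Phi x z)" "cmod (Phi y z)"] by (simp add: norm_mult)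
  qed
qed measurable

lemma bergman_inner_self: "bergman_inner \<alpha> (Phi x) (Phi x) = of_real ((norm x)\<^sup>2)"
proof -
  have "bergman_inner \<alpha> (Phi x) (Phi x) = (LINT z|weighted_area \<alpha>. complex_of_real ((cmod (Phi x z))\<^sup>2))"
    unfolding bergman_inner_def by (simp only: complex_norm_square)
  then show ?thesis
    by (simp only: integral_complex_of_real integral_Phi_sq)
qed

lemma Re_bergman_inner: "Re (bergman_inner \<alpha> (Phi x) (Phi y)) = inner x y"
proof -
  have "Re (bergman_inner \<alpha> (Phi x) (Phi y)) = (LINT z|weighted_area \<alpha>. Re (Phi x z * cnj (Phi y z)))"
    unfolding bergman_inner_def
    by (rule integral_bounded_linear[OF bounded_linear_Re integrable_Phi_mult, symmetric])
  \<comment> \<open>Polarization reduces the inner product to squared norms, which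
    \<open>Phi\<close> is already known to preserve.\<close>
  also have "(\<lambda>z. Re (Phi x z * cnj (Phi y z))) = (\<lambda>z. ((cmod (Phi (x + y) z))\<^sup>2 - (cmod (Phi (x - y) z))\<^sup>2) / 4)"
    by (simp add: Phi_add Phi_diff cmod_power2) (simp add: algebra_simps power2_eq_square add_divide_distrib)
  also have "(LINT z|weighted_area \<alpha>. ((cmod (Phi (x + y) z))\<^sup>2 - (cmod (Phi (x - y) z))\<^sup>2) / 4)
      = ((norm (x + y))\<^sup>2 - (norm (x - y))\<^sup>2) / 4"
    by (simp add: integrable_Phi_sq integral_Phi_sq Bochner_Integration.integral_diff)
  also have "\<dots> = inner x y"
    by (simp add: power2_norm_eq_inner inner_simps inner_commute)
  finally show ?thesis .
qed

lemma bergman_dist_Phi: "bergman_dist \<alpha> (Phi x) (Phi y) = dist x y"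
proof -
  have "(\<lambda>z. Phi x z - Phi y z) = Phi (x - y)"
    by (rule ext) (simp add: Phi_diff)
  then show ?thesis
    by (simp add: bergman_dist_def bergman_inner_self dist_norm)
qed

lemma bergman_dist_Phi_zero: "bergman_dist \<alpha> (Phi x) (\<lambda>_. 0) = norm x"
  using bergman_dist_Phi[of x 0] by (simp add: Phi_zero[abs_def])

lemma Metric_space_bergman: "Metric_space (A2 \<alpha>) (bergman_dist \<alpha>)"
proof
  fix f g h :: "complex \<Rightarrow> complex"
  \<comment> \<open>\<open>Metric_space\<close> demands nonnegativity and symmetry for arbitrary
    functions, so the distance is written as an integral; the other two axioms concern members of
    \<open>A2 \<alpha>\<close> and come from \<open>ell2\<close>.\<close>
  have sq: "bergman_dist \<alpha> f g = sqrt (LINT z|weighted_area \<alpha>. (cmod (f z - g z))\<^sup>2)" for f g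
  proof -
    have "bergman_inner \<alpha> (\<lambda>z. f z - g z) (\<lambda>z. f z - g z)
        = (LINT z|weighted_area \<alpha>. complex_of_real ((cmod (f z - g z))\<^sup>2))"
      unfolding bergman_inner_def by (simp only: complex_norm_square)
    then show ?thesis
      by (simp only: bergman_dist_def integral_complex_of_real Re_complex_of_real)
  qed
  show "0 \<le> bergman_dist \<alpha> f g"
    unfolding sq by (simp add: Bochner_Integration.integral_nonneg)
  show "bergman_dist \<alpha> f g = bergman_dist \<alpha> g f"
    unfolding sq by (simp add: norm_minus_commute)
  show "bergman_dist \<alpha> f g = 0 \<longleftrightarrow> f = g" if "f \<in> A2 \<alpha>" "g \<in> A2 \<alpha>"
    using that bergman_dist_Phi[of "Phi_inv f" "Phi_inv g"] by (metis Phi_Phi_inv dist_eq_0_iff)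
  show "bergman_dist \<alpha> f h \<le> bergman_dist \<alpha> f g + bergman_dist \<alpha> g h"
    if "f \<in> A2 \<alpha>" "g \<in> A2 \<alpha>" "h \<in> A2 \<alpha>"
    using that dist_triangle[of "Phi_inv f" "Phi_inv h" "Phi_inv g"]
    by (simp flip: bergman_dist_Phi)
qed

end

section \<open>Multiplication operators and their defect operators\<close>

text \<open>The algebra \<open>H^\<infinity>\<close>. The bound is left open because the functions
  that occur in the factorization of a defect operator, such as reciprocals and derivatives, need
  not be contractive.\<close>

definition multiplier :: "(complex \<Rightarrow> complex) \<Rightarrow> bool" where
  "multiplier \<phi> \<longleftrightarrow> \<phi> holomorphic_on unit_disc \<and> bounded (\<phi> ` unit_disc)"

lemma multiplierE:
  assumes "multiplier \<phi>"
  obtains B where "0 \<le> B" "\<And>z. cmod z < 1 \<Longrightarrow> cmod (\<phi> z) \<le> B"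
proof -
  obtain B where "\<And>z. cmod z < 1 \<Longrightarrow> cmod (\<phi> z) \<le> B"
    using assms unfolding multiplier_def bounded_iff by (metis imageI mem_ball_0)
  moreover have "0 \<le> B"
    using order_trans[OF norm_ge_zero calculation[of 0]] by simp
  ultimately show ?thesis using that by blast
qed

lemma multiplierI:
  assumes "\<phi> holomorphic_on unit_disc" "\<And>z. cmod z < 1 \<Longrightarrow> cmod (\<phi> z) \<le> B"
  shows "multiplier \<phi>"
  using assms unfolding multiplier_def bounded_iff by (auto intro!: exI[of _ B])

lemma multiplier_mult:
  assumes "multiplier \<phi>" "multiplier \<psi>"
  shows "multiplier (\<lambda>z. \<phi> z * \<psi> z)"
proof -
  obtain A B where "\<And>z. cmod z < 1 \<Longrightarrow> cmod (\<phi> z) \<le> A" "\<And>z. cmod z < 1 \<Longrightarrow> cmod (\<psi> z) \<le> B" "0 \<le> A"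
    using assms by (metis multiplierE)
  then show ?thesis
    using assms by (intro multiplierI[where B = "A * B"])
      (auto simp: multiplier_def norm_mult intro!: holomorphic_intros mult_mono)
qed

lemma multiplier_add:
  assumes "multiplier \<phi>" "multiplier \<psi>"
  shows "multiplier (\<lambda>z. \<phi> z + \<psi> z)"
proof -
  obtain A B where "\<And>z. cmod z < 1 \<Longrightarrow> cmod (\<phi> z) \<le> A" "\<And>z. cmod z < 1 \<Longrightarrow> cmod (\<psi> z) \<le> B"
    using assms by (metis multiplierE)
  then show ?thesis
    using assms by (intro multiplierI[where B = "A + B"])
      (auto simp: multiplier_def intro!: holomorphic_intros norm_triangle_mono)
qed

lemma multiplier_const: "multiplier (\<lambda>_. c)"
  by (rule multiplierI[where B = "cmod c"]) auto

lemma multiplier_id: "multiplier (\<lambda>z. z)"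
  by (rule multiplierI[where B = 1]) auto

lemma coef_cong:
  assumes "f holomorphic_on unit_disc" "\<And>z. cmod z < 1 \<Longrightarrow> f z = g z"
  shows "coef g n = coef f n"
  by (rule coef_unique) (use coef_sums[OF assms(1)] assms(2) in force)

lemma coef_euler:
  assumes f: "f holomorphic_on unit_disc"
  shows "coef (\<lambda>z. z * deriv f z + c * f z) n = (of_nat n + c) * coef f n"
proof (rule coef_unique)
  fix z :: complex assume z: "cmod z < 1"
  have "deriv f holomorphic_on unit_disc"
    by (intro holomorphic_deriv f) auto
  from sums_mult[OF coef_sums[OF this z], of z]
  have "(\<lambda>n. of_nat (Suc n) * coef f (Suc n) * z ^ Suc n) sums (z * deriv f z)"
    by (simp add: coef_deriv mult_ac del: of_nat_Suc)
  then have "(\<lambda>n. of_nat n * coef f n * z ^ n) sums (z * deriv f z)"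
    by (subst (asm) sums_Suc_iff) simp
  from sums_add[OF this sums_mult[OF coef_sums[OF f z], of c]]
  show "(\<lambda>n. (of_nat n + c) * coef f n * z ^ n) sums (z * deriv f z + c * f z)"
    by (simp add: algebra_simps)
qed

context bergman
begin

definition mop :: "(complex \<Rightarrow> complex) \<Rightarrow> ell2 \<Rightarrow> ell2" where
  "mop \<phi> x = Phi_inv (\<lambda>z. \<phi> z * Phi x z)"

lemma mult_Phi_in_A2:
  assumes "multiplier \<phi>"
  shows "(\<lambda>z. \<phi> z * Phi x z) \<in> A2 \<alpha>"
proof -
  obtain B where B: "0 \<le> B" "\<And>z. cmod z < 1 \<Longrightarrow> cmod (\<phi> z) \<le> B"
    using assms by (metis multiplierE)
  have hol: "(\<lambda>z. \<phi> z * Phi x z) holomorphic_on unit_disc"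
    using assms by (auto simp: multiplier_def intro!: holomorphic_intros Phi_holomorphic)
  have fin: "(\<integral>\<^sup>+z\<in>unit_disc. ennreal ((1 - (cmod z)\<^sup>2) powr \<alpha> * (cmod (Phi x z))\<^sup>2) \<partial>area) < \<infinity>"
    using Phi_in_A2[of x] A2_iff[of 0 \<alpha> "Phi x"] disc_integral_finite_iff[OF Phi_holomorphic alpha, of x] alpha
    by simp
  have "(\<integral>\<^sup>+z\<in>unit_disc. ennreal ((1 - (cmod z)\<^sup>2) powr \<alpha> * (cmod (\<phi> z * Phi x z))\<^sup>2) \<partial>area)
      \<le> (\<integral>\<^sup>+z. ennreal (B\<^sup>2) * (ennreal ((1 - (cmod z)\<^sup>2) powr \<alpha> * (cmod (Phi x z))\<^sup>2) * indicator unit_disc z) \<partial>area)"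
  proof (rule nn_integral_mono)
    fix z
    show "ennreal ((1 - (cmod z)\<^sup>2) powr \<alpha> * (cmod (\<phi> z * Phi x z))\<^sup>2) * indicator unit_disc z
      \<le> ennreal (B\<^sup>2) * (ennreal ((1 - (cmod z)\<^sup>2) powr \<alpha> * (cmod (Phi x z))\<^sup>2) * indicator unit_disc z)"
    proof (cases "cmod z < 1")
      case True
      have "(1 - (cmod z)\<^sup>2) powr \<alpha> * (cmod (\<phi> z * Phi x z))\<^sup>2
          = (cmod (\<phi> z))\<^sup>2 * ((1 - (cmod z)\<^sup>2) powr \<alpha> * (cmod (Phi x z))\<^sup>2)"
        by (simp add: norm_mult power_mult_distrib)
      also have "\<dots> \<le> B\<^sup>2 * ((1 - (cmod z)\<^sup>2) powr \<alpha> * (cmod (Phi x z))\<^sup>2)"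
        by (intro mult_right_mono power_mono B(2) True) auto
      finally show ?thesis
        using True by (simp add: indicator_def ennreal_mult'[symmetric] ennreal_leI)
    qed (simp add: indicator_def)
  qed
  also have "\<dots> = ennreal (B\<^sup>2) * (\<integral>\<^sup>+z\<in>unit_disc. ennreal ((1 - (cmod z)\<^sup>2) powr \<alpha> * (cmod (Phi x z))\<^sup>2) \<partial>area)"
    by (intro nn_integral_cmult borel_measurable_times_ennreal borel_measurable_indicator)
      (simp_all add: sets_area, measurable)
  also have "\<dots> < \<infinity>"
    using fin by (simp add: ennreal_mult_less_top)
  finally show ?thesis
    using A2_iff[of 0 \<alpha> "\<lambda>z. \<phi> z * Phi x z"] disc_integral_finite_iff[OF hol alpha] alpha hol
    by (simp add: Phi_outside)
qed

lemma Phi_mop_fun: "multiplier \<phi> \<Longrightarrow> Phi (mop \<phi> x) = (\<lambda>z. \<phi> z * Phi x z)"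
  by (simp add: mop_def mult_Phi_in_A2)

lemma Phi_mop: "multiplier \<phi> \<Longrightarrow> Phi (mop \<phi> x) z = \<phi> z * Phi x z"
  by (simp add: Phi_mop_fun)

lemma mop_eqI:
  assumes "multiplier \<phi>" "\<And>z. cmod z < 1 \<Longrightarrow> \<phi> z * Phi x z = Phi y z"
  shows "mop \<phi> x = y"
proof -
  have "Phi (mop \<phi> x) z = Phi y z" for z
    using assms by (cases "cmod z < 1") (auto simp: Phi_mop Phi_outside)
  then have "Phi (mop \<phi> x) = Phi y" ..
  then show ?thesis by simp
qed

lemma norm_mop_le:
  assumes "multiplier \<phi>" and B: "0 \<le> B" "\<And>z. cmod z < 1 \<Longrightarrow> cmod (\<phi> z) \<le> B"
  shows "norm (mop \<phi> x) \<le> B * norm x"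
proof -
  have "ennreal ((norm (mop \<phi> x))\<^sup>2) = (\<integral>\<^sup>+z. ennreal ((cmod (Phi (mop \<phi> x) z))\<^sup>2) \<partial>weighted_area \<alpha>)"
    by (simp add: nn_integral_Phi)
  also have "\<dots> \<le> (\<integral>\<^sup>+z. ennreal (B\<^sup>2) * ennreal ((cmod (Phi x z))\<^sup>2) \<partial>weighted_area \<alpha>)"
  proof (rule nn_integral_mono)
    fix z
    have "(cmod (Phi (mop \<phi> x) z))\<^sup>2 \<le> B\<^sup>2 * (cmod (Phi x z))\<^sup>2"
      using B(2)[of z] by (cases "cmod z < 1")
        (auto simp: Phi_mop[OF assms(1)] norm_mult power_mult_distrib Phi_outside intro!: mult_right_mono power_mono)
    then show "ennreal ((cmod (Phi (mop \<phi> x) z))\<^sup>2) \<le> ennreal (B\<^sup>2) * ennreal ((cmod (Phi x z))\<^sup>2)"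
      by (simp add: ennreal_mult'[symmetric] ennreal_leI)
  qed
  also have "\<dots> = ennreal (B\<^sup>2) * (\<integral>\<^sup>+z. ennreal ((cmod (Phi x z))\<^sup>2) \<partial>weighted_area \<alpha>)"
    by (rule nn_integral_cmult) measurable
  also have "\<dots> = ennreal ((B * norm x)\<^sup>2)"
    by (simp add: nn_integral_Phi ennreal_mult'[symmetric] power_mult_distrib)
  finally have "(norm (mop \<phi> x))\<^sup>2 \<le> (B * norm x)\<^sup>2"
    by simp
  then show ?thesis
    by (rule power2_le_imp_le) (use B(1) in simp)
qed

lemma bounded_linear_mop:
  assumes "multiplier \<phi>"
  shows "bounded_linear (mop \<phi>)"
proof -
  obtain B where B: "0 \<le> B" "\<And>z. cmod z < 1 \<Longrightarrow> cmod (\<phi> z) \<le> B"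
    using assms by (metis multiplierE)
  show ?thesis
  proof (rule bounded_linear_intro[where K = B])
    show "mop \<phi> (x + y) = mop \<phi> x + mop \<phi> y" "mop \<phi> (r *\<^sub>R x) = r *\<^sub>R mop \<phi> x" for x y r
      by (rule mop_eqI[OF assms], simp add: Phi_add Phi_scaleR Phi_mop assms algebra_simps)+
    show "norm (mop \<phi> x) \<le> norm x * B" for x
      using norm_mop_le[OF assms B, of x] by (simp add: mult.commute)
  qed
qed

lemma mop_mop:
  assumes "multiplier \<phi>" "multiplier \<psi>"
  shows "mop \<phi> (mop \<psi> x) = mop (\<lambda>z. \<phi> z * \<psi> z) x"
  using assms by (intro mop_eqI) (auto simp: Phi_mop multiplier_mult)

lemma mop_plus:
  assumes "multiplier \<phi>" "multiplier \<psi>"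
  shows "mop (\<lambda>z. \<phi> z + \<psi> z) x = mop \<phi> x + mop \<psi> x"
  using assms by (intro mop_eqI) (auto simp: Phi_mop Phi_add multiplier_add algebra_simps)

lemma mop_cong:
  assumes "multiplier \<phi>" "\<And>z. cmod z < 1 \<Longrightarrow> \<psi> z = \<phi> z"
  shows "mop \<psi> x = mop \<phi> x"
proof -
  have "(\<lambda>z. \<psi> z * Phi x z) = (\<lambda>z. \<phi> z * Phi x z)"
    by (rule ext) (metis Phi_outside assms(2) dist_0_norm mem_ball mult_zero_right)
  then show ?thesis by (simp add: mop_def)
qed

lemma coord_mop: "multiplier \<phi> \<Longrightarrow> coord (mop \<phi> x) n = of_real (sqrt (wt \<alpha> n)) * coef (\<lambda>z. \<phi> z * Phi x z) n"
  using coef_Phi[of "mop \<phi> x" n] by (simp add: Phi_mop_fun field_simps)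

text \<open>Since \<open>ell2\<close> is only a real vector space, complex scalars act on it through
  multiplication by constant functions; this rule makes that action computable.\<close>

lemma coord_mop_const: "coord (mop (\<lambda>_. c) x) n = c * coord x n"
proof -
  have "coef (\<lambda>z. c * Phi x z) n = c * coef (Phi x) n"
    by (rule coef_unique) (use sums_mult[OF coef_sums[OF Phi_holomorphic], of _ c] in \<open>simp add: mult.assoc\<close>)
  then show ?thesis
    by (simp add: coord_mop multiplier_const coef_Phi)
qed

lemma norm_mop_const: "norm (mop (\<lambda>_. c) x) = cmod c * norm x"
proof -
  have "(norm (mop (\<lambda>_. c) x))\<^sup>2 = (cmod c * norm x)\<^sup>2"
    by (simp add: norm_ell2_sq coord_mop_const norm_mult power_mult_distrib suminf_mult summable_coord)
  then show ?thesis
    by (simp add: power2_eq_iff_nonneg)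
qed

abbreviation adj :: "(complex \<Rightarrow> complex) \<Rightarrow> ell2 \<Rightarrow> ell2" where
  "adj \<phi> \<equiv> adjoint (mop \<phi>)"

lemma inner_adj: "multiplier \<phi> \<Longrightarrow> inner x (adj \<phi> y) = inner (mop \<phi> x) y"
  by (intro inner_adjoint_ell2 bounded_linear_mop)

lemma bounded_linear_adj: "multiplier \<phi> \<Longrightarrow> bounded_linear (adj \<phi>)"
  by (intro bounded_linear_adjoint_ell2 bounded_linear_mop)

lemma adj_mult:
  assumes "multiplier \<phi>" "multiplier \<psi>"
  shows "adj (\<lambda>z. \<phi> z * \<psi> z) x = adj \<psi> (adj \<phi> x)"
  by (rule inner_eq_left_imp_eq) (simp add: inner_adj assms multiplier_mult mop_mop)

lemma adj_const: "adj (\<lambda>_. c) x = mop (\<lambda>_. cnj c) x"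
proof (rule adjoint_ell2_unique[OF bounded_linear_mop[OF multiplier_const]])
  show "inner (mop (\<lambda>_. c) y) x = inner y (mop (\<lambda>_. cnj c) x)" for y
    unfolding inner_ell2_def by (simp only: coord_mop_const complex_cnj_mult complex_cnj_cnj mult_ac)
qed

text \<open>The adjoint in \<open>ell2\<close> matches only the real parts of the inner products.
  Replacing \<open>x\<close> by \<open>mop (\<lambda>_. \<i>) x\<close>, which commutes with
  \<open>mop \<phi>\<close>, matches the imaginary parts as well.\<close>

lemma bergman_adjoint_Phi:
  assumes \<phi>: "multiplier \<phi>"
  shows "bergman_adjoint \<alpha> (mult_op \<phi>) (Phi g) = Phi (adj \<phi> g)"
  unfolding bergman_adjoint_def
proof (rule the_equality)
  have mo: "mult_op \<phi> (Phi x) = Phi (mop \<phi> x)" for x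
    by (rule ext) (simp add: mult_op_def Phi_mop \<phi>)
  have scale: "bergman_inner \<alpha> (Phi (mop (\<lambda>_. c) x)) h = c * bergman_inner \<alpha> (Phi x) h" for c x h
    by (simp add: bergman_inner_def Phi_mop multiplier_const mult.assoc)
  have comm: "mop \<phi> (mop (\<lambda>_. c) x) = mop (\<lambda>_. c) (mop \<phi> x)" for c x
    by (simp add: mop_mop multiplier_const \<phi> mult.commute)
  have Re_eq: "Re (bergman_inner \<alpha> (Phi (mop \<phi> x)) (Phi g)) = Re (bergman_inner \<alpha> (Phi x) (Phi (adj \<phi> g)))" for x
    by (simp add: Re_bergman_inner inner_adj \<phi>)
  have "bergman_inner \<alpha> (Phi (mop \<phi> x)) (Phi g) = bergman_inner \<alpha> (Phi x) (Phi (adj \<phi> g))" for x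
    using Re_eq[of x] Re_eq[of "mop (\<lambda>_. \<i>) x"] by (simp add: comm scale complex_eq_iff)
  then show "Phi (adj \<phi> g) \<in> A2 \<alpha> \<and> (\<forall>f\<in>A2 \<alpha>. bergman_inner \<alpha> (mult_op \<phi> f) (Phi g) = bergman_inner \<alpha> f (Phi (adj \<phi> g)))"
    by (auto simp: Phi_in_A2 mo simp flip: range_Phi)
  fix h
  assume h: "h \<in> A2 \<alpha> \<and> (\<forall>f\<in>A2 \<alpha>. bergman_inner \<alpha> (mult_op \<phi> f) (Phi g) = bergman_inner \<alpha> f h)"
  then obtain y where y: "h = Phi y"
    by (metis Phi_Phi_inv)
  have "inner (mop \<phi> x) g = inner x y" for x
    using h[THEN conjunct2, rule_format, OF Phi_in_A2[of x]] by (simp add: mo y flip: Re_bergman_inner)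
  then have "adj \<phi> g = y"
    by (intro adjoint_ell2_unique bounded_linear_mop \<phi>)
  then show "h = Phi (adj \<phi> g)"
    by (simp add: y)
qed

definition defect :: "(complex \<Rightarrow> complex) \<Rightarrow> ell2 \<Rightarrow> ell2" where
  "defect \<phi> x = x - mop \<phi> (adj \<phi> x)"

lemma defect_op_Phi: "multiplier \<phi> \<Longrightarrow> defect_op \<alpha> \<phi> (Phi x) = Phi (defect \<phi> x)"
  by (rule ext) (simp add: defect_op_def bergman_adjoint_Phi mult_op_def defect_def Phi_diff Phi_mop)

lemma bounded_linear_defect: "multiplier \<phi> \<Longrightarrow> bounded_linear (defect \<phi>)"
  unfolding defect_def
  by (intro bounded_linear_sub bounded_linear_ident bounded_linear_compose[OF bounded_linear_mop bounded_linear_adj])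

lemma defect_op_image: "multiplier \<phi> \<Longrightarrow> defect_op \<alpha> \<phi> ` A2 \<alpha> = Phi ` range (defect \<phi>)"
  by (auto simp: defect_op_Phi image_iff simp flip: range_Phi)

section \<open>The diagonal operator \<open>Dg\<close> and the Euler operator it inverts\<close>

definition Dg :: "ell2 \<Rightarrow> ell2" where
  "Dg x = Abs_ell2 (\<lambda>n. of_real (lam \<alpha> n) * coord x n)"

lemma coord_Dg [simp]: "coord (Dg x) n = of_real (lam \<alpha> n) * coord x n"
  unfolding Dg_def
  by (subst coord_Abs_ell2) (rule summable_square_norm_mult[OF summable_coord, where B = 1], auto)

lemma norm_Dg_le: "norm (Dg x) \<le> norm x"
  by (rule norm_ell2_le) (simp add: norm_mult mult_left_le_one_le)

lemma bounded_linear_Dg: "bounded_linear Dg"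
  by (rule bounded_linear_intro[of _ 1]) (auto intro!: ell2_eqI simp: algebra_simps scaleR_conv_of_real norm_Dg_le)

lemma Dg_diff: "Dg (x - y) = Dg x - Dg y"
  by (rule linear_diff[OF bounded_linear.linear[OF bounded_linear_Dg]])

lemma Dg_inject [simp]: "Dg x = Dg y \<longleftrightarrow> x = y"
proof
  assume "Dg x = Dg y"
  then have "coord (Dg x) n = coord (Dg y) n" for n
    by simp
  then show "x = y"
    by (intro ell2_eqI) simp
qed simp

lemma inner_Dg_commute: "inner (Dg x) y = inner x (Dg y)"
  by (simp add: inner_ell2_def mult_ac)

text \<open>The entries of \<open>Dg\<close> lie between 0 and 1, so its square is dominated by
  \<open>Dg\<close> itself. In this way a bound on the quadratic form of a defect operator becomes a
  bound on norms.\<close>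

lemma norm_Dg_sq_le: "(norm (Dg x))\<^sup>2 \<le> inner (Dg x) x"
  unfolding power2_norm_eq_inner
  unfolding inner_ell2_def
proof (intro suminf_le summable_inner_ell2)
  fix n
  have "lam \<alpha> n * (lam \<alpha> n * (cmod (coord x n))\<^sup>2) \<le> lam \<alpha> n * (cmod (coord x n))\<^sup>2"
    by (intro mult_left_mono mult_left_le_one_le) auto
  moreover have "Re (coord (Dg x) n * cnj (coord (Dg x) n)) = lam \<alpha> n * (lam \<alpha> n * (cmod (coord x n))\<^sup>2)"
    unfolding Re_mult_cnj_self by (simp add: norm_mult power_mult_distrib) (simp add: power2_eq_square)
  moreover have "Re (coord (Dg x) n * cnj (coord x n)) = lam \<alpha> n * (cmod (coord x n))\<^sup>2"
    by (simp add: cmod_power2) (simp add: algebra_simps power2_eq_square)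
  ultimately show "Re (coord (Dg x) n * cnj (coord (Dg x) n)) \<le> Re (coord (Dg x) n * cnj (coord x n))"
    by simp
qed

lemma inner_Dg_nonneg: "0 \<le> inner (Dg x) x"
  using norm_Dg_sq_le[of x] zero_le_power2 order_trans by blast

lemma Phi_range_Dg: "Phi ` range Dg = A2 (\<alpha> - 2)"
proof (intro set_eqI iffI)
  fix f assume "f \<in> Phi ` range Dg"
  then obtain x where x: "f = Phi (Dg x)" by auto
  show "f \<in> A2 (\<alpha> - 2)"
    unfolding A2_minus_two_iff[OF alpha] x
    by (simp add: Phi_holomorphic Phi_outside coef_Phi summable_coord)
next
  fix f assume "f \<in> A2 (\<alpha> - 2)"
  then have f: "f holomorphic_on unit_disc" "\<And>z. z \<notin> unit_disc \<Longrightarrow> f z = 0"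
    and s: "summable (\<lambda>n. (cmod (of_real (sqrt (wt \<alpha> n) / lam \<alpha> n) * coef f n))\<^sup>2)"
    unfolding A2_minus_two_iff[OF alpha] by auto
  have "summable (\<lambda>n. (cmod (of_real (lam \<alpha> n) * (of_real (sqrt (wt \<alpha> n) / lam \<alpha> n) * coef f n)))\<^sup>2)"
    by (rule summable_square_norm_mult[OF s, where B = 1]) simp
  then have fA: "f \<in> A2 \<alpha>"
    unfolding A2_alpha_iff[OF alpha] using f by simp
  define y where "y = Abs_ell2 (\<lambda>n. of_real (sqrt (wt \<alpha> n) / lam \<alpha> n) * coef f n)"
  have "Dg y = Phi_inv f"
    unfolding y_def Phi_inv_def Dg_def coord_Abs_ell2[OF s] by simp
  then have "f = Phi (Dg y)"
    using fA by simp
  then show "f \<in> Phi ` range Dg" by blast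
qed

lemma range_subset_iff_Dg: "Phi ` S \<subseteq> A2 (\<alpha> - 2) \<longleftrightarrow> S \<subseteq> range Dg"
  unfolding Phi_range_Dg[symmetric] by (simp add: inj_image_subset_iff inj_def)

lemma range_eq_iff_Dg: "Phi ` S = A2 (\<alpha> - 2) \<longleftrightarrow> S = range Dg"
  unfolding Phi_range_Dg[symmetric] by (simp add: inj_image_eq_iff inj_def)

text \<open>In coefficients this is
  \<open>(n + \<alpha> + 1) * lam \<alpha> n = \<alpha> + 1\<close>: \<open>Dg\<close> inverts the
  Euler operator \<open>(z d/dz + \<alpha> + 1) / (\<alpha> + 1)\<close>.\<close>

lemma Dg_ode:
  assumes z: "cmod z < 1"
  shows "z * deriv (Phi (Dg x)) z + (of_real \<alpha> + 1) * Phi (Dg x) z = (of_real \<alpha> + 1) * Phi x z"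
proof -
  let ?L = "\<lambda>z. z * deriv (Phi (Dg x)) z + (of_real \<alpha> + 1) * Phi (Dg x) z"
  have hol: "?L holomorphic_on unit_disc"
    by (intro holomorphic_intros holomorphic_deriv Phi_holomorphic) auto
  have "coef ?L n = (of_real \<alpha> + 1) * coef (Phi x) n" for n
  proof -
    have "(real n + \<alpha> + 1) * lam \<alpha> n = \<alpha> + 1"
      using alpha by (simp add: lam_def)
    then have "(of_nat n + (of_real \<alpha> + 1)) * complex_of_real (lam \<alpha> n) = of_real \<alpha> + 1"
      by (metis (no_types, opaque_lifting) add.assoc of_real_1 of_real_add of_real_mult of_real_of_nat_eq)
    then show ?thesis
      unfolding coef_euler[OF Phi_holomorphic] by (simp add: coef_Phi flip: mult.assoc)
  qed
  then show ?thesis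
    using coef_sums[OF hol z] sums_mult[OF coef_sums[OF Phi_holomorphic z], of "of_real \<alpha> + 1" x]
    by (simp add: sums_iff mult.assoc)
qed

text \<open>For the Euler operator \<open>L\<close> inverted by \<open>Dg\<close>, the product rule
  reads \<open>L (e f) = e (L f) + d f\<close> with \<open>d = z e' / (\<alpha> + 1)\<close>. For
  \<open>f\<close> given by \<open>Dg x\<close> the first term belongs to \<open>mop e x\<close>,
  and applying \<open>Dg\<close> to both sides gives the identity. The term with \<open>d\<close> is
  the one of lower order.\<close>

lemma mop_Dg:
  assumes e: "multiplier e" and d: "multiplier d"
    and ed: "\<And>z. cmod z < 1 \<Longrightarrow> (of_real \<alpha> + 1) * d z = z * deriv e z"
  shows "mop e (Dg x) = Dg (mop e x + mop d (Dg x))"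
proof (rule ell2_eqI)
  fix n
  let ?c = "complex_of_real \<alpha> + 1"
  let ?H = "Phi (mop e (Dg x))" and ?R = "Phi (mop e x + mop d (Dg x))"
  have eh: "e holomorphic_on unit_disc"
    using e by (simp add: multiplier_def)
  have "?c * ?R z = z * deriv ?H z + ?c * ?H z" if z: "cmod z < 1" for z
  proof -
    have "deriv ?H z = deriv (\<lambda>z. e z * Phi (Dg x) z) z"
      by (simp add: Phi_mop_fun e)
    also have "\<dots> = e z * deriv (Phi (Dg x)) z + deriv e z * Phi (Dg x) z"
      using z eh Phi_holomorphic[of "Dg x"]
      by (intro complex_derivative_mult_at holomorphic_on_imp_analytic_at[of _ unit_disc]
          deriv_mult holomorphic_on_imp_differentiable_at[of _ unit_disc]) auto
    finally have "z * deriv ?H z + ?c * ?H z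
       = e z * (z * deriv (Phi (Dg x)) z + ?c * Phi (Dg x) z) + z * deriv e z * Phi (Dg x) z"
      by (simp add: Phi_mop e algebra_simps)
    also have "\<dots> = ?c * ?R z"
      unfolding Dg_ode[OF z] ed[OF z, symmetric] by (simp add: Phi_mop Phi_add e d algebra_simps)
    finally show ?thesis by simp
  qed
  then have "coef (\<lambda>z. z * deriv ?H z + ?c * ?H z) n = coef (\<lambda>z. ?c * ?R z) n"
    by (intro coef_cong) (auto intro!: holomorphic_intros Phi_holomorphic)
  also have "\<dots> = ?c * coef ?R n"
    by (rule coef_unique) (use sums_mult[OF coef_sums[OF Phi_holomorphic], of _ ?c] in \<open>simp add: mult.assoc\<close>)
  finally have "(of_nat n + ?c) * coef ?H n = ?c * coef ?R n"
    by (simp add: coef_euler[OF Phi_holomorphic])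
  then have eq: "(of_nat n + ?c) * coord (mop e (Dg x)) n = ?c * coord (mop e x + mop d (Dg x)) n"
    by (simp add: coef_Phi del: coord_simps)
  have "of_nat n + ?c \<noteq> 0"
  proof -
    have "real n + (\<alpha> + 1) \<noteq> 0"
      using alpha by linarith
    then have "complex_of_real (real n + (\<alpha> + 1)) \<noteq> 0"
      unfolding of_real_eq_0_iff .
    then show ?thesis by simp
  qed
  then have "coord (mop e (Dg x)) n = ?c * coord (mop e x + mop d (Dg x)) n / (of_nat n + ?c)"
    unfolding eq[symmetric] by simp
  moreover have "complex_of_real (lam \<alpha> n) = ?c / (of_nat n + ?c)"
    by (simp add: lam_def add.assoc)
  ultimately show "coord (mop e (Dg x)) n = coord (Dg (mop e x + mop d (Dg x))) n"
    by (simp only: coord_Dg times_divide_eq_left)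
qed

text \<open>Multiplication by \<open>z\<close> is a weighted shift with weights
  \<open>sqrt (wt \<alpha> (m + 1) / wt \<alpha> m)\<close>, so the shift times its adjoint is
  diagonal with entries \<open>1 - lam \<alpha> n\<close>. At \<open>n = 0\<close> the shift
  contributes nothing, in agreement with \<open>lam \<alpha> 0 = 1\<close>.\<close>

lemma defect_id: "defect (\<lambda>z. z) x = Dg x"
proof (rule ell2_eqI)
  fix n
  let ?S = "mop (\<lambda>z. z)"
  have S: "coord (?S y) n = (case n of 0 \<Rightarrow> 0 | Suc m \<Rightarrow> of_real (sqrt (wt \<alpha> (Suc m) / wt \<alpha> m)) * coord y m)" for y n
  proof -
    have "coef (\<lambda>z. z * Phi y z) n = (case n of 0 \<Rightarrow> 0 | Suc m \<Rightarrow> coef (Phi y) m)"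
    proof (rule coef_unique)
      fix z :: complex assume z: "cmod z < 1"
      have "(\<lambda>n. coef (Phi y) n * z ^ Suc n) sums (z * Phi y z)"
        using sums_mult[OF coef_sums[OF Phi_holomorphic z, of y], of z] by (simp add: mult_ac)
      then show "(\<lambda>n. (case n of 0 \<Rightarrow> 0 | Suc m \<Rightarrow> coef (Phi y) m) * z ^ n) sums (z * Phi y z)"
        using sums_Suc_iff[of "\<lambda>n. (case n of 0 \<Rightarrow> 0 | Suc m \<Rightarrow> coef (Phi y) m) * z ^ n" "z * Phi y z"] by simp
    qed
    then show ?thesis
      by (auto simp: coord_mop multiplier_id coef_Phi real_sqrt_divide split: nat.split)
  qed
  have single: "?S (single m c) = single (Suc m) (of_real (sqrt (wt \<alpha> (Suc m) / wt \<alpha> m)) * c)" for m c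
    by (rule ell2_eqI) (auto simp: S split: nat.split)
  have adj: "coord (adj (\<lambda>z. z) y) m = of_real (sqrt (wt \<alpha> (Suc m) / wt \<alpha> m)) * coord y (Suc m)" for y m
  proof -
    \<comment> \<open>The values for \<open>c = 1\<close> and \<open>c = \<i>\<close> recover a
      complex coordinate from real inner products.\<close>
    have "Re (c * cnj (coord (adj (\<lambda>z. z) y) m)) = Re (c * cnj (of_real (sqrt (wt \<alpha> (Suc m) / wt \<alpha> m)) * coord y (Suc m)))" for c
      using inner_adj[OF multiplier_id, of "single m c" y]
      unfolding single inner_single by (simp only: complex_cnj_mult complex_cnj_complex_of_real mult_ac)
    from this[of 1] this[of \<i>] show ?thesis
      by (simp add: complex_eq_iff)
  qed
  show "coord (defect (\<lambda>z. z) x) n = coord (Dg x) n"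
  proof (cases n)
    case 0
    then show ?thesis
      using alpha by (simp add: defect_def S lam_def)
  next
    case (Suc m)
    have "sqrt (wt \<alpha> (Suc m) / wt \<alpha> m) * sqrt (wt \<alpha> (Suc m) / wt \<alpha> m) = real (Suc m) / (real (Suc m) + \<alpha> + 1)"
      using alpha by (simp add: wt_Suc[OF alpha] del: of_nat_Suc)
    also have "\<dots> = 1 - lam \<alpha> (Suc m)"
      using alpha by (simp add: lam_def field_simps)
    finally have "complex_of_real (sqrt (wt \<alpha> (Suc m) / wt \<alpha> m)) * complex_of_real (sqrt (wt \<alpha> (Suc m) / wt \<alpha> m))
        = 1 - of_real (lam \<alpha> (Suc m))"
      by (metis of_real_1 of_real_diff of_real_mult)
    then have "coord (?S (adj (\<lambda>z. z) x)) n = (1 - of_real (lam \<alpha> (Suc m))) * coord x (Suc m)"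
      using Suc by (simp add: S adj flip: mult.assoc)
    then show ?thesis
      using Suc by (simp add: defect_def algebra_simps)
  qed
qed

end

section \<open>Characterizing finite Blaschke products by their boundary behaviour\<close>

definition blaschke_factor :: "complex \<Rightarrow> complex \<Rightarrow> complex" where
  "blaschke_factor a z = (a - z) / (1 - cnj a * z)"

lemma blaschke_denom_bound:
  assumes "cmod a < 1" "cmod z < 1"
  shows "1 - cmod a \<le> cmod (1 - cnj a * z)"
proof -
  have "cmod (cnj a * z) \<le> cmod a * 1"
    unfolding norm_mult using assms by (intro mult_mono) auto
  moreover have "1 - cmod (cnj a * z) \<le> cmod (1 - cnj a * z)"
    using norm_triangle_ineq2[of 1 "cnj a * z"] by simp
  ultimately show ?thesis by simp
qed

lemma blaschke_denom_nz:
  assumes "cmod a < 1" "cmod z < 1"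
  shows "1 - cnj a * z \<noteq> 0"
  using blaschke_denom_bound[OF assms] assms by auto

text \<open>Maximum modulus principle on a closed disc whose radius exceeds both \<rho> and
  \<open>cmod z\<close>, for every \<epsilon>.\<close>

lemma norm_le_one_of_boundary:
  assumes g: "g holomorphic_on unit_disc"
    and bd: "\<And>\<epsilon>. 0 < \<epsilon> \<Longrightarrow> \<exists>\<rho><1. \<forall>w. \<rho> < cmod w \<longrightarrow> cmod w < 1 \<longrightarrow> cmod (g w) \<le> 1 + \<epsilon>"
    and z: "cmod z < 1"
  shows "cmod (g z) \<le> 1"
proof (rule field_le_epsilon)
  fix \<epsilon> :: real assume "0 < \<epsilon>"
  then obtain \<rho> where \<rho>: "\<rho> < 1" "\<And>w. \<rho> < cmod w \<Longrightarrow> cmod w < 1 \<Longrightarrow> cmod (g w) \<le> 1 + \<epsilon>"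
    using bd by blast
  obtain r where r: "max \<rho> (cmod z) < r" "r < 1"
    using \<rho>(1) z dense[of "max \<rho> (cmod z)" 1] by auto
  have r0: "0 < r"
    using r(1) norm_ge_zero[of z] by linarith
  show "cmod (g z) \<le> 1 + \<epsilon>"
  proof (rule maximum_modulus_frontier[where S = "cball 0 r" and f = g and \<xi> = z and B = "1 + \<epsilon>"])
    show "g holomorphic_on interior (cball 0 r)"
      using r by (auto intro!: holomorphic_on_subset[OF g])
    show "continuous_on (closure (cball 0 r)) g"
      using r by (auto intro!: holomorphic_on_imp_continuous_on holomorphic_on_subset[OF g])
    show "cmod (g w) \<le> 1 + \<epsilon>" if "w \<in> frontier (cball 0 r)" for w
      using that r r0 by (intro \<rho>(2)) auto
    show "z \<in> cball 0 r"
      using r by simp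
  qed simp
qed

text \<open>Stronger than being inner: the modulus tends to 1 uniformly at the boundary, not merely
  radially almost everywhere. This is the form that compactness delivers, and it confines the zeros
  to a smaller disc.\<close>

definition asymptotically_inner :: "(complex \<Rightarrow> complex) \<Rightarrow> bool" where
  "asymptotically_inner g \<longleftrightarrow> g holomorphic_on unit_disc \<and> (\<forall>z. cmod z < 1 \<longrightarrow> cmod (g z) \<le> 1) \<and>
     (\<forall>\<epsilon>>0. \<exists>\<rho><1. \<forall>w. \<rho> < cmod w \<longrightarrow> cmod w < 1 \<longrightarrow> 1 - \<epsilon> \<le> cmod (g w))"

text \<open>From \<open>(1 + 2 * t) * (1 - t) \<ge> 1\<close> for
  \<open>0 \<le> t \<le> 1/2\<close>. The cap \<open>1/2\<close> also keeps \<open>x\<close>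
  positive.\<close>

lemma inverse_near_one:
  fixes \<epsilon> :: real
  assumes "0 < \<epsilon>" "1 - min (1/2) (\<epsilon> / 2) \<le> x"
  shows "1 / x \<le> 1 + \<epsilon>"
proof -
  define t where "t = min (1/2) (\<epsilon> / 2)"
  have t: "0 < t" "t \<le> 1/2" "2 * t \<le> \<epsilon>"
    using assms(1) by (auto simp: t_def)
  have "t * t \<le> t * (1/2)"
    using t by (intro mult_left_mono) auto
  then have "1 \<le> (1 + 2 * t) * (1 - t)"
    by (simp add: algebra_simps)
  also have "\<dots> \<le> (1 + \<epsilon>) * x"
    using t assms by (intro mult_mono) (auto simp: t_def)
  finally show ?thesis
    using t assms(2) by (simp add: t_def[symmetric] divide_le_eq)
qed

text \<open>The reciprocal is holomorphic and nearly bounded by 1 at the boundary, hence bounded by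
  1 inside. So the modulus of \<open>g\<close> is 1 throughout, and the maximum principle makes
  \<open>g\<close> constant.\<close>

lemma zero_free_asymptotically_inner:
  assumes g: "asymptotically_inner g" and nz: "\<And>z. cmod z < 1 \<Longrightarrow> g z \<noteq> 0"
  shows "\<exists>c. cmod c = 1 \<and> (\<forall>z\<in>unit_disc. g z = c)"
proof -
  have hol: "g holomorphic_on unit_disc"
    using g by (simp add: asymptotically_inner_def)
  have "cmod (inverse (g z)) \<le> 1" if z: "cmod z < 1" for z
  proof (rule norm_le_one_of_boundary[OF _ _ z])
    show "(\<lambda>z. inverse (g z)) holomorphic_on unit_disc"
      using nz by (intro holomorphic_intros hol) auto
    fix \<epsilon> :: real assume e: "0 < \<epsilon>"
    then have "0 < min (1/2) (\<epsilon> / 2)" by simp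
    then obtain \<rho> where "\<rho> < 1" "\<forall>w. \<rho> < cmod w \<longrightarrow> cmod w < 1 \<longrightarrow> 1 - min (1/2) (\<epsilon> / 2) \<le> cmod (g w)"
      using g unfolding asymptotically_inner_def by meson
    then show "\<exists>\<rho><1. \<forall>w. \<rho> < cmod w \<longrightarrow> cmod w < 1 \<longrightarrow> cmod (inverse (g w)) \<le> 1 + \<epsilon>"
      using inverse_near_one[OF e] by (auto simp: norm_inverse inverse_eq_divide norm_divide)
  qed
  then have "g z = 0 \<or> 1 \<le> cmod (g z)" if "cmod z < 1" for z
    using that by (simp add: norm_inverse inverse_le_1_iff)
  then have ge: "1 \<le> cmod (g z)" if "cmod z < 1" for z
    using that nz by blast
  have le: "cmod (g z) \<le> 1" if "cmod z < 1" for z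
    using g that by (simp add: asymptotically_inner_def)
  have "g constant_on unit_disc"
    by (rule maximum_modulus_principle[OF hol, of unit_disc 0]) (use ge[of 0] le in \<open>auto intro: order_trans\<close>)
  then obtain c where c: "\<And>z. cmod z < 1 \<Longrightarrow> g z = c"
    unfolding constant_on_def by auto
  then have "cmod c = 1"
    using ge[of 0] le[of 0] by simp
  then show ?thesis using c by auto
qed

text \<open>The standard identity for the pseudohyperbolic distance of \<open>a\<close> and
  \<open>z\<close>. It quantifies both the approach to 1 at the boundary and the gap below 1
  inside.\<close>

lemma blaschke_factor_norm:
  assumes a: "cmod a < 1" and z: "cmod z < 1"
  shows "1 - (cmod (blaschke_factor a z))\<^sup>2 = (1 - (cmod a)\<^sup>2) * (1 - (cmod z)\<^sup>2) / (cmod (1 - cnj a * z))\<^sup>2"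
proof -
  have "(cmod (1 - cnj a * z))\<^sup>2 - (cmod (a - z))\<^sup>2 = (1 - (cmod a)\<^sup>2) * (1 - (cmod z)\<^sup>2)"
    unfolding cmod_power2 by (simp add: algebra_simps power2_eq_square)
  then show ?thesis
    using blaschke_denom_nz[OF a z] by (simp add: blaschke_factor_def norm_divide power_divide diff_divide_eq_iff)
qed

lemma blaschke_factor_le_one:
  assumes a: "cmod a < 1" and z: "cmod z < 1"
  shows "cmod (blaschke_factor a z) \<le> 1"
proof -
  have "0 \<le> 1 - (cmod (blaschke_factor a z))\<^sup>2"
    unfolding blaschke_factor_norm[OF a z] using a z by (auto intro!: divide_nonneg_nonneg mult_nonneg_nonneg simp: power_le_one)
  then show ?thesis
    by (simp add: abs_square_le_1)
qed

lemma blaschke_factor_near_one: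
  assumes a: "cmod a < 1" and e: "0 < \<epsilon>"
  shows "\<exists>\<rho><1. \<forall>w. \<rho> < cmod w \<longrightarrow> cmod w < 1 \<longrightarrow> 1 - \<epsilon> \<le> cmod (blaschke_factor a w)"
proof -
  \<comment> \<open>In \<open>blaschke_factor_norm\<close> the numerator is at most
    \<open>2 * (1 - cmod w)\<close> and the denominator at least
    \<open>(1 - cmod a)\<^sup>2\<close>.\<close>
  define K where "K = 2 / (1 - cmod a)\<^sup>2"
  have K: "0 < K"
    using a by (simp add: K_def)
  show ?thesis
  proof (intro exI[of _ "1 - \<epsilon> / K"] conjI allI impI)
    show "1 - \<epsilon> / K < 1"
      using K e by simp
    fix w assume w: "1 - \<epsilon> / K < cmod w" "cmod w < 1"
    let ?b = "cmod (blaschke_factor a w)"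
    have "1 - ?b\<^sup>2 = (1 - (cmod a)\<^sup>2) * (1 - (cmod w)\<^sup>2) / (cmod (1 - cnj a * w))\<^sup>2"
      by (rule blaschke_factor_norm[OF a w(2)])
    also have "\<dots> \<le> (1 * (2 * (1 - cmod w))) / (1 - cmod a)\<^sup>2"
    proof (intro frac_le mult_mono power_mono blaschke_denom_bound a w)
      have "1 - (cmod w)\<^sup>2 = (1 + cmod w) * (1 - cmod w)"
        by (simp add: algebra_simps power2_eq_square)
      also have "\<dots> \<le> 2 * (1 - cmod w)"
        using w by (intro mult_right_mono) auto
      finally show "1 - (cmod w)\<^sup>2 \<le> 2 * (1 - cmod w)" .
    qed (use a w in \<open>auto simp: power_le_one\<close>)
    also have "\<dots> = K * (1 - cmod w)"
      by (simp add: K_def)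
    also have "\<dots> \<le> \<epsilon>"
      using w K by (simp add: field_simps)
    finally have "1 - \<epsilon> \<le> ?b\<^sup>2" by simp
    also have "?b\<^sup>2 \<le> ?b"
      using blaschke_factor_le_one[OF a w(2)] by (simp add: power2_eq_square mult_left_le)
    finally show "1 - \<epsilon> \<le> ?b" .
  qed
qed

text \<open>The factor has modulus near 1 at the boundary, so the quotient is nearly bounded by 1
  there and the maximum principle gives \<open>cmod (h z) \<le> 1\<close>. The lower bound survives
  because division by a factor of modulus at most 1 does not decrease the modulus.\<close>

lemma divide_blaschke_factor:
  assumes g: "asymptotically_inner g" and a: "cmod a < 1" and ga: "g a = 0"
  obtains h where "asymptotically_inner h" "\<And>z. cmod z < 1 \<Longrightarrow> g z = blaschke_factor a z * h z"
proof -
  have hol: "g holomorphic_on unit_disc"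
    using g by (simp add: asymptotically_inner_def)
  \<comment> \<open>Difference quotient of \<open>g\<close> at its zero \<open>a\<close>, completed
    by the derivative at the removable singularity.\<close>
  define f where "f z = (if z = a then deriv g a else g z / (z - a))" for z
  define h where "h z = - f z * (1 - cnj a * z)" for z
  have "f holomorphic_on unit_disc"
    by (rule pole_theorem_open_0[OF hol, of a]) (auto simp: f_def ga)
  then have hh: "h holomorphic_on unit_disc"
    unfolding h_def by (intro holomorphic_intros)
  have gh: "g z = blaschke_factor a z * h z" if "cmod z < 1" for z
  proof (cases "z = a")
    case True
    then show ?thesis by (simp add: ga blaschke_factor_def)
  next
    case False
    then show ?thesis
      using blaschke_denom_nz[OF a that]
      by (simp add: f_def h_def blaschke_factor_def divide_simps) (simp add: algebra_simps)
  qed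
  have ge: "cmod (g z) \<le> cmod (h z)" if "cmod z < 1" for z
    using gh[OF that] blaschke_factor_le_one[OF a that] by (simp add: norm_mult mult_left_le_one_le)
  have le: "cmod (h z) \<le> 1" if z: "cmod z < 1" for z
  proof (rule norm_le_one_of_boundary[OF hh _ z])
    fix \<epsilon> :: real assume e: "0 < \<epsilon>"
    then have "0 < min (1/2) (\<epsilon> / 2)" by simp
    from blaschke_factor_near_one[OF a this] obtain \<rho> where \<rho>: "\<rho> < 1"
      "\<And>w. \<rho> < cmod w \<Longrightarrow> cmod w < 1 \<Longrightarrow> 1 - min (1/2) (\<epsilon> / 2) \<le> cmod (blaschke_factor a w)"
      by blast
    have "cmod (h w) \<le> 1 + \<epsilon>" if w: "\<rho> < cmod w" "cmod w < 1" for w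
    proof -
      let ?b = "cmod (blaschke_factor a w)"
      have b: "1 / ?b \<le> 1 + \<epsilon>"
        by (rule inverse_near_one[OF e \<rho>(2)[OF w]])
      have b0: "0 < ?b"
        using \<rho>(2)[OF w] e by (auto simp: min_def split: if_splits)
      have "cmod (h w) = cmod (g w) * (1 / ?b)"
        using gh[OF w(2)] b0 by (simp add: norm_mult)
      also have "\<dots> \<le> 1 * (1 + \<epsilon>)"
        using g w b by (intro mult_mono) (auto simp: asymptotically_inner_def)
      finally show ?thesis by simp
    qed
    then show "\<exists>\<rho><1. \<forall>w. \<rho> < cmod w \<longrightarrow> cmod w < 1 \<longrightarrow> cmod (h w) \<le> 1 + \<epsilon>"
      using \<rho>(1) by blast
  qed
  have "asymptotically_inner h"
    using g hh le ge unfolding asymptotically_inner_def by (meson order_trans)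
  then show ?thesis
    using gh that by blast
qed

text \<open>Zeros are divided out one at a time. The modulus at a fixed non-zero \<open>z\<^sub>0\<close> grows by a factor at
  least \<open>1/q\<close> in each step but never exceeds 1, so the process stops.\<close>

lemma asymptotically_inner_blaschke_aux:
  assumes z0: "cmod z0 < 1" and q: "0 < q"
    "\<And>a. cmod a \<le> \<rho> \<Longrightarrow> cmod (blaschke_factor a z0) \<le> q" and \<rho>: "\<rho> < 1"
    and g: "asymptotically_inner g" "\<And>z. cmod z < 1 \<Longrightarrow> g z = 0 \<Longrightarrow> cmod z \<le> \<rho>" "q ^ n < cmod (g z0)"
  shows "finite_blaschke_product g"
  using g
proof (induction n arbitrary: g)
  case 0
  \<comment> \<open>For exponent 0 the premise reads \<open>1 < cmod (g z0)\<close>, against the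
    bound by 1.\<close>
  then show ?case
    using z0 by (fastforce simp: asymptotically_inner_def)
next
  case (Suc n)
  show ?case
  proof (cases "\<exists>a. cmod a < 1 \<and> g a = 0")
    case False
    then obtain c where "cmod c = 1" "\<forall>z\<in>unit_disc. g z = c"
      using zero_free_asymptotically_inner[OF Suc.prems(1)] by blast
    then show ?thesis
      unfolding finite_blaschke_product_def by (intro exI[of _ c] exI[of _ 0]) auto
  next
    case True
    then obtain a where a: "cmod a < 1" "g a = 0" by blast
    obtain h where h: "asymptotically_inner h" "\<And>z. cmod z < 1 \<Longrightarrow> g z = blaschke_factor a z * h z"
      using divide_blaschke_factor[OF Suc.prems(1) a] by blast
    have "q * q ^ n < cmod (blaschke_factor a z0) * cmod (h z0)"
      using Suc.prems(3) h(2)[OF z0] by (simp add: norm_mult)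
    also have "\<dots> \<le> q * cmod (h z0)"
      using q(2) Suc.prems(2)[OF a] by (intro mult_right_mono) auto
    finally have "q ^ n < cmod (h z0)"
      using q(1) by simp
    with h Suc.prems(2) have "finite_blaschke_product h"
      by (intro Suc.IH) auto
    then obtain c and m :: nat and b where c: "cmod c = 1" and b: "\<forall>i<m. b i \<in> unit_disc"
      and hb: "\<forall>z\<in>unit_disc. h z = c * (\<Prod>i<m. (b i - z) / (1 - cnj (b i) * z))"
      unfolding finite_blaschke_product_def by blast
    let ?b = "b(m := a)"
    have "\<forall>z\<in>unit_disc. g z = c * (\<Prod>i<Suc m. (?b i - z) / (1 - cnj (?b i) * z))"
    proof
      fix z assume z: "z \<in> unit_disc"
      have "(\<Prod>i<m. (?b i - z) / (1 - cnj (?b i) * z)) = (\<Prod>i<m. (b i - z) / (1 - cnj (b i) * z))"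
        by (intro prod.cong) auto
      then show "g z = c * (\<Prod>i<Suc m. (?b i - z) / (1 - cnj (?b i) * z))"
        using h(2)[of z] hb z by (simp add: blaschke_factor_def)
    qed
    moreover have "\<forall>i<Suc m. ?b i \<in> unit_disc"
      using a(1) b by (auto simp: less_Suc_eq)
    ultimately show ?thesis
      unfolding finite_blaschke_product_def using c by blast
  qed
qed

theorem asymptotically_inner_imp_blaschke:
  assumes g: "asymptotically_inner g"
  shows "finite_blaschke_product g"
proof -
  obtain \<rho> where \<rho>: "\<rho> < 1" "\<And>w. \<rho> < cmod w \<Longrightarrow> cmod w < 1 \<Longrightarrow> 1 - 1 / 2 \<le> cmod (g w)"
    using g unfolding asymptotically_inner_def by (meson half_gt_zero zero_less_one)
  \<comment> \<open>All zeros satisfy \<open>cmod z \<le> \<rho>\<close>, since beyond \<rho> the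
    modulus is at least 1/2. The test point lies beyond \<rho>, which keeps \<open>g\<close> away
    from 0 there; the maximum is taken because \<rho> may be negative.\<close>
  define r where "r = (max \<rho> 0 + 1) / 2"
  have r: "\<rho> < r" "0 \<le> r" "r < 1"
    using \<rho>(1) by (auto simp: r_def max_def)
  define z0 where "z0 = complex_of_real r"
  have z0: "cmod z0 = r"
    using r by (simp add: z0_def)
  \<comment> \<open>Comes from a lower bound in \<open>blaschke_factor_norm\<close>:
    \<open>cmod a\<close> is at most \<open>max \<rho> 0\<close> in the numerator, and the
    denominator is at most \<open>2\<^sup>2\<close>.\<close>
  define q where "q = sqrt (1 - (1 - (max \<rho> 0)\<^sup>2) * (1 - r\<^sup>2) / 4)"
  have pos: "0 < 1 - (max \<rho> 0)\<^sup>2" "0 < 1 - r\<^sup>2"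
    using \<rho>(1) r by (auto simp: abs_square_less_1 max_def)
  then have "(1 - (max \<rho> 0)\<^sup>2) * (1 - r\<^sup>2) \<le> 1 * 1"
    by (intro mult_mono) auto
  then have q: "0 < q" "q < 1"
    unfolding q_def using mult_pos_pos[OF pos] by (auto simp: real_sqrt_gt_0_iff)
  have qa: "cmod (blaschke_factor a z0) \<le> q" if a: "cmod a \<le> \<rho>" for a
    unfolding q_def
  proof (rule real_le_rsqrt)
    have a1: "cmod a < 1" and z1: "cmod z0 < 1"
      using a \<rho>(1) z0 r by auto
    have "cmod (1 - cnj a * z0) \<le> 1 + cmod a * cmod z0"
      using norm_triangle_ineq4[of 1 "cnj a * z0"] by (simp add: norm_mult)
    also have "cmod a * cmod z0 \<le> 1 * 1"
      using a1 z1 by (intro mult_mono) auto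
    finally have "(cmod (1 - cnj a * z0))\<^sup>2 \<le> 2\<^sup>2"
      by (intro power_mono) auto
    moreover have "(cmod a)\<^sup>2 \<le> (max \<rho> 0)\<^sup>2"
      using a by (intro power_mono) auto
    ultimately have "(1 - (max \<rho> 0)\<^sup>2) * (1 - r\<^sup>2) / 4
        \<le> (1 - (cmod a)\<^sup>2) * (1 - (cmod z0)\<^sup>2) / (cmod (1 - cnj a * z0))\<^sup>2"
      using pos blaschke_denom_nz[OF a1 z1] a1 by (intro frac_le mult_mono) (auto simp: z0 power_le_one)
    then show "(cmod (blaschke_factor a z0))\<^sup>2 \<le> 1 - (1 - (max \<rho> 0)\<^sup>2) * (1 - r\<^sup>2) / 4"
      using blaschke_factor_norm[OF a1 z1] by linarith
  qed
  have g0: "1 / 2 \<le> cmod (g z0)"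
    using \<rho>(2)[of z0] z0 r by simp
  obtain n where n: "q ^ n < 1 / 2"
    using real_arch_pow_inv[of "1/2" q] q by auto
  show ?thesis
  proof (rule asymptotically_inner_blaschke_aux[OF _ q(1) qa \<rho>(1) g])
    show "cmod z0 < 1"
      using z0 r by simp
    show "cmod z \<le> \<rho>" if "cmod z < 1" "g z = 0" for z
      using \<rho>(2)[of z] that by (cases "\<rho> < cmod z") auto
    show "q ^ n < cmod (g z0)"
      using n g0 by linarith
  qed
qed

section \<open>The defect operator of a finite Blaschke product\<close>

text \<open>The lower bound makes a right inverse \<open>G\<close> of \<open>A\<close> Lipschitz
  with constant \<open>1 / r\<close>. Solving \<open>A x + s *\<^sub>R x = h\<close> amounts to
  finding a fixed point of \<open>\<lambda>x. G (h - s *\<^sub>R x)\<close>, a contraction because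
  \<open>\<bar>s\<bar> < r\<close>.\<close>

lemma surj_step:
  fixes A :: "'a::banach \<Rightarrow> 'a"
  assumes A: "linear A" and surj: "surj A" and r: "\<And>x. r * norm x \<le> norm (A x)"
    and s: "\<bar>s\<bar> < r"
  shows "surj (\<lambda>x. A x + s *\<^sub>R x)"
  unfolding surj_def
proof
  fix h
  obtain G where G: "\<And>y. A (G y) = y"
    using surj by (metis surjD)
  have r0: "0 < r"
    using s by linarith
  have lip: "norm (G x - G y) \<le> norm (x - y) / r" for x y
    using r[of "G x - G y"] r0 by (simp add: linear_diff[OF A] G field_simps)
  have "\<exists>!x. G (h - s *\<^sub>R x) = x"
  proof (rule banach_fix_type)
    show "0 \<le> \<bar>s\<bar> / r" "\<bar>s\<bar> / r < 1"
      using s r0 by auto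
    show "\<forall>x y. dist (G (h - s *\<^sub>R x)) (G (h - s *\<^sub>R y)) \<le> \<bar>s\<bar> / r * dist x y"
    proof (intro allI)
      fix x y
      have "(h - s *\<^sub>R x) - (h - s *\<^sub>R y) = s *\<^sub>R (y - x)"
        by (simp add: algebra_simps)
      then have "norm ((h - s *\<^sub>R x) - (h - s *\<^sub>R y)) = \<bar>s\<bar> * norm (x - y)"
        by (simp add: norm_minus_commute)
      then show "dist (G (h - s *\<^sub>R x)) (G (h - s *\<^sub>R y)) \<le> \<bar>s\<bar> / r * dist x y"
        using lip[of "h - s *\<^sub>R x" "h - s *\<^sub>R y"] by (simp add: dist_norm)
    qed
  qed
  then obtain x where "G (h - s *\<^sub>R x) = x"
    by blast
  then have "A x = h - s *\<^sub>R x"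
    using G by metis
  then show "\<exists>x. h = A x + s *\<^sub>R x"
    by (metis diff_add_cancel)
qed

text \<open>For large \<open>T\<close> the equation \<open>A x + T *\<^sub>R x = h\<close> is solved
  by a contraction. The lower bound is uniform in \<open>t\<close>, so surjectivity moves from
  \<open>T\<close> down to 0 in finitely many steps of length at most \<open>r / 2\<close>, short
  enough for \<open>surj_step\<close>.\<close>

lemma continuity_method:
  fixes A :: "'a::banach \<Rightarrow> 'a"
  assumes A: "bounded_linear A" and r: "0 < r"
    and bd: "\<And>t x. 0 \<le> t \<Longrightarrow> r * norm x \<le> norm (A x + t *\<^sub>R x)"
  shows "surj A"
proof -
  interpret A: bounded_linear A by fact
  obtain K where K: "\<And>x. norm (A x) \<le> norm x * K" "0 \<le> K"
    using A.nonneg_bounded by auto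
  \<comment> \<open>Exceeds \<open>K\<close>, so that \<open>K / T < 1\<close>, and is positive even
    for \<open>K = 0\<close>.\<close>
  define T where "T = 2 * K + 1"
  have lin: "linear (\<lambda>x. A x + t *\<^sub>R x)" for t
    by (intro linear_compose_add A.linear linear_compose_scale_right linear_id[unfolded id_def])
  have "surj (\<lambda>x. A x + T *\<^sub>R x)"
    unfolding surj_def
  proof
    fix h
    have "\<exists>!x. (1 / T) *\<^sub>R (h - A x) = x"
    proof (rule banach_fix_type)
      show "0 \<le> K / T" "K / T < 1"
        using K by (auto simp: T_def)
      show "\<forall>x y. dist ((1 / T) *\<^sub>R (h - A x)) ((1 / T) *\<^sub>R (h - A y)) \<le> K / T * dist x y"
      proof (intro allI)
        fix x y
        have "dist ((1 / T) *\<^sub>R (h - A x)) ((1 / T) *\<^sub>R (h - A y)) = norm ((1 / T) *\<^sub>R A (y - x))"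
          by (simp add: dist_norm A.diff flip: scaleR_diff_right)
        also have "\<dots> = norm (A (y - x)) / T"
          using K by (simp add: T_def)
        also have "\<dots> \<le> (norm (y - x) * K) / T"
          using K by (intro divide_right_mono) (auto simp: T_def)
        finally show "dist ((1 / T) *\<^sub>R (h - A x)) ((1 / T) *\<^sub>R (h - A y)) \<le> K / T * dist x y"
          by (simp add: dist_norm norm_minus_commute mult.commute)
      qed
    qed
    then obtain x where x: "(1 / T) *\<^sub>R (h - A x) = x"
      by blast
    have "T *\<^sub>R x = h - A x"
      using K by (subst x[symmetric]) (simp add: T_def)
    then show "\<exists>x. h = A x + T *\<^sub>R x"
      by (metis add.commute diff_add_cancel)
  qed
  note surj_T = this
  have step: "surj (\<lambda>x. A x + max 0 (T - real n * (r / 2)) *\<^sub>R x)" for n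
  proof (induction n)
    case 0
    then show ?case using surj_T K by (simp add: T_def max_def)
  next
    case (Suc n)
    let ?t = "max 0 (T - real n * (r / 2))" and ?u = "max 0 (T - real (Suc n) * (r / 2))"
    have "surj (\<lambda>x. (A x + ?t *\<^sub>R x) + (?u - ?t) *\<^sub>R x)"
      using r by (intro surj_step[OF lin Suc bd]) (auto simp: algebra_simps max_def abs_if)
    then show ?case
      by (simp add: algebra_simps)
  qed
  obtain n where "T < real n * (r / 2)"
    using reals_Archimedean3[of "r / 2"] r by auto
  then have "max 0 (T - real n * (r / 2)) = 0"
    by simp
  then show ?thesis
    using step[of n] by simp
qed

text \<open>A bounded derivative is what makes \<open>d\<close> in \<open>mop_Dg\<close> a
  multiplier. Blaschke factors qualify because their poles lie outside the closed disc.\<close>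

definition smooth_multiplier :: "(complex \<Rightarrow> complex) \<Rightarrow> bool" where
  "smooth_multiplier e \<longleftrightarrow> multiplier e \<and> multiplier (deriv e)"

lemma smooth_multiplierD: "smooth_multiplier e \<Longrightarrow> multiplier e" "smooth_multiplier e \<Longrightarrow> multiplier (deriv e)"
  by (auto simp: smooth_multiplier_def)

lemma multiplier_cong:
  assumes "multiplier f" "\<And>z. cmod z < 1 \<Longrightarrow> g z = f z"
  shows "multiplier g"
proof -
  have "g holomorphic_on unit_disc"
    using assms by (subst holomorphic_cong[of _ unit_disc g f]) (auto simp: multiplier_def)
  then show ?thesis
    using assms by (metis multiplierE multiplierI)
qed

lemma multiplier_differentiable:
  assumes "multiplier f" "cmod z < 1"
  shows "f field_differentiable at z"
  using assms by (intro holomorphic_on_imp_differentiable_at[of _ unit_disc]) (auto simp: multiplier_def)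

lemma smooth_multiplier_mult:
  assumes "smooth_multiplier e" "smooth_multiplier f"
  shows "smooth_multiplier (\<lambda>z. e z * f z)"
proof -
  have "multiplier (\<lambda>z. e z * deriv f z + deriv e z * f z)"
    using assms by (intro multiplier_add multiplier_mult) (auto simp: smooth_multiplier_def)
  then have "multiplier (deriv (\<lambda>z. e z * f z))"
    by (rule multiplier_cong) (use assms in \<open>simp add: multiplier_differentiable smooth_multiplier_def\<close>)
  then show ?thesis
    using assms by (auto simp: smooth_multiplier_def multiplier_mult)
qed

lemma smooth_multiplier_const: "smooth_multiplier (\<lambda>_. c)"
  by (simp add: smooth_multiplier_def multiplier_const)

lemma multiplier_inv_denom:
  assumes a: "cmod a < 1"
  shows "multiplier (\<lambda>z. 1 / (1 - cnj a * z))"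
proof (rule multiplierI)
  show "(\<lambda>z. 1 / (1 - cnj a * z)) holomorphic_on unit_disc"
    using blaschke_denom_nz[OF a] by (intro holomorphic_intros) auto
  fix z :: complex assume "cmod z < 1"
  then show "cmod (1 / (1 - cnj a * z)) \<le> 1 / (1 - cmod a)"
    using blaschke_denom_bound[OF a, of z] a by (auto simp: norm_divide intro!: divide_left_mono mult_pos_pos)
qed

lemma multiplier_affine: "multiplier (\<lambda>z. b + c * z)"
  by (intro multiplier_add multiplier_mult multiplier_const multiplier_id)

lemma smooth_multiplier_affine: "smooth_multiplier (\<lambda>z. b + c * z)"
proof -
  have "multiplier (deriv (\<lambda>z. b + c * z))"
    by (rule multiplier_cong[OF multiplier_const[of c]]) (auto intro!: DERIV_imp_deriv derivative_eq_intros)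
  then show ?thesis
    by (simp add: smooth_multiplier_def multiplier_affine)
qed

lemma smooth_multiplier_inv_denom:
  assumes a: "cmod a < 1"
  shows "smooth_multiplier (\<lambda>z. 1 / (1 - cnj a * z))"
proof -
  have "multiplier (\<lambda>z. cnj a * ((1 / (1 - cnj a * z)) * (1 / (1 - cnj a * z))))"
    by (intro multiplier_mult multiplier_const multiplier_inv_denom a)
  then have "multiplier (deriv (\<lambda>z. 1 / (1 - cnj a * z)))"
    by (rule multiplier_cong)
      (use blaschke_denom_nz[OF a] in \<open>auto intro!: DERIV_imp_deriv derivative_eq_intros\<close>)
  then show ?thesis
    by (simp add: smooth_multiplier_def multiplier_inv_denom a)
qed

lemma smooth_multiplier_blaschke_factor:
  assumes "cmod a < 1"
  shows "smooth_multiplier (blaschke_factor a)"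
proof -
  have "blaschke_factor a = (\<lambda>z. (a + (-1) * z) * (1 / (1 - cnj a * z)))"
    by (auto simp: blaschke_factor_def)
  then show ?thesis
    using smooth_multiplier_mult[OF smooth_multiplier_affine smooth_multiplier_inv_denom[OF assms], of a "-1"] by simp
qed

section \<open>The defect of a Blaschke product as a sum of conjugates of \<open>Dg\<close>\<close>

context bergman
begin

lemma adj_plus:
  assumes "multiplier \<phi>" "multiplier \<psi>"
  shows "adj (\<lambda>z. \<phi> z + \<psi> z) x = adj \<phi> x + adj \<psi> x"
  by (rule inner_eq_left_imp_eq) (simp add: inner_adj assms multiplier_add mop_plus inner_simps)

lemma adj_affine: "adj (\<lambda>z. b + c * z) x = mop (\<lambda>_. cnj b) x + mop (\<lambda>_. cnj c) (adj (\<lambda>z. z) x)"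
proof -
  have "adj (\<lambda>z. b + c * z) x = adj (\<lambda>_. b) x + adj (\<lambda>z. z * c) x"
    by (subst adj_plus[symmetric]) (auto simp: multiplier_const multiplier_id multiplier_mult mult.commute)
  also have "adj (\<lambda>z. z * c) x = adj (\<lambda>_. c) (adj (\<lambda>z. z) x)"
    by (rule adj_mult[OF multiplier_id multiplier_const])
  finally show ?thesis
    by (simp only: adj_const)
qed

lemma inner_defect:
  assumes "multiplier \<phi>"
  shows "inner (defect \<phi> x) y = inner x y - inner (adj \<phi> x) (adj \<phi> y)"
  by (simp add: defect_def inner_diff_left inner_adj[OF assms])

text \<open>The defect of the product is \<open>I - T_\<phi> T_\<psi> T_\<psi>* T_\<phi>*\<close>;
  subtracting and adding \<open>T_\<phi> T_\<phi>*\<close> splits off the defect of \<phi>.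
  Iterated, this telescopes into one term per factor.\<close>

lemma defect_mult:
  assumes "multiplier \<phi>" "multiplier \<psi>"
  shows "defect (\<lambda>z. \<phi> z * \<psi> z) x = defect \<phi> x + mop \<phi> (defect \<psi> (adj \<phi> x))"
proof -
  have "mop \<phi> (defect \<psi> (adj \<phi> x)) = mop \<phi> (adj \<phi> x) - mop \<phi> (mop \<psi> (adj \<psi> (adj \<phi> x)))"
    unfolding defect_def by (rule linear_diff[OF bounded_linear.linear[OF bounded_linear_mop[OF assms(1)]]])
  then show ?thesis
    by (simp add: defect_def adj_mult mop_mop assms)
qed

lemma inner_mop_const: "inner (mop (\<lambda>_. c) x) y = inner x (mop (\<lambda>_. cnj c) y)"
  using inner_adj[OF multiplier_const, of x c y] by (simp add: adj_const)

lemma mop_const_mop_const: "mop (\<lambda>_. c) (mop (\<lambda>_. d) x) = mop (\<lambda>_. c * d) x"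
  by (rule mop_mop[OF multiplier_const multiplier_const])

lemma mop_of_real: "mop (\<lambda>_. of_real r) x = r *\<^sub>R x"
  by (rule ell2_eqI) (simp add: coord_mop_const scaleR_conv_of_real)

text \<open>With \<open>S\<close> the multiplication by the variable, the operator of the Moebius map is
  \<open>(a - S) V\<close> for \<open>V = (1 - cnj a S)\<^sup>-\<^sup>1\<close>, so its defect is
  \<open>V ((1 - cnj a S) (1 - cnj a S)* - (a - S) (a - S)*) V*\<close>, and the middle factor
  collapses to \<open>(1 - \<bar>a\<bar>\<^sup>2) (1 - S S*)\<close>.\<close>

lemma defect_blaschke_factor:
  assumes a: "cmod a < 1"
  defines "e \<equiv> \<lambda>z. (1 / (1 - cnj a * z)) * of_real (sqrt (1 - (cmod a)\<^sup>2))"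
  shows "defect (blaschke_factor a) x = mop e (Dg (adj e x))"
proof (rule inner_eq_left_imp_eq)
  fix y
  let ?v = "\<lambda>z. 1 / (1 - cnj a * z)" and ?p = "\<lambda>z. 1 + (- cnj a) * z" and ?q = "\<lambda>z. a + (-1) * z"
  let ?s = "sqrt (1 - (cmod a)\<^sup>2)"
  let ?S = "adj (\<lambda>z. z)"
  define u where "u = adj ?v x"
  define w where "w = adj ?v y"
  have v: "multiplier ?v" and e: "multiplier e"
    unfolding e_def by (intro multiplier_mult multiplier_const multiplier_inv_denom a)+
  \<comment> \<open>\<open>?p\<close> is the reciprocal of \<open>?v\<close>, so
    \<open>adj ?p\<close> undoes \<open>adj ?v\<close>, and \<open>x\<close>, \<open>y\<close> can
    be expressed through \<open>u\<close>, \<open>w\<close>.\<close>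
  have pv: "adj ?p (adj ?v x) = x" for x
  proof -
    have "mop (\<lambda>z. ?v z * ?p z) y = mop (\<lambda>_. 1) y" for y
      using blaschke_denom_nz[OF a] by (intro mop_cong multiplier_const) simp
    then have "mop (\<lambda>z. ?v z * ?p z) = mop (\<lambda>_. 1)" ..
    moreover have "adj (\<lambda>z. ?v z * ?p z) x = adj ?p (adj ?v x)"
      by (rule adj_mult[OF v multiplier_affine])
    ultimately have "adj ?p (adj ?v x) = adj (\<lambda>_. 1) x"
      by simp
    then show ?thesis
      using mop_of_real[of 1 x] by (simp add: adj_const)
  qed
  have qv: "adj (blaschke_factor a) x = adj ?q (adj ?v x)" for x
  proof -
    have eq: "blaschke_factor a = (\<lambda>z. ?v z * ?q z)"
      by (auto simp: blaschke_factor_def)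
    show ?thesis
      unfolding eq by (rule adj_mult[OF v multiplier_affine])
  qed
  have pu: "adj ?p u = u - mop (\<lambda>_. a) (?S u)" for u
    unfolding adj_affine
    using mop_of_real[of 1 u] mop_of_real[of "-1" "mop (\<lambda>_. a) (?S u)"] mop_const_mop_const[of "-1" a "?S u"]
    by simp
  have qu: "adj ?q u = mop (\<lambda>_. cnj a) u - ?S u" for u
    unfolding adj_affine using mop_of_real[of "-1" "?S u"] by simp
  have "inner (defect (blaschke_factor a) x) y = inner x y - inner (adj ?q u) (adj ?q w)"
    using smooth_multiplier_blaschke_factor[OF a] by (simp add: inner_defect smooth_multiplier_def qv u_def w_def)
  also have "inner x y = inner (adj ?p u) (adj ?p w)"
    by (simp only: u_def w_def pv)
  also have "inner (adj ?p u) (adj ?p w) - inner (adj ?q u) (adj ?q w)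
    = inner (u - mop (\<lambda>_. a) (?S u)) (w - mop (\<lambda>_. a) (?S w))
      - inner (mop (\<lambda>_. cnj a) u - ?S u) (mop (\<lambda>_. cnj a) w - ?S w)"
    by (simp only: pu qu)
  \<comment> \<open>The mixed terms of the two products agree once the scalar \<open>a\<close> is
    moved across the inner product, and cancel.\<close>
  also have "inner (u - mop (\<lambda>_. a) (?S u)) (w - mop (\<lambda>_. a) (?S w))
      - inner (mop (\<lambda>_. cnj a) u - ?S u) (mop (\<lambda>_. cnj a) w - ?S w)
      = inner u w + inner (mop (\<lambda>_. a) (?S u)) (mop (\<lambda>_. a) (?S w))
       - inner (mop (\<lambda>_. cnj a) u) (mop (\<lambda>_. cnj a) w) - inner (?S u) (?S w)"
    by (simp add: inner_diff_left inner_diff_right inner_mop_const)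
  also have "inner (mop (\<lambda>_. a) (?S u)) (mop (\<lambda>_. a) (?S w)) = (cmod a)\<^sup>2 * inner (?S u) (?S w)"
    using mop_of_real[of "(cmod a)\<^sup>2" "?S w"] complex_norm_square[of a]
    by (simp add: inner_mop_const mop_const_mop_const mult.commute)
  also have "inner (mop (\<lambda>_. cnj a) u) (mop (\<lambda>_. cnj a) w) = (cmod a)\<^sup>2 * inner u w"
    using mop_of_real[of "(cmod a)\<^sup>2" w] complex_norm_square[of a]
    by (simp add: inner_mop_const mop_const_mop_const mult.commute)
  also have "inner u w + (cmod a)\<^sup>2 * inner (?S u) (?S w) - (cmod a)\<^sup>2 * inner u w - inner (?S u) (?S w)
      = (1 - (cmod a)\<^sup>2) * (inner u w - inner (?S u) (?S w))"
    by (simp add: algebra_simps)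
  also have "inner u w - inner (?S u) (?S w) = inner (Dg u) w"
    by (simp only: inner_defect[OF multiplier_id, symmetric] defect_id)
  \<comment> \<open>The factor \<open>1 - (cmod a)\<^sup>2\<close> is split evenly between the two
    occurrences of \<open>e\<close>, whence the square root in its definition.\<close>
  also have "(1 - (cmod a)\<^sup>2) * inner (Dg u) w = inner (Dg (adj e x)) (adj e y)"
  proof -
    have ae: "adj e x = ?s *\<^sub>R adj ?v x" for x
      unfolding e_def adj_mult[OF v multiplier_const] adj_const complex_cnj_complex_of_real mop_of_real ..
    have "Dg (?s *\<^sub>R u) = ?s *\<^sub>R Dg u"
      by (rule linear_scale[OF bounded_linear.linear[OF bounded_linear_Dg]])
    moreover have "?s * ?s = 1 - (cmod a)\<^sup>2"
      using a by (simp add: abs_square_le_1 flip: power2_eq_square)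
    ultimately show ?thesis
      by (simp add: ae u_def w_def flip: mult.assoc)
  qed
  also have "\<dots> = inner (mop e (Dg (adj e x))) y"
    by (rule inner_adj[OF e])
  finally show "inner y (defect (blaschke_factor a) x) = inner y (mop e (Dg (adj e x)))"
    by (simp add: inner_commute)
qed

text \<open>Telescoping over the factors: conjugating the defect of factor \<open>i\<close> by the
  partial product \<open>B i\<close> merges everything into the single function \<open>e i\<close>,
  and the unimodular constant \<open>c\<close> has defect 0. Up to unimodular constants the
  \<open>e i\<close> are the Takenaka-Malmquist functions of the zeros.\<close>

lemma defect_blaschke:
  fixes a :: "nat \<Rightarrow> complex"
  assumes c: "cmod c = 1" and a: "\<And>i. i < n \<Longrightarrow> cmod (a i) < 1"
  defines "B \<equiv> \<lambda>n z. c * (\<Prod>i<n. blaschke_factor (a i) z)"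
  defines "e \<equiv> \<lambda>i z. B i z * ((1 / (1 - cnj (a i) * z)) * of_real (sqrt (1 - (cmod (a i))\<^sup>2)))"
  shows "smooth_multiplier (B n)" "\<And>i. i < n \<Longrightarrow> smooth_multiplier (e i)" "defect (B n) x = (\<Sum>i<n. mop (e i) (Dg (adj (e i) x)))"
proof -
  have nB: "smooth_multiplier (B k)" if "k \<le> n" for k
    using that
  proof (induction k)
    case 0
    then show ?case by (simp add: B_def smooth_multiplier_const)
  next
    case (Suc k)
    have "B (Suc k) = (\<lambda>z. B k z * blaschke_factor (a k) z)"
      by (simp add: B_def mult.assoc)
    then show ?case
      using Suc a[of k] by (simp add: smooth_multiplier_mult smooth_multiplier_blaschke_factor)
  qed
  then show "smooth_multiplier (B n)" by simp
  show ne: "smooth_multiplier (e i)" if "i < n" for i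
    unfolding e_def using that a nB by (intro smooth_multiplier_mult smooth_multiplier_inv_denom smooth_multiplier_const) auto
  have "defect (B k) x = (\<Sum>i<k. mop (e i) (Dg (adj (e i) x)))" if "k \<le> n" for k
    using that
  proof (induction k)
    case 0
    have "c * cnj c = 1"
      using complex_norm_square[of c] c by simp
    then have "mop (\<lambda>_. c) (mop (\<lambda>_. cnj c) x) = x"
      using mop_of_real[of 1 x] by (simp add: mop_const_mop_const)
    then show ?case
      by (simp add: B_def defect_def adj_const)
  next
    case (Suc k)
    let ?f = "\<lambda>z. (1 / (1 - cnj (a k) * z)) * of_real (sqrt (1 - (cmod (a k))\<^sup>2))"
    have ak: "cmod (a k) < 1" and k: "k \<le> n"
      using Suc.prems a by auto
    have f: "multiplier ?f"
      using ak by (intro multiplier_mult multiplier_inv_denom multiplier_const)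
    have Bk: "multiplier (B k)"
      using nB[OF k] by (rule smooth_multiplierD)
    have "B (Suc k) = (\<lambda>z. B k z * blaschke_factor (a k) z)"
      by (simp add: B_def mult.assoc)
    then have "defect (B (Suc k)) x = defect (B k) x + mop (B k) (defect (blaschke_factor (a k)) (adj (B k) x))"
      using defect_mult[OF Bk smooth_multiplierD(1)[OF smooth_multiplier_blaschke_factor[OF ak]]] by simp
    also have "mop (B k) (defect (blaschke_factor (a k)) (adj (B k) x)) = mop (e k) (Dg (adj (e k) x))"
      unfolding defect_blaschke_factor[OF ak] mop_mop[OF Bk f] e_def adj_mult[OF Bk f] ..
    finally show ?case
      using Suc.IH[OF k] by simp
  qed
  then show "defect (B n) x = (\<Sum>i<n. mop (e i) (Dg (adj (e i) x)))"
    by simp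
qed

lemma smooth_multiplier_log_derivative:
  assumes "smooth_multiplier e"
  obtains d where "multiplier d" "\<And>z. cmod z < 1 \<Longrightarrow> (of_real \<alpha> + 1) * d z = z * deriv e z"
proof
  have "complex_of_real (\<alpha> + 1) \<noteq> 0"
    using alpha unfolding of_real_eq_0_iff by linarith
  then show "(of_real \<alpha> + 1) * ((1 / (of_real \<alpha> + 1)) * (z * deriv e z)) = z * deriv e z" for z :: complex
    by simp
  show "multiplier (\<lambda>z. (1 / (of_real \<alpha> + 1)) * (z * deriv e z))"
    using assms by (intro multiplier_mult multiplier_const multiplier_id smooth_multiplierD)
qed

section \<open>The range of the defect operator of a Blaschke product\<close>

lemma defect_factorization:
  fixes e d :: "nat \<Rightarrow> complex \<Rightarrow> complex"
  assumes E: "\<And>x. E x = (\<Sum>i<n. mop (e i) (Dg (adj (e i) x)))"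
    and e: "\<And>i. i < n \<Longrightarrow> multiplier (e i)" and d: "\<And>i. i < n \<Longrightarrow> multiplier (d i)"
    and ed: "\<And>i z. i < n \<Longrightarrow> cmod z < 1 \<Longrightarrow> (of_real \<alpha> + 1) * d i z = z * deriv (e i) z"
  defines "Y \<equiv> \<lambda>x. \<Sum>i<n. mop (e i) (adj (e i) x) + mop (d i) (Dg (adj (e i) x))"
  shows "bounded_linear Y" "E x = Dg (Y x)"
proof -
  show "bounded_linear Y"
    unfolding Y_def using e d
    by (intro bounded_linear_sum bounded_linear_add bounded_linear_compose[OF bounded_linear_mop bounded_linear_adj]
        bounded_linear_compose[OF bounded_linear_mop bounded_linear_compose[OF bounded_linear_Dg bounded_linear_adj]]) auto
  have "mop (e i) (Dg (adj (e i) x)) = Dg (mop (e i) (adj (e i) x) + mop (d i) (Dg (adj (e i) x)))" if "i < n" for i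
    using that by (intro mop_Dg e d ed)
  then show "E x = Dg (Y x)"
    unfolding E Y_def by (simp add: linear_sum[OF bounded_linear.linear[OF bounded_linear_Dg]])
qed

text \<open>Surjectivity of \<open>Y\<close> in \<open>E = D Y\<close> by the method of continuity along \<open>Y + t\<close>. If
  \<open>Y x + t x = h\<close>, then \<open>\<langle>E x, x\<rangle> = \<langle>Y x, D x\<rangle> \<le> \<parallel>h\<parallel> \<parallel>x\<parallel>\<close>, which makes the lower order part of
  \<open>Y\<close> small, while the principal part \<open>\<Sum> T\<^sub>e T\<^sub>e*\<close> is bounded below.\<close>

lemma surj_elliptic:
  fixes e d :: "nat \<Rightarrow> complex \<Rightarrow> complex"
  assumes E: "\<And>x. E x = (\<Sum>i<n. mop (e i) (Dg (adj (e i) x)))"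
    and e: "\<And>i. i < n \<Longrightarrow> multiplier (e i)" and d: "\<And>i. i < n \<Longrightarrow> multiplier (d i)"
    and Y: "Y = (\<lambda>x. \<Sum>i<n. mop (e i) (adj (e i) x) + mop (d i) (Dg (adj (e i) x)))"
    and blY: "bounded_linear Y" and EY: "\<And>x. E x = Dg (Y x)"
    and j: "j < n" "multiplier g" "\<And>z. cmod z < 1 \<Longrightarrow> e j z * g z = 1"
  shows "surj Y"
proof -
  obtain G where G: "0 \<le> G" "\<And>z. cmod z < 1 \<Longrightarrow> cmod (g z) \<le> G"
    using multiplierE[OF j(2)] by metis
  \<comment> \<open>\<open>g\<close> inverts \<open>e j\<close>, so \<open>adj g\<close> undoes
    \<open>adj (e j)\<close>, which is therefore bounded below. This is the coercivity of the
    principal part.\<close>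
  have Gb: "norm x \<le> G * norm (adj (e j) x)" for x
  proof -
    have "mop (\<lambda>z. e j z * g z) = mop (\<lambda>_. 1)"
      using j(3) by (intro ext mop_cong multiplier_const) auto
    then have "adj g (adj (e j) x) = adj (\<lambda>_. 1) x"
      using adj_mult[OF e[OF j(1)] j(2)] by simp
    also have "\<dots> = x"
      using mop_of_real[of 1 x] by (simp add: adj_const)
    finally show ?thesis
      using norm_adjoint_ell2_le[OF bounded_linear_mop[OF j(2)] norm_mop_le[OF j(2) G], of "adj (e j) x"] by simp
  qed
  define \<delta> where "\<delta> = 1 / (G + 1)\<^sup>2"
  have \<delta>: "0 < \<delta>"
    using G(1) by (simp add: \<delta>_def)
  have low: "\<delta> * (norm x)\<^sup>2 \<le> (norm (adj (e j) x))\<^sup>2" for x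
  proof -
    have "norm x \<le> (G + 1) * norm (adj (e j) x)"
      using Gb[of x] by (rule order_trans) (intro mult_right_mono, auto)
    then have "(norm x)\<^sup>2 \<le> ((G + 1) * norm (adj (e j) x))\<^sup>2"
      by (rule power_mono) simp
    then have "(norm x)\<^sup>2 / (G + 1)\<^sup>2 \<le> (norm (adj (e j) x))\<^sup>2"
      using G(1) by (subst pos_divide_le_eq) (simp_all add: power_mult_distrib mult.commute)
    then show ?thesis
      by (simp add: \<delta>_def)
  qed
  have "\<exists>C\<ge>0. \<forall>y. norm (mop (d i) y) \<le> C * norm y" if "i < n" for i
    using multiplierE[OF d[OF that]] norm_mop_le[OF d[OF that]] by metis
  then obtain C where C: "\<And>i. i < n \<Longrightarrow> 0 \<le> C i" "\<And>i y. i < n \<Longrightarrow> norm (mop (d i) y) \<le> C i * norm y"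
    by metis
  define c where "c = (\<Sum>i<n. C i)"
  have c: "0 \<le> c"
    unfolding c_def using C by (intro sum_nonneg) auto
  \<comment> \<open>Under \<open>norm h < r * norm x\<close> both terms on the right of the estimate
    \<open>main\<close> are at most \<open>\<delta> / 2 * (norm x)\<^sup>2\<close>. The second entry
    is a square because \<open>norm h\<close> enters that term through the square root
    \<open>q\<close>.\<close>
  define r where "r = min (\<delta> / 2) ((\<delta> / (2 * (c + 1)))\<^sup>2)"
  have r: "0 < r"
    using \<delta> c by (simp add: r_def)
  show ?thesis
  proof (rule continuity_method[OF blY r])
    fix t :: real and x
    assume t: "0 \<le> t"
    define h where "h = Y x + t *\<^sub>R x"
    have Yh: "Y x = h - t *\<^sub>R x"
      by (simp add: h_def)
    \<comment> \<open>\<open>q\<^sup>2\<close> will bound \<open>inner (E x) x\<close>, the sum of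
      the forms of \<open>Dg\<close> at the vectors \<open>adj (e i) x\<close>. Each lower order
      term is thus controlled by \<open>q\<close>, which is small when \<open>norm h\<close>
      is.\<close>
    define q where "q = sqrt (norm h * norm x)"
    have "inner (E x) x = inner (h - t *\<^sub>R x) (Dg x)"
      unfolding EY Yh by (rule inner_Dg_commute)
    also have "\<dots> = inner h (Dg x) - t * inner (Dg x) x"
      by (simp add: inner_diff_left inner_commute[of x "Dg x"])
    \<comment> \<open>Positivity of \<open>Dg\<close> and \<open>t \<ge> 0\<close> make the
      discarded term harmless, which is why the path runs through nonnegative
      \<open>t\<close>.\<close>
    also have "\<dots> \<le> inner h (Dg x)"
      using t inner_Dg_nonneg[of x] by simp
    also have "\<dots> \<le> norm h * norm x"
      using norm_cauchy_schwarz[of h "Dg x"] mult_left_mono[OF norm_Dg_le[of x], of "norm h"] by simp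
    finally have Ex: "inner (E x) x \<le> norm h * norm x" .
    have Ei: "inner (E x) x = (\<Sum>i<n. inner (Dg (adj (e i) x)) (adj (e i) x))"
      unfolding E inner_sum_left by (intro sum.cong refl) (simp add: inner_adj e)
    have Dq: "norm (Dg (adj (e i) x)) \<le> q" if "i < n" for i
    proof -
      have "(norm (Dg (adj (e i) x)))\<^sup>2 \<le> inner (Dg (adj (e i) x)) (adj (e i) x)"
        by (rule norm_Dg_sq_le)
      also have "\<dots> \<le> (\<Sum>i<n. inner (Dg (adj (e i) x)) (adj (e i) x))"
        using that by (intro member_le_sum) (auto simp: inner_Dg_nonneg)
      also have "\<dots> \<le> norm h * norm x"
        using Ex Ei by simp
      finally show ?thesis
        unfolding q_def by (rule real_le_rsqrt)
    qed
    have "inner (Y x) x = (\<Sum>i<n. (norm (adj (e i) x))\<^sup>2) + (\<Sum>i<n. inner (mop (d i) (Dg (adj (e i) x))) x)"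
      unfolding Y inner_sum_left inner_add_left sum.distrib
      using e by (simp add: inner_adj[symmetric] power2_norm_eq_inner)
    moreover have "\<delta> * (norm x)\<^sup>2 \<le> (\<Sum>i<n. (norm (adj (e i) x))\<^sup>2)"
      using low[of x] member_le_sum[of j "{..<n}" "\<lambda>i. (norm (adj (e i) x))\<^sup>2"] j(1) by simp
    moreover have "- (c * q * norm x) \<le> (\<Sum>i<n. inner (mop (d i) (Dg (adj (e i) x))) x)"
    proof -
      have "- (C i * q * norm x) \<le> inner (mop (d i) (Dg (adj (e i) x))) x" if i: "i < n" for i
      proof -
        have "\<bar>inner (mop (d i) (Dg (adj (e i) x))) x\<bar> \<le> norm (mop (d i) (Dg (adj (e i) x))) * norm x"
          by (rule Cauchy_Schwarz_ineq2)
        also have "\<dots> \<le> (C i * norm (Dg (adj (e i) x))) * norm x"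
          by (intro mult_right_mono C i) auto
        also have "\<dots> \<le> (C i * q) * norm x"
          by (intro mult_right_mono mult_left_mono C Dq i) auto
        finally show ?thesis by linarith
      qed
      then have "(\<Sum>i<n. - (C i * q * norm x)) \<le> (\<Sum>i<n. inner (mop (d i) (Dg (adj (e i) x))) x)"
        by (intro sum_mono) auto
      then show ?thesis
        by (simp add: c_def sum_negf sum_distrib_right)
    qed
    moreover have "inner (Y x) x \<le> norm h * norm x"
    proof -
      have "inner (Y x) x = inner h x - t * inner x x"
        by (simp add: Yh inner_diff_left)
      also have "\<dots> \<le> inner h x"
        using t by simp
      finally show ?thesis
        using norm_cauchy_schwarz[of h x] by linarith
    qed
    ultimately have main: "\<delta> * (norm x)\<^sup>2 \<le> norm h * norm x + c * q * norm x"
      by linarith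
    show "r * norm x \<le> norm (Y x + t *\<^sub>R x)"
    proof (rule ccontr)
      assume "\<not> ?thesis"
      then have hx: "norm h < r * norm x"
        by (simp add: h_def)
      then have x: "0 < norm x"
        using r norm_ge_zero[of h] by (metis less_le_trans not_less zero_less_mult_pos norm_ge_zero order_le_less_trans)
      have "r \<le> \<delta> / 2"
        by (simp add: r_def)
      then have h2: "norm h < \<delta> / 2 * norm x"
        using hx mult_right_mono[OF _ norm_ge_zero, of r "\<delta> / 2" x] by linarith
      have "q \<le> \<delta> / (2 * (c + 1)) * norm x"
        unfolding q_def
      proof (rule real_le_lsqrt)
        have "norm h * norm x \<le> (r * norm x) * norm x"
          using hx by (intro mult_right_mono) auto
        also have "\<dots> \<le> ((\<delta> / (2 * (c + 1)))\<^sup>2 * norm x) * norm x"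
          by (intro mult_right_mono) (auto simp: r_def)
        finally show "norm h * norm x \<le> (\<delta> / (2 * (c + 1)) * norm x)\<^sup>2"
          by (simp add: power2_eq_square mult_ac)
      qed (use \<delta> c in auto)
      then have "c * q \<le> c * (\<delta> / (2 * (c + 1)) * norm x)"
        using c by (intro mult_left_mono)
      also have "\<dots> \<le> \<delta> / 2 * norm x"
      proof -
        have "c * (\<delta> / (2 * (c + 1))) \<le> \<delta> / 2"
          using c \<delta> by (simp add: field_simps)
        from mult_right_mono[OF this, of "norm x"] show ?thesis by (simp add: mult.assoc)
      qed
      finally have "norm h + c * q < \<delta> * norm x"
        using h2 by (simp add: field_simps)
      then have "(norm h + c * q) * norm x < (\<delta> * norm x) * norm x"
        using x by (rule mult_strict_right_mono)
      then show False
        using main by (simp add: algebra_simps power2_eq_square)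
    qed
  qed
qed

lemma blaschke_range:
  assumes \<phi>: "multiplier \<phi>" and B: "finite_blaschke_product \<phi>"
  shows "range (defect \<phi>) \<subseteq> range Dg"
    and "\<not> (\<exists>c. cmod c = 1 \<and> (\<forall>z\<in>unit_disc. \<phi> z = c)) \<Longrightarrow> range (defect \<phi>) = range Dg"
proof -
  obtain c and n :: nat and a where c: "cmod c = 1" and a': "\<forall>i<n. a i \<in> unit_disc"
    and eq': "\<forall>z\<in>unit_disc. \<phi> z = c * (\<Prod>i<n. (a i - z) / (1 - cnj (a i) * z))"
    using B unfolding finite_blaschke_product_def by blast
  have a: "cmod (a i) < 1" if "i < n" for i
    using a' that by simp
  have eq: "\<phi> z = c * (\<Prod>i<n. (a i - z) / (1 - cnj (a i) * z))" if "z \<in> unit_disc" for z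
    using eq' that by blast
  define B where "B n z = c * (\<Prod>i<n. blaschke_factor (a i) z)" for n z
  define e where "e i z = B i z * ((1 / (1 - cnj (a i) * z)) * of_real (sqrt (1 - (cmod (a i))\<^sup>2)))" for i z
  note bl = defect_blaschke[where c = c and n = n and a = a, OF c a, folded B_def, folded e_def]
  have "mop (B n) = mop \<phi>"
    using eq by (intro ext mop_cong[OF \<phi>]) (simp add: B_def blaschke_factor_def)
  then have d\<phi>: "defect (B n) = defect \<phi>"
    by (simp add: defect_def[abs_def])
  have E: "defect \<phi> x = (\<Sum>i<n. mop (e i) (Dg (adj (e i) x)))" for x
    using bl(3)[of x] by (simp add: d\<phi>)
  have e: "multiplier (e i)" if "i < n" for i
    using bl(2)[of i] that by (auto simp: smooth_multiplier_def)
  have "\<exists>d. multiplier d \<and> (\<forall>z. cmod z < 1 \<longrightarrow> (of_real \<alpha> + 1) * d z = z * deriv (e i) z)" if "i < n" for i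
    using smooth_multiplier_log_derivative[of "e i"] bl(2)[of i] that by metis
  then obtain d where d: "\<And>i. i < n \<Longrightarrow> multiplier (d i)"
    and ed: "\<And>i z. i < n \<Longrightarrow> cmod z < 1 \<Longrightarrow> (of_real \<alpha> + 1) * d i z = z * deriv (e i) z"
    by metis
  define Y where "Y = (\<lambda>x. \<Sum>i<n. mop (e i) (adj (e i) x) + mop (d i) (Dg (adj (e i) x)))"
  note Y = defect_factorization[OF E e d ed, folded Y_def]
  show "range (defect \<phi>) \<subseteq> range Dg"
    using Y(2) by auto
  assume nc: "\<not> (\<exists>c. cmod c = 1 \<and> (\<forall>z\<in>unit_disc. \<phi> z = c))"
  have n: "0 < n"
  proof (rule ccontr)
    assume "\<not> 0 < n"
    then have "\<forall>z\<in>unit_disc. \<phi> z = c"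
      using eq by simp
    then show False
      using nc c by blast
  qed
  \<comment> \<open>\<open>e 0\<close> contains no Blaschke factor: it is
    \<open>c * s / (1 - cnj (a 0) * z)\<close>, whose reciprocal is affine and thus a
    multiplier.\<close>
  define s where "s = sqrt (1 - (cmod (a 0))\<^sup>2)"
  have "(cmod (a 0))\<^sup>2 < 1"
    using a[OF n] by (simp add: abs_square_less_1)
  then have s: "s \<noteq> 0"
    by (simp add: s_def)
  have "surj Y"
  proof (rule surj_elliptic[where E = "defect \<phi>" and e = e and d = d and n = n and j = 0
        and g = "\<lambda>z. (1 / (c * of_real s)) * (1 + (- cnj (a 0)) * z)"])
    show "multiplier (\<lambda>z. (1 / (c * of_real s)) * (1 + (- cnj (a 0)) * z))"
      by (intro multiplier_mult multiplier_const multiplier_affine)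
    show "e 0 z * ((1 / (c * of_real s)) * (1 + (- cnj (a 0)) * z)) = 1" if "cmod z < 1" for z
      using blaschke_denom_nz[OF a[OF n] that] s c by (auto simp: e_def B_def s_def[symmetric])
    show "Y = (\<lambda>x. \<Sum>i<n. mop (e i) (adj (e i) x) + mop (d i) (Dg (adj (e i) x)))"
      by (rule Y_def)
    show "defect \<phi> x = Dg (Y x)" for x
      unfolding Y_def by (rule Y(2))
    show "defect \<phi> x = (\<Sum>i<n. mop (e i) (Dg (adj (e i) x)))" for x
      by (rule E)
    show "bounded_linear Y"
      by (rule Y(1))
  qed (use e d n in simp_all)
  have "defect \<phi> = (\<lambda>x. Dg (Y x))"
    unfolding Y_def by (rule ext) (rule Y(2))
  then have "range (defect \<phi>) = Dg ` range Y"
    by (simp add: image_image)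
  then show "range (defect \<phi>) = range Dg"
    by (simp only: \<open>surj Y\<close>)
qed

end

section \<open>Compactness\<close>

text \<open>Bounded coordinatewise convergence is weak convergence: \<open>y\<close> is replaced by
  a finite truncation, for which only finitely many coordinates matter, and the remainder is
  controlled by \<open>B\<close>.\<close>

lemma inner_tendsto_zero_ell2:
  assumes bd: "\<And>j. norm (X j) \<le> B" and lim: "\<And>n. (\<lambda>j. coord (X j) n) \<longlonglongrightarrow> 0"
  shows "(\<lambda>j. inner y (X j)) \<longlonglongrightarrow> 0"
proof (rule LIMSEQ_I)
  fix \<epsilon> :: real assume e: "0 < \<epsilon>"
  have B: "0 \<le> B"
    using bd[of 0] norm_ge_zero[of "X 0"] by linarith
  define p where "p N = (\<Sum>n<N. single n (coord y n))" for N
  have "p \<longlonglongrightarrow> y"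
    unfolding p_def by (rule trunc_tendsto)
  then obtain N where N: "norm (p N - y) < \<epsilon> / (2 * (B + 1))"
    using B e LIMSEQ_D[of p y "\<epsilon> / (2 * (B + 1))"] by force
  have "(\<lambda>j. \<Sum>n<N. Re (coord y n * cnj (coord (X j) n))) \<longlonglongrightarrow> (\<Sum>n<N. Re (coord y n * cnj 0))"
    by (intro tendsto_intros lim)
  then have "(\<lambda>j. inner (p N) (X j)) \<longlonglongrightarrow> 0"
    by (simp add: p_def inner_sum_left inner_single)
  then obtain M where M: "\<And>j. j \<ge> M \<Longrightarrow> \<bar>inner (p N) (X j)\<bar> < \<epsilon> / 2"
    using e LIMSEQ_D[of "\<lambda>j. inner (p N) (X j)" 0 "\<epsilon> / 2"] by force
  have "norm (inner y (X j) - 0) < \<epsilon>" if j: "j \<ge> M" for j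
  proof -
    have "\<bar>inner (p N - y) (X j)\<bar> \<le> norm (p N - y) * norm (X j)"
      by (rule Cauchy_Schwarz_ineq2)
    also have "\<dots> \<le> \<epsilon> / (2 * (B + 1)) * B"
      using N bd[of j] e B by (intro mult_mono) (auto intro!: divide_nonneg_nonneg)
    also have "\<dots> \<le> \<epsilon> / 2"
      using B e by (simp add: field_simps)
    finally have "\<bar>inner (p N) (X j) - inner y (X j)\<bar> \<le> \<epsilon> / 2"
      by (simp only: inner_diff_left)
    with M[OF j] show ?thesis
      unfolding real_norm_def diff_0_right by linarith
  qed
  then show "\<exists>M. \<forall>j\<ge>M. norm (inner y (X j) - 0) < \<epsilon>"
    by blast
qed

text \<open>Weak sequential compactness of balls. The coordinates range over a countable product of
  discs, compact by Tychonoff and metrizable, and the coordinatewise limit stays in the ball by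
  \<open>coordwise_limit_ell2\<close>.\<close>

lemma coordinatewise_subsequence_ell2:
  assumes bd: "\<And>j. norm (X j) \<le> B"
  obtains r y where "strict_mono (r :: nat \<Rightarrow> nat)" "norm y \<le> B" "\<And>n. (\<lambda>j. coord (X (r j)) n) \<longlonglongrightarrow> coord y n"
proof -
  have "compactin (product_topology (\<lambda>_. euclidean) UNIV) (PiE UNIV (\<lambda>_::nat. cball (0::complex) B))"
    by (subst compactin_PiE) auto
  then have "compact (PiE UNIV (\<lambda>_::nat. cball (0::complex) B))"
    by (simp add: euclidean_product_topology)
  then have sc: "seq_compact (PiE UNIV (\<lambda>_::nat. cball (0::complex) B))"
    by (rule compact_imp_seq_compact)
  have "coord (X j) \<in> PiE UNIV (\<lambda>_. cball 0 B)" for j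
    using order_trans[OF cmod_coord_le bd] by (auto simp: PiE_UNIV_domain)
  then obtain f r where r: "strict_mono (r :: nat \<Rightarrow> nat)" and f: "((\<lambda>j. coord (X j)) \<circ> r) \<longlonglongrightarrow> f"
    using sc[unfolded seq_compact_def, rule_format, of "\<lambda>j. coord (X j)"] by blast
  have lim: "(\<lambda>j. coord (X (r j)) n) \<longlonglongrightarrow> f n" for n
  proof -
    have "continuous_on UNIV (\<lambda>g :: nat \<Rightarrow> complex. g n)"
      by (rule continuous_on_product_coordinates)
    from continuous_on_tendsto_compose[OF this f] show ?thesis
      by (simp add: o_def)
  qed
  note y = coordwise_limit_ell2[OF lim, of B]
  show ?thesis
    by (rule that[OF r, of "Abs_ell2 f"]) (use y lim bd in auto)
qed

section \<open>Compactness of \<open>Dg\<close> and its transfer to the function space\<close>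

context bergman
begin

lemma norm_Dg_sq_split:
  assumes "\<And>n. n \<ge> N \<Longrightarrow> lam \<alpha> n \<le> \<epsilon>"
  shows "(norm (Dg x))\<^sup>2 \<le> (\<Sum>n<N. (cmod (coord x n))\<^sup>2) + \<epsilon>\<^sup>2 * (norm x)\<^sup>2"
proof -
  let ?g = "\<lambda>n. (if n < N then (cmod (coord x n))\<^sup>2 else 0)"
  have s: "summable ?g"
    by (rule summable_finite[of "{..<N}"]) auto
  have "(norm (Dg x))\<^sup>2 \<le> (\<Sum>n. ?g n + \<epsilon>\<^sup>2 * (cmod (coord x n))\<^sup>2)"
    unfolding norm_ell2_sq
  proof (intro suminf_le summable_coord summable_add s summable_mult)
    fix n
    show "(cmod (coord (Dg x) n))\<^sup>2 \<le> ?g n + \<epsilon>\<^sup>2 * (cmod (coord x n))\<^sup>2"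
    proof (cases "n < N")
      case True
      have "(cmod (coord (Dg x) n))\<^sup>2 \<le> (cmod (coord x n))\<^sup>2"
        by (intro power_mono) (auto simp: norm_mult mult_left_le_one_le)
      then show ?thesis using True by (simp add: add_increasing2)
    next
      case False
      then have "(lam \<alpha> n)\<^sup>2 \<le> \<epsilon>\<^sup>2"
        using assms[of n] by (intro power_mono) auto
      then show ?thesis
        using False by (simp add: norm_mult power_mult_distrib mult_right_mono)
    qed
  qed
  also have "\<dots> = (\<Sum>n. ?g n) + (\<Sum>n. \<epsilon>\<^sup>2 * (cmod (coord x n))\<^sup>2)"
    by (rule suminf_add[symmetric]) (intro s summable_mult summable_coord)+
  also have "(\<Sum>n. ?g n) = (\<Sum>n<N. ?g n)"
    by (rule suminf_finite) auto
  also have "(\<Sum>n. \<epsilon>\<^sup>2 * (cmod (coord x n))\<^sup>2) = \<epsilon>\<^sup>2 * (norm x)\<^sup>2"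
    unfolding norm_ell2_sq by (rule suminf_mult[OF summable_coord])
  finally show ?thesis by simp
qed

text \<open>Finitely many coordinates tend to 0 by hypothesis, and the remaining ones are damped by
  the small entries of \<open>Dg\<close>. So \<open>Dg\<close> turns weak null sequences into norm
  null sequences.\<close>

lemma Dg_tendsto_zero:
  assumes bd: "\<And>j. norm (X j) \<le> B" and lim: "\<And>n. (\<lambda>j. coord (X j) n) \<longlonglongrightarrow> 0"
  shows "(\<lambda>j. Dg (X j)) \<longlonglongrightarrow> 0"
proof (rule LIMSEQ_I)
  fix \<epsilon> :: real assume e: "0 < \<epsilon>"
  have B: "0 \<le> B"
    using bd[of 0] norm_ge_zero[of "X 0"] by linarith
  define \<eta> where "\<eta> = \<epsilon> / (2 * (B + 1))"
  have \<eta>: "0 < \<eta>" using e B by (simp add: \<eta>_def)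
  then obtain N where N: "\<And>n. n \<ge> N \<Longrightarrow> lam \<alpha> n \<le> \<eta>"
    using LIMSEQ_D[OF lam_tendsto[of \<alpha>] \<eta>] by fastforce
  have "(\<lambda>j. \<Sum>n<N. (cmod (coord (X j) n))\<^sup>2) \<longlonglongrightarrow> (\<Sum>n<N. (cmod 0)\<^sup>2)"
    by (intro tendsto_intros lim)
  then have "(\<lambda>j. \<Sum>n<N. (cmod (coord (X j) n))\<^sup>2) \<longlonglongrightarrow> 0"
    by simp
  from LIMSEQ_D[OF this, of "\<epsilon>\<^sup>2 / 4"] e
  obtain M where M: "\<And>j. j \<ge> M \<Longrightarrow> (\<Sum>n<N. (cmod (coord (X j) n))\<^sup>2) < \<epsilon>\<^sup>2 / 4"
    by (fastforce simp: sum_nonneg)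
  have "norm (Dg (X j) - 0) < \<epsilon>" if j: "j \<ge> M" for j
  proof -
    have "\<eta> * norm (X j) \<le> \<eta> * B"
      using bd[of j] \<eta> by (intro mult_left_mono) auto
    also have "\<dots> \<le> \<epsilon> / 2"
      using B e by (simp add: \<eta>_def field_simps)
    finally have "(\<eta> * norm (X j))\<^sup>2 \<le> (\<epsilon> / 2)\<^sup>2"
      using \<eta> by (intro power_mono) auto
    then have "(norm (Dg (X j)))\<^sup>2 < \<epsilon>\<^sup>2 / 4 + \<epsilon>\<^sup>2 / 4"
      using norm_Dg_sq_split[of N \<eta> "X j"] N M[OF j] by (simp add: power_mult_distrib power_divide)
    also have "\<dots> \<le> \<epsilon>\<^sup>2" by simp
    finally show ?thesis
      using e power2_less_imp_less[of "norm (Dg (X j))" \<epsilon>] by simp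
  qed
  then show "\<exists>M. \<forall>j\<ge>M. norm (Dg (X j) - 0) < \<epsilon>"
    by blast
qed

text \<open>A weak limit of points of the ball stays in the ball, and \<open>Dg\<close> turns weak
  into norm convergence; so the image itself is compact, not only its closure.\<close>

lemma compact_Dg_cball: "compact (Dg ` cball 0 C)"
  unfolding compact_eq_seq_compact_metric seq_compact_def
proof (intro allI impI)
  fix Z :: "nat \<Rightarrow> ell2" assume "\<forall>n. Z n \<in> Dg ` cball 0 C"
  then have "\<exists>x. norm x \<le> C \<and> Z n = Dg x" for n
    by (simp add: image_iff Bex_def)
  then obtain X where X: "\<And>n. norm (X n) \<le> C" "\<And>n. Z n = Dg (X n)"
    by metis
  obtain r y where r: "strict_mono (r :: nat \<Rightarrow> nat)" and y: "norm y \<le> C" "\<And>n. (\<lambda>j. coord (X (r j)) n) \<longlonglongrightarrow> coord y n"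
    using coordinatewise_subsequence_ell2[of X C, OF X(1)] by metis
  have "(\<lambda>j. Dg (X (r j) - y)) \<longlonglongrightarrow> 0"
  proof (rule Dg_tendsto_zero)
    show "norm (X (r j) - y) \<le> C + C" for j
      using norm_triangle_ineq4[of "X (r j)" y] X(1)[of "r j"] y(1) by linarith
    show "(\<lambda>j. coord (X (r j) - y) n) \<longlonglongrightarrow> 0" for n
      using tendsto_diff[OF y(2)[of n] tendsto_const[of "coord y n"]] by simp
  qed
  then have "(\<lambda>j. Dg (X (r j))) \<longlonglongrightarrow> Dg y"
    unfolding Dg_diff by (rule LIM_zero_cancel)
  then show "\<exists>l\<in>Dg ` cball 0 C. \<exists>r. strict_mono r \<and> (Z \<circ> r) \<longlonglongrightarrow> l"
    using r y(1) by (intro bexI[of _ "Dg y"] exI[of _ r]) (auto simp: X(2) o_def)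
qed

lemma compactin_Phi_image: "compactin (bergman_topology \<alpha>) (Phi ` K) \<longleftrightarrow> compact K"
proof -
  interpret Metric_space "A2 \<alpha>" "bergman_dist \<alpha>"
    by (rule Metric_space_bergman)
  have lim: "limitin mtopology (\<lambda>j. Phi (X j)) (Phi l) sequentially \<longleftrightarrow> X \<longlonglongrightarrow> l" for X l
    unfolding limit_metric_sequentially by (simp add: Phi_in_A2 bergman_dist_Phi lim_sequentially)
  show ?thesis
    unfolding compactin_sequentially compact_eq_seq_compact_metric seq_compact_def
  proof safe
    fix X :: "nat \<Rightarrow> ell2"
    assume X: "\<forall>n. X n \<in> K"
      and sub: "\<forall>\<sigma> :: nat \<Rightarrow> complex \<Rightarrow> complex. range \<sigma> \<subseteq> Phi ` K \<longrightarrow> (\<exists>l (r :: nat \<Rightarrow> nat). l \<in> Phi ` K \<and> strict_mono r \<and> limitin mtopology (\<sigma> \<circ> r) l sequentially)"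
    have "range (\<lambda>j. Phi (X j)) \<subseteq> Phi ` K"
      using X by auto
    from sub[rule_format, OF this] obtain l r where "l \<in> K" "strict_mono r"
      "limitin mtopology ((\<lambda>j. Phi (X j)) \<circ> r) (Phi l) sequentially"
      by (elim exE conjE imageE) simp
    then show "\<exists>l\<in>K. \<exists>r. strict_mono r \<and> (X \<circ> r) \<longlonglongrightarrow> l"
      using lim[of "\<lambda>j. X (r j)" l] by (auto simp: o_def)
  next
    fix \<sigma> :: "nat \<Rightarrow> complex \<Rightarrow> complex"
    assume \<sigma>: "range \<sigma> \<subseteq> Phi ` K"
      and sub: "\<forall>f :: nat \<Rightarrow> ell2. (\<forall>n. f n \<in> K) \<longrightarrow> (\<exists>l\<in>K. \<exists>r :: nat \<Rightarrow> nat. strict_mono r \<and> (f \<circ> r) \<longlonglongrightarrow> l)"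
    define X where "X j = Phi_inv (\<sigma> j)" for j
    have X: "X j \<in> K" "Phi (X j) = \<sigma> j" for j
      using \<sigma> by (auto simp: X_def image_subset_iff image_iff) (metis Phi_inv_Phi rangeI subset_iff imageE)+
    with sub[rule_format, of X] obtain l r where "l \<in> K" "strict_mono r" "(X \<circ> r) \<longlonglongrightarrow> l"
      by blast
    then show "\<exists>l r. l \<in> Phi ` K \<and> strict_mono r \<and> limitin mtopology (\<sigma> \<circ> r) l sequentially"
      using lim[of "\<lambda>j. X (r j)" l] by (intro exI[of _ "Phi l"] exI[of _ r]) (auto simp: o_def X(2))
  qed (auto simp: Phi_in_A2)
qed

text \<open>Compact sets are closed in a Hausdorff space, so the closure of the image of the ball is
  compact as soon as that image lies in some compact set; conversely that closure is such a
  set.\<close>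

lemma compact_op_iff:
  assumes \<phi>: "multiplier \<phi>"
  shows "compact_op_on_bergman \<alpha> (defect_op \<alpha> \<phi>) \<longleftrightarrow> (\<exists>K. compact K \<and> defect \<phi> ` cball 0 1 \<subseteq> K)"
proof -
  interpret Metric_space "A2 \<alpha>" "bergman_dist \<alpha>"
    by (rule Metric_space_bergman)
  have "{f \<in> A2 \<alpha>. bergman_dist \<alpha> f (\<lambda>_. 0) \<le> 1} = Phi ` cball 0 1"
    by (auto simp: bergman_dist_Phi_zero simp flip: range_Phi)
  then have img: "defect_op \<alpha> \<phi> ` {f \<in> A2 \<alpha>. bergman_dist \<alpha> f (\<lambda>_. 0) \<le> 1} = Phi ` defect \<phi> ` cball 0 1"
    by (simp add: image_image defect_op_Phi \<phi>)
  have sub: "defect_op \<alpha> \<phi> ` A2 \<alpha> \<subseteq> A2 \<alpha>"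
    unfolding defect_op_image[OF \<phi>] by (auto simp: Phi_in_A2)
  let ?S = "Phi ` defect \<phi> ` cball 0 1"
  have S: "?S \<subseteq> mtopology closure_of ?S"
    by (intro closure_of_subset) (auto simp: Phi_in_A2)
  show ?thesis
    unfolding compact_op_on_bergman_def img
  proof (safe intro!: sub[THEN subsetD])
    assume c: "compactin mtopology (mtopology closure_of ?S)"
    define K where "K = {x. Phi x \<in> mtopology closure_of ?S}"
    have "mtopology closure_of ?S \<subseteq> A2 \<alpha>"
      using compactin_subset_topspace[OF c] by simp
    then have "Phi ` K = mtopology closure_of ?S"
      unfolding K_def using range_Phi by auto
    then have "compact K"
      using c by (simp flip: compactin_Phi_image)
    moreover have "defect \<phi> ` cball 0 1 \<subseteq> K"
      using S by (auto simp: K_def)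
    ultimately show "\<exists>K. compact K \<and> defect \<phi> ` cball 0 1 \<subseteq> K"
      by blast
  next
    fix K assume K: "compact K" "defect \<phi> ` cball 0 1 \<subseteq> K"
    have "compactin mtopology (Phi ` K)"
      using K by (simp add: compactin_Phi_image)
    moreover from this have "closedin mtopology (Phi ` K)"
      by (rule compactin_imp_closedin[OF Hausdorff_space_mtopology])
    then have "mtopology closure_of ?S \<subseteq> Phi ` K"
      using K(2) by (intro closure_of_minimal) auto
    ultimately show "compactin mtopology (mtopology closure_of ?S)"
      by (rule closed_compactin) simp
  qed
qed

text \<open>A closed graph argument: \<open>D\<^sup>-\<^sup>1 E\<close> is everywhere defined and coordinatewise continuous,
  hence bounded by Baire's theorem.\<close>

lemma range_Dg_bounded_factor:
  fixes E :: "ell2 \<Rightarrow> ell2"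
  assumes E: "bounded_linear E" and sub: "range E \<subseteq> range Dg"
  obtains C where "\<And>x. \<exists>y. E x = Dg y \<and> norm y \<le> C * norm x"
proof -
  interpret E: bounded_linear E by fact
  have "\<exists>y. E x = Dg y" for x
    using sub by (auto simp: image_subset_iff image_iff)
  then obtain Y where Y: "\<And>x. E x = Dg (Y x)"
    by metis
  have Dlin: "linear Dg"
    by (rule bounded_linear.linear[OF bounded_linear_Dg])
  have Yadd: "Y (x + y) = Y x + Y y" and Yscale: "Y (c *\<^sub>R x) = c *\<^sub>R Y x" for x y c
  proof -
    have "Dg (Y (x + y)) = Dg (Y x + Y y)" "Dg (Y (c *\<^sub>R x)) = Dg (c *\<^sub>R Y x)"
      by (simp_all add: linear_add[OF Dlin] linear_scale[OF Dlin] E.add E.scaleR flip: Y)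
    then show "Y (x + y) = Y x + Y y" "Y (c *\<^sub>R x) = c *\<^sub>R Y x"
      by simp_all
  qed
  \<comment> \<open>These sets cover the space and are closed by lower semicontinuity under
    coordinatewise limits, so Baire's theorem finds one with an interior point.\<close>
  define F where "F M = {x. norm (Y x) \<le> real M}" for M :: nat
  have cY: "coord (Y x) n = coord (E x) n / of_real (lam \<alpha> n)" for x n
    unfolding Y by simp
  have closed: "closed (F M)" for M
  proof (unfold closed_sequential_limits, intro allI impI, elim conjE)
    fix X l assume X: "\<forall>n. X n \<in> F M" and l: "X \<longlonglongrightarrow> l"
    have "(\<lambda>j. coord (Y (X j)) n) \<longlonglongrightarrow> coord (Y l) n" for n
      unfolding cY by (intro tendsto_divide tendsto_const bounded_linear.tendsto[OF bounded_linear_coord] E.tendsto l) simp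
    from coordwise_limit_ell2(2)[OF this, of "real M"] X show "l \<in> F M"
      by (simp add: F_def coord_inverse)
  qed
  have "\<exists>M. interior (F M) \<noteq> {}"
  proof (rule ccontr)
    assume "\<not> ?thesis"
    then have "Met_TC.mtopology interior_of \<Union>(range F) = {}"
      using closed
      by (intro Met_TC.metric_Baire_category_alt) (auto simp: complete_UNIV)
    moreover have "\<Union>(range F) = UNIV"
      using real_arch_simple[of "norm (Y _)"] by (auto simp: F_def)
    ultimately show False
      by simp
  qed
  then obtain M x0 \<rho> where "0 < \<rho>" and ball: "ball x0 \<rho> \<subseteq> F M"
    by (metis all_not_in_conv interior_subset mem_interior)
  \<comment> \<open>\<open>Y x\<close> is the difference of the values of \<open>Y\<close> at
    \<open>x0 + x\<close> and \<open>x0\<close>, and both points lie in \<open>F M\<close>.\<close>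
  have small: "norm (Y x) \<le> 2 * real M" if "norm x < \<rho>" for x
  proof -
    have "x0 + x \<in> F M" "x0 \<in> F M"
      using that \<open>0 < \<rho>\<close> by (auto intro!: subsetD[OF ball] simp: dist_norm)
    then have "norm (Y x0 + Y x) \<le> M" "norm (Y x0) \<le> M"
      by (auto simp: F_def Yadd)
    then show ?thesis
      using norm_triangle_ineq4[of "Y x0 + Y x" "Y x0"] by simp
  qed
  have "norm (Y x) \<le> (4 * real M / \<rho>) * norm x" for x
  proof (cases "x = 0")
    case True
    then show ?thesis using Yscale[of 0 0] by simp
  next
    case False
    \<comment> \<open>Scales \<open>x\<close> to norm \<open>\<rho> / 2\<close>, inside the ball;
      this produces the constant \<open>4 * M / \<rho>\<close>.\<close>
    define c where "c = \<rho> / (2 * norm x)"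
    have c: "0 < c" using False \<open>0 < \<rho>\<close> by (simp add: c_def)
    have "norm (c *\<^sub>R x) < \<rho>"
      using c False \<open>0 < \<rho>\<close> by (simp add: c_def)
    from small[OF this] have "c * norm (Y x) \<le> 2 * real M"
      using c by (simp add: Yscale)
    then show ?thesis
      using c False \<open>0 < \<rho>\<close> by (simp add: c_def field_simps)
  qed
  then show ?thesis
    using that[of "4 * real M / \<rho>"] Y by blast
qed

lemma range_subset_imp_compact:
  assumes \<phi>: "multiplier \<phi>" and sub: "range (defect \<phi>) \<subseteq> range Dg"
  shows "\<exists>K. compact K \<and> defect \<phi> ` cball 0 1 \<subseteq> K"
proof -
  obtain C where C: "\<And>x. \<exists>y. defect \<phi> x = Dg y \<and> norm y \<le> C * norm x"
    using range_Dg_bounded_factor[OF bounded_linear_defect[OF \<phi>] sub] by blast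
  have "defect \<phi> x \<in> Dg ` cball 0 \<bar>C\<bar>" if "norm x \<le> 1" for x
  proof -
    obtain y where y: "defect \<phi> x = Dg y" "norm y \<le> C * norm x"
      using C by blast
    have "C * norm x \<le> \<bar>C\<bar> * 1"
      using that by (intro mult_mono) auto
    then show ?thesis
      using y by auto
  qed
  then show ?thesis
    by (intro exI[of _ "Dg ` cball 0 \<bar>C\<bar>"]) (auto simp: compact_Dg_cball)
qed

section \<open>Reproducing kernels\<close>

text \<open>The coordinates of the reproducing kernel at \<open>w\<close>, which as a function of
  \<open>z\<close> is \<open>(1 - cnj w * z)\<close> to the power
  \<open>- (\<alpha> + 2)\<close>.\<close>

definition kap :: "complex \<Rightarrow> ell2" where
  "kap w = Abs_ell2 (\<lambda>n. cnj w ^ n / of_real (sqrt (wt \<alpha> n)))"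

lemma kap_coords:
  assumes w: "cmod w < 1"
  shows "coord (kap w) n = cnj w ^ n / of_real (sqrt (wt \<alpha> n))"
    and "(norm (kap w))\<^sup>2 = (\<Sum>n. ((cmod w)\<^sup>2) ^ n / wt \<alpha> n)"
proof -
  have eq: "(cmod (cnj w ^ n / of_real (sqrt (wt \<alpha> n))))\<^sup>2 = ((cmod w)\<^sup>2) ^ n / wt \<alpha> n" for n
    by (simp add: norm_divide norm_power power_divide power_mult[symmetric] mult.commute)
  have s: "summable (\<lambda>n. ((cmod w)\<^sup>2) ^ n / wt \<alpha> n)"
    using w by (intro summable_power_div_wt) (auto simp: abs_square_less_1)
  then have c: "coord (kap w) = (\<lambda>n. cnj w ^ n / of_real (sqrt (wt \<alpha> n)))"
    unfolding kap_def by (intro coord_Abs_ell2) (simp only: eq)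
  then show "coord (kap w) n = cnj w ^ n / of_real (sqrt (wt \<alpha> n))"
    by simp
  show "(norm (kap w))\<^sup>2 = (\<Sum>n. ((cmod w)\<^sup>2) ^ n / wt \<alpha> n)"
    unfolding norm_ell2_sq c by (simp only: eq)
qed

lemma inner_kap:
  assumes w: "cmod w < 1"
  shows "inner x (kap w) = Re (Phi x w)"
proof -
  have "(\<lambda>n. Re (coord x n / of_real (sqrt (wt \<alpha> n)) * w ^ n)) sums Re (Phi x w)"
    by (intro sums_Re Phi_sums w)
  moreover have "Re (coord x n * cnj (coord (kap w) n)) = Re (coord x n / of_real (sqrt (wt \<alpha> n)) * w ^ n)" for n
    by (simp add: kap_coords(1)[OF w])
  ultimately show ?thesis
    unfolding inner_ell2_def by (simp add: sums_iff)
qed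

text \<open>Evaluation at \<open>w\<close> sees multiplication by \<phi> as multiplication by the
  number \<open>\<phi> w\<close>, so kernels are eigenvectors of the adjoint.\<close>

lemma adj_kap:
  assumes \<phi>: "multiplier \<phi>" and w: "cmod w < 1"
  shows "adj \<phi> (kap w) = mop (\<lambda>_. cnj (\<phi> w)) (kap w)"
proof (rule inner_eq_left_imp_eq)
  fix x
  have "inner x (adj \<phi> (kap w)) = Re (\<phi> w * Phi x w)"
    using w by (simp add: inner_adj \<phi> inner_kap Phi_mop)
  also have "\<dots> = inner (mop (\<lambda>_. \<phi> w) x) (kap w)"
    using w by (simp add: inner_kap Phi_mop multiplier_const)
  also have "\<dots> = inner x (mop (\<lambda>_. cnj (\<phi> w)) (kap w))"
    by (simp add: adj_const inner_adj[symmetric] multiplier_const)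
  finally show "inner x (adj \<phi> (kap w)) = inner x (mop (\<lambda>_. cnj (\<phi> w)) (kap w))" .
qed

lemma inner_defect_kap:
  assumes \<phi>: "multiplier \<phi>" and w: "cmod w < 1"
  shows "inner (defect \<phi> (kap w)) (kap w) = (1 - (cmod (\<phi> w))\<^sup>2) * (norm (kap w))\<^sup>2"
proof -
  have "inner (defect \<phi> (kap w)) (kap w) = (norm (kap w))\<^sup>2 - (norm (adj \<phi> (kap w)))\<^sup>2"
    by (simp add: defect_def inner_diff_left inner_adj[OF \<phi>, symmetric] power2_norm_eq_inner)
  then show ?thesis
    by (simp add: adj_kap[OF \<phi> w] norm_mop_const power_mult_distrib algebra_simps)
qed

text \<open>The weights decrease, so near the boundary the first \<open>N\<close> terms of the
  squared norm exceed any number below \<open>N / wt \<alpha> 0\<close>, and \<open>N\<close> is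
  arbitrary.\<close>

lemma norm_kap_at_top:
  assumes w: "\<And>j. cmod (w j) < 1" and lim: "(\<lambda>j. cmod (w j)) \<longlonglongrightarrow> 1"
  shows "filterlim (\<lambda>j. norm (kap (w j))) at_top sequentially"
proof -
  have wle: "wt \<alpha> n \<le> wt \<alpha> 0" for n
  proof (induction n)
    case (Suc n)
    have "real (Suc n) / (real (Suc n) + \<alpha> + 1) \<le> 1"
      using alpha by simp
    then have "wt \<alpha> (Suc n) \<le> 1 * wt \<alpha> n"
      unfolding wt_Suc[OF alpha] by (intro mult_right_mono) auto
    with Suc show ?case by simp
  qed simp
  have low: "(\<Sum>n<N. ((cmod (w j))\<^sup>2) ^ n) / wt \<alpha> 0 \<le> (norm (kap (w j)))\<^sup>2" for N j
  proof -
    have "(\<Sum>n<N. ((cmod (w j))\<^sup>2) ^ n) / wt \<alpha> 0 \<le> (\<Sum>n<N. ((cmod (w j))\<^sup>2) ^ n / wt \<alpha> n)"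
      unfolding sum_divide_distrib using wle by (intro sum_mono divide_left_mono) auto
    also have "\<dots> \<le> (\<Sum>n. ((cmod (w j))\<^sup>2) ^ n / wt \<alpha> n)"
      using w by (intro sum_le_suminf summable_power_div_wt) (auto simp: abs_square_less_1)
    finally show ?thesis
      by (simp add: kap_coords(2)[OF w])
  qed
  show ?thesis
    unfolding filterlim_at_top
  proof
    fix Z :: real
    obtain N where N: "(\<bar>Z\<bar>\<^sup>2 + 1) * wt \<alpha> 0 < real N"
      using reals_Archimedean2 by blast
    have "(\<lambda>j. (\<Sum>n<N. ((cmod (w j))\<^sup>2) ^ n)) \<longlonglongrightarrow> (\<Sum>n<N. (1\<^sup>2) ^ n)"
      by (intro tendsto_intros lim)
    then have "\<forall>\<^sub>F j in sequentially. (\<bar>Z\<bar>\<^sup>2 + 1) * wt \<alpha> 0 < (\<Sum>n<N. ((cmod (w j))\<^sup>2) ^ n)"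
      using N by (intro order_tendstoD(1)) auto
    then show "\<forall>\<^sub>F j in sequentially. Z \<le> norm (kap (w j))"
    proof eventually_elim
      case (elim j)
      then have "\<bar>Z\<bar>\<^sup>2 + 1 \<le> (\<Sum>n<N. ((cmod (w j))\<^sup>2) ^ n) / wt \<alpha> 0"
        by (simp add: pos_le_divide_eq)
      then have "\<bar>Z\<bar>\<^sup>2 \<le> (norm (kap (w j)))\<^sup>2"
        using low[where N = N and j = j] by linarith
      then have "\<bar>Z\<bar> \<le> norm (kap (w j))"
        by (rule power2_le_imp_le) simp
      then show ?case by linarith
    qed
  qed
qed

text \<open>Normalized kernels tend weakly to 0 at the boundary, because each coordinate of the
  kernels is bounded while their norms grow. Compactness makes the images norm convergent along a
  subsequence, so the quadratic form of the defect operator tends to 0 there and cannot stay above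
  \<epsilon>.\<close>

lemma compact_defect_boundary:
  assumes \<phi>: "multiplier \<phi>" and K: "compact K" "defect \<phi> ` cball 0 1 \<subseteq> K" and e: "0 < \<epsilon>"
  shows "\<exists>\<rho><1. \<forall>w. \<rho> < cmod w \<longrightarrow> cmod w < 1 \<longrightarrow> 1 - (cmod (\<phi> w))\<^sup>2 < \<epsilon>"
proof (rule ccontr)
  assume neg: "\<not> ?thesis"
  have "\<exists>w. 1 - 1 / real (Suc j) < cmod w \<and> cmod w < 1 \<and> \<epsilon> \<le> 1 - (cmod (\<phi> w))\<^sup>2" for j
    using neg by (force simp: not_less)
  then obtain w where w: "\<And>j. 1 - 1 / real (Suc j) < cmod (w j)" "\<And>j. cmod (w j) < 1"
    "\<And>j. \<epsilon> \<le> 1 - (cmod (\<phi> (w j)))\<^sup>2"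
    by metis
  have lim: "(\<lambda>j. cmod (w j)) \<longlonglongrightarrow> 1"
  proof (rule tendsto_sandwich[OF _ _ _ tendsto_const])
    show "(\<lambda>j. 1 - 1 / real (Suc j)) \<longlonglongrightarrow> 1"
      by real_asymp
  qed (use w in \<open>auto intro!: always_eventually less_imp_le simp del: of_nat_Suc\<close>)
  define k where "k j = (1 / norm (kap (w j))) *\<^sub>R kap (w j)" for j
  have top: "filterlim (\<lambda>j. norm (kap (w j))) at_top sequentially"
    by (rule norm_kap_at_top[OF w(2) lim])
  have nz: "kap (w j) \<noteq> 0" for j
  proof
    assume "kap (w j) = 0"
    then have "coord (kap (w j)) 0 = 0" by simp
    then show False by (simp add: kap_coords(1)[OF w(2)])
  qed
  have nk: "norm (k j) \<le> 1" for j
    using nz by (simp add: k_def)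
  have Ek: "\<epsilon> \<le> inner (defect \<phi> (k j)) (k j)" for j
  proof -
    have "defect \<phi> (k j) = (1 / norm (kap (w j))) *\<^sub>R defect \<phi> (kap (w j))"
      unfolding k_def by (rule linear_scale[OF bounded_linear.linear[OF bounded_linear_defect[OF \<phi>]]])
    then have "inner (defect \<phi> (k j)) (k j) = inner (defect \<phi> (kap (w j))) (kap (w j)) / (norm (kap (w j)))\<^sup>2"
      by (simp add: k_def power2_eq_square)
    also have "\<dots> = 1 - (cmod (\<phi> (w j)))\<^sup>2"
      using nz by (simp add: inner_defect_kap[OF \<phi> w(2)])
    finally show ?thesis using w(3) by simp
  qed
  have "\<forall>j. defect \<phi> (k j) \<in> K"
    using K(2) nk by (auto simp: image_subset_iff)
  with K(1)[unfolded compact_eq_seq_compact_metric seq_compact_def, rule_format, of "\<lambda>j. defect \<phi> (k j)"]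
  obtain y r where r: "strict_mono (r :: nat \<Rightarrow> nat)" and y: "(\<lambda>j. defect \<phi> (k (r j))) \<longlonglongrightarrow> y"
    by (auto simp: o_def)
  have "(\<lambda>j. coord (k j) n) \<longlonglongrightarrow> 0" for n
  proof (rule tendsto_norm_zero_cancel, rule tendsto_sandwich[OF _ _ tendsto_const])
    have "(\<lambda>j. inverse (norm (kap (w j))) * (1 / sqrt (wt \<alpha> n))) \<longlonglongrightarrow> 0 * (1 / sqrt (wt \<alpha> n))"
      by (intro tendsto_mult tendsto_const tendsto_inverse_0_at_top top)
    then show "(\<lambda>j. inverse (norm (kap (w j))) * (1 / sqrt (wt \<alpha> n))) \<longlonglongrightarrow> 0"
      by simp
    show "\<forall>\<^sub>F j in sequentially. norm (coord (k j) n) \<le> inverse (norm (kap (w j))) * (1 / sqrt (wt \<alpha> n))"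
    proof (rule always_eventually, rule allI)
      fix j
      have "cmod (coord (kap (w j)) n) \<le> 1 / sqrt (wt \<alpha> n)"
        using w(2)[of j] by (simp add: kap_coords(1)[OF w(2)] norm_divide norm_power power_le_one divide_right_mono)
      then have "inverse (norm (kap (w j))) * cmod (coord (kap (w j)) n) \<le> inverse (norm (kap (w j))) * (1 / sqrt (wt \<alpha> n))"
        by (intro mult_left_mono) auto
      then show "norm (coord (k j) n) \<le> inverse (norm (kap (w j))) * (1 / sqrt (wt \<alpha> n))"
        by (simp add: k_def inverse_eq_divide)
    qed
  qed auto
  then have "(\<lambda>j. coord (k (r j)) n) \<longlonglongrightarrow> 0" for n
    using LIMSEQ_subseq_LIMSEQ[OF _ r] by (force simp: o_def)
  then have "(\<lambda>j. inner y (k (r j))) \<longlonglongrightarrow> 0"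
    by (intro inner_tendsto_zero_ell2[where B = 1] nk)
  \<comment> \<open>The form splits into \<open>inner y (k (r j))\<close>, small by weak
    convergence, and this remainder, small by norm convergence of the images.\<close>
  moreover have "(\<lambda>j. inner (defect \<phi> (k (r j)) - y) (k (r j))) \<longlonglongrightarrow> 0"
  proof (rule tendsto_norm_zero_cancel, rule tendsto_sandwich[OF _ _ tendsto_const])
    show "(\<lambda>j. norm (defect \<phi> (k (r j)) - y)) \<longlonglongrightarrow> 0"
      using y by (intro tendsto_norm_zero LIM_zero)
    show "\<forall>\<^sub>F j in sequentially. norm (inner (defect \<phi> (k (r j)) - y) (k (r j))) \<le> norm (defect \<phi> (k (r j)) - y)"
    proof (rule always_eventually, rule allI)
      fix j
      show "norm (inner (defect \<phi> (k (r j)) - y) (k (r j))) \<le> norm (defect \<phi> (k (r j)) - y)"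
        using Cauchy_Schwarz_ineq2[of "defect \<phi> (k (r j)) - y" "k (r j)"]
          mult_left_mono[OF nk[of "r j"], of "norm (defect \<phi> (k (r j)) - y)"] by simp
    qed
  qed auto
  ultimately have "(\<lambda>j. inner y (k (r j)) + inner (defect \<phi> (k (r j)) - y) (k (r j))) \<longlonglongrightarrow> 0 + 0"
    by (rule tendsto_add)
  then have "(\<lambda>j. inner (defect \<phi> (k (r j))) (k (r j))) \<longlonglongrightarrow> 0"
    by (simp add: inner_diff_left)
  then have "\<epsilon> \<le> 0"
    by (rule LIMSEQ_le_const) (use Ek in blast)
  with e show False by simp
qed

lemma compact_defect_imp_blaschke:
  assumes hol: "\<phi> holomorphic_on unit_disc" and le: "\<And>z. cmod z < 1 \<Longrightarrow> cmod (\<phi> z) \<le> 1"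
    and K: "compact K" "defect \<phi> ` cball 0 1 \<subseteq> K"
  shows "finite_blaschke_product \<phi>"
proof -
  have \<phi>: "multiplier \<phi>"
    by (rule multiplierI[OF hol le])
  have "asymptotically_inner \<phi>"
    unfolding asymptotically_inner_def
  proof (intro conjI allI impI hol le)
    fix \<epsilon> :: real assume "0 < \<epsilon>"
    from compact_defect_boundary[OF \<phi> K this] obtain \<rho> where \<rho>: "\<rho> < 1"
      "\<And>w. \<rho> < cmod w \<Longrightarrow> cmod w < 1 \<Longrightarrow> 1 - (cmod (\<phi> w))\<^sup>2 < \<epsilon>"
      by blast
    have "1 - \<epsilon> \<le> cmod (\<phi> w)" if "\<rho> < cmod w" "cmod w < 1" for w
    proof -
      have "(cmod (\<phi> w))\<^sup>2 \<le> cmod (\<phi> w)"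
        using le[OF that(2)] by (simp add: power2_eq_square mult_left_le)
      then show ?thesis
        using \<rho>(2)[OF that] by linarith
    qed
    then show "\<exists>\<rho><1. \<forall>w. \<rho> < cmod w \<longrightarrow> cmod w < 1 \<longrightarrow> 1 - \<epsilon> \<le> cmod (\<phi> w)"
      using \<rho>(1) by blast
  qed
  then show ?thesis
    by (rule asymptotically_inner_imp_blaschke)
qed

end

theorem theorem15:
  fixes \<alpha> :: real and \<phi> :: "complex \<Rightarrow> complex"
  assumes "\<alpha> > -1"
    and "\<phi> holomorphic_on unit_disc"
    and "\<forall>z\<in>unit_disc. cmod (\<phi> z) \<le> 1"
  shows "(compact_op_on_bergman \<alpha> (defect_op \<alpha> \<phi>) \<longleftrightarrow> finite_blaschke_product \<phi>) \<and>
    (finite_blaschke_product \<phi> \<longleftrightarrow> defect_op \<alpha> \<phi> ` A2 \<alpha> \<subseteq> A2 (\<alpha> - 2)) \<and>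
    (\<not> (\<exists>c. cmod c = 1 \<and> (\<forall>z\<in>unit_disc. \<phi> z = c)) \<longrightarrow>
      (finite_blaschke_product \<phi> \<longleftrightarrow> defect_op \<alpha> \<phi> ` A2 \<alpha> = A2 (\<alpha> - 2)))"
proof -
  interpret bergman \<alpha>
    by standard (rule assms(1))
  have le: "cmod (\<phi> z) \<le> 1" if "cmod z < 1" for z
    using assms(3) that by simp
  have \<phi>: "multiplier \<phi>"
    by (rule multiplierI[OF assms(2) le])
  have a_iff: "compact_op_on_bergman \<alpha> (defect_op \<alpha> \<phi>) \<longleftrightarrow> (\<exists>K. compact K \<and> defect \<phi> ` cball 0 1 \<subseteq> K)"
    by (rule compact_op_iff[OF \<phi>])
  have d_iff: "defect_op \<alpha> \<phi> ` A2 \<alpha> \<subseteq> A2 (\<alpha> - 2) \<longleftrightarrow> range (defect \<phi>) \<subseteq> range Dg"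
    unfolding defect_op_image[OF \<phi>] by (rule range_subset_iff_Dg)
  have c_iff: "defect_op \<alpha> \<phi> ` A2 \<alpha> = A2 (\<alpha> - 2) \<longleftrightarrow> range (defect \<phi>) = range Dg"
    unfolding defect_op_image[OF \<phi>] by (rule range_eq_iff_Dg)
  have ab: "finite_blaschke_product \<phi>" if "compact K" "defect \<phi> ` cball 0 1 \<subseteq> K" for K
    by (rule compact_defect_imp_blaschke[OF assms(2) le that])
  have da: "\<exists>K. compact K \<and> defect \<phi> ` cball 0 1 \<subseteq> K" if "range (defect \<phi>) \<subseteq> range Dg"
    by (rule range_subset_imp_compact[OF \<phi> that])
  have bd: "range (defect \<phi>) \<subseteq> range Dg" if "finite_blaschke_product \<phi>"
    by (rule blaschke_range(1)[OF \<phi> that])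
  have bc: "range (defect \<phi>) = range Dg"
    if "finite_blaschke_product \<phi>" "\<not> (\<exists>c. cmod c = 1 \<and> (\<forall>z\<in>unit_disc. \<phi> z = c))"
    by (rule blaschke_range(2)[OF \<phi> that])
  \<comment> \<open>The cycle runs from (a) to (b) to (d) and back to (a); (c) implies (d), and is
    reached from (b) outside the unimodular constants.\<close>
  show ?thesis
    unfolding a_iff d_iff c_iff using ab da bd bc by blast
qed

end
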